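(* Let $0<s<1$ and $1<p<\infty$. For any positive $f\in L^1(\mathbb{R}^n)\cap C(\mathbb{R}^n)$ that is not radially decreasing about any center, there are constants $\gamma=\gamma(n,s,p,f)>0$, $\tau_0=\tau_0(f)>0$, and a hyperplane $H\subset\mathbb{R}^n$ such that $$[f^{\tau}]_{W^{s,p}(\mathbb{R}^n)}^p \le [f]_{W^{s,p}(\mathbb{R}^n)}^p-\gamma\tau\qquad\text{for all } 0\le\tau\le\tau_0,$$ where $f^\tau$ is the continuous Steiner symmetrization of $f$ about $H$.
   Context: Seminorm: $[f]_{W^{s,p}(\mathbb{R}^n)}^p=\int_{\mathbb{R}^n}\int_{\mathbb{R}^n}\frac{|f(x)-f(y)|^p}{|x-y|^{n+sp}}\,dx\,dy$. A function $f$ is radially decreasing about a center $x_0$ if $f(x)=\Phi(|x-x_0|)$ with $\Phi$ non-increasing. Continuous Steiner symmetrization of open sets $U\subset\mathbb{R}$, denoted $M^\tau(U)$, $\tau\ge0$: (1) If $U=(y_-,y_+)$, then $M^\tau(U)=(y_-^\tau,y_+^\tau)$ with $y_\pm^\tau=y_\pm-\tau\,\mathrm{sgn}(y_++y_-)$ for $0<\tau\le|y_++y_-|/2$, and $y_\pm^\tau=\pm(y_+-y_-)/2$ for $\tau>|y_++y_-|/2$. (2) If $U=\bigcup_{i=1}^m I_i$ is a finite union of disjoint open intervals, then $M^\tau(U)=\bigcup_{i=1}^m M^\tau(I_i)$ for $0\le\tau<\tau_1$, where $\tau_1$ is the first time two of the intervals $M^\tau(I_i)$ touch; at $\tau_1$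 the two intervals are merged into one and the process is restarted. (3) If $U=\bigcup_{i=1}^\infty I_i$ is a countable union of disjoint open intervals, then $M^\tau(U)=\bigcup_{m=1}^\infty M^\tau(U_m)$ with $U_m=\bigcup_{i=1}^m I_i$. Continuous Steiner symmetrization of a function: write $x=(x',x_n)\in\mathbb{R}^{n-1}\times\mathbb{R}$. For nonnegative $f\in L^1(\mathbb{R}^n)\cap C(\mathbb{R}^n)$ let $U_{x'}^h=\{x_n\in\mathbb{R}: f(x',x_n)>h\}$, and, for the hyperplane $\{x_n=0\}$ (direction $e_n$), $f^\tau(x)=\int_0^\infty\chi_{M^\tau(U_{x'}^h)}(x_n)\,dh$. For a general hyperplane $H$, $f^\tau$ is defined by the same procedure after a rigid motion of $\mathbb{R}^n$ taking $H$ to $\{x_n=0\}$. *)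

theory Defs
  imports "HOL-Analysis.Analysis"
begin

section \<open>The fractional Sobolev seminorm\<close>

text \<open>The p-th power of the seminorm; it takes the value \<open>\<infinity>\<close> when \<open>f\<close> is not in the space.\<close>

definition sobolev_seminorm_powr :: "real \<Rightarrow> real \<Rightarrow> (real^'n \<Rightarrow> real) \<Rightarrow> ennreal" where
  "sobolev_seminorm_powr s p f =
     (\<integral>\<^sup>+y. \<integral>\<^sup>+x. ennreal (\<bar>f x - f y\<bar> powr p / norm (x - y) powr (real CARD('n) + s * p))
        \<partial>lborel \<partial>lborel)"

definition radially_decreasing_about :: "real^'n \<Rightarrow> (real^'n \<Rightarrow> real) \<Rightarrow> bool" where
  "radially_decreasing_about x0 f \<longleftrightarrow>
     (\<exists>\<Phi>::real \<Rightarrow> real. antimono_on {0..} \<Phi> \<and> (\<forall>x. f x = \<Phi> (norm (x - x0))))"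

section \<open>Continuous Steiner symmetrization of open sets of reals\<close>

text \<open>A bounded open interval is represented by its pair of endpoints, and a finite disjoint
  union of such intervals by the list of its members, ordered from left to right.\<close>

fun move_interval :: "real \<Rightarrow> real \<times> real \<Rightarrow> real \<times> real" where
  "move_interval \<tau> (a, b) =
     (if \<tau> \<le> \<bar>b + a\<bar> / 2 then (a - \<tau> * sgn (b + a), b - \<tau> * sgn (b + a))
      else (- (b - a) / 2, (b - a) / 2))"

text \<open>In an ordered list of disjoint intervals the first contact is between neighbours.\<close>

definition touching :: "(real \<times> real) list \<Rightarrow> bool" where
  "touching Is \<longleftrightarrow> (\<exists>i. Suc i < length Is \<and> snd (Is ! i) = fst (Is ! Suc i))"

definition touching_times :: "(real \<times> real) list \<Rightarrow> real set" where
  "touching_times Is = {\<sigma>. 0 \<le> \<sigma> \<and> touching (map (move_interval \<sigma>) Is)}"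

fun merge_touching :: "(real \<times> real) list \<Rightarrow> (real \<times> real) list" where
  "merge_touching ((a, b) # (c, d) # Is) =
     (if b = c then merge_touching ((a, d) # Is) else (a, b) # merge_touching ((c, d) # Is))"
| "merge_touching Is = Is"

lemma length_merge_touching_le: "length (merge_touching Is) \<le> length Is"
  by (induction Is rule: merge_touching.induct) auto

lemma length_merge_touching_less:
  assumes "touching Is"
  shows "length (merge_touching Is) < length Is"
  using assms
proof (induction Is rule: merge_touching.induct)
  case (1 a b c d Is)
  show ?case
  proof (cases "b = c")
    case True
    then show ?thesis
      using length_merge_touching_le[of "(a, d) # Is"] by simp
  next
    case False
    obtain i where i: "Suc i < length ((a, b) # (c, d) # Is)"
      "snd (((a, b) # (c, d) # Is) ! i) = fst (((a, b) # (c, d) # Is) ! Suc i)"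
      using 1(3) unfolding touching_def by blast
    with False obtain j where "i = Suc j"
      by (cases i) auto
    with i have "touching ((c, d) # Is)"
      unfolding touching_def by auto
    with 1(2) False show ?thesis by simp
  qed
qed (auto simp: touching_def)

lemma move_interval_eq:
  assumes "0 \<le> \<tau>"
  shows "move_interval \<tau> I =
    (fst I - min \<tau> (\<bar>snd I + fst I\<bar> / 2) * sgn (snd I + fst I),
     snd I - min \<tau> (\<bar>snd I + fst I\<bar> / 2) * sgn (snd I + fst I))"
  using assms by (cases I) (auto simp: min_def sgn_if field_simps)

lemma closed_touching_times: "closed (touching_times Is)"
proof -
  define g where "g I \<sigma> = min \<sigma> (\<bar>snd I + fst I\<bar> / 2) * sgn (snd I + fst I)"
    for I :: "real \<times> real" and \<sigma>
  have "touching_times Is = (\<Union>i\<in>{i. Suc i < length Is}.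
      {0..} \<inter> {\<sigma>. snd (Is ! i) - g (Is ! i) \<sigma> = fst (Is ! Suc i) - g (Is ! Suc i) \<sigma>})"
    unfolding touching_times_def touching_def g_def by (auto simp: move_interval_eq)
  moreover have "finite {i. Suc i < length Is}"
    by (rule finite_subset[of _ "{..<length Is}"]) auto
  moreover have "closed ({0..} \<inter>
      {\<sigma>. snd (Is ! i) - g (Is ! i) \<sigma> = fst (Is ! Suc i) - g (Is ! Suc i) \<sigma>})" for i
    unfolding g_def by (intro closed_Int closed_Collect_eq continuous_intros) auto
  ultimately show ?thesis by (simp only:) (intro closed_UN ballI)
qed

lemma Inf_touching_times:
  assumes "touching_times Is \<noteq> {}"
  shows "Inf (touching_times Is) \<in> touching_times Is"
  using assms closed_touching_times
  by (intro closed_contains_Inf) (auto simp: touching_times_def intro!: bdd_belowI[of _ 0])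

function evolve :: "real \<Rightarrow> (real \<times> real) list \<Rightarrow> (real \<times> real) list" where
  "evolve \<tau> Is =
     (if \<exists>\<sigma>\<in>touching_times Is. \<sigma> \<le> \<tau> then
        let \<tau>1 = Inf (touching_times Is)
        in evolve (\<tau> - \<tau>1) (merge_touching (map (move_interval \<tau>1) Is))
      else map (move_interval \<tau>) Is)"
  by pat_completeness auto
termination
proof (relation "Wellfounded.measure (\<lambda>(\<tau>, Is). length Is)", goal_cases)
  case (2 \<tau> Is \<tau>1)
  then have "touching (map (move_interval \<tau>1) Is)"
    using Inf_touching_times[of Is] by (auto simp: touching_times_def)
  from length_merge_touching_less[OF this] show ?case by simp
qed simp

declare evolve.simps [simp del]

definition interval_list :: "real set set \<Rightarrow> (real \<times> real) list" where
  "interval_list C = (THE Is. sorted_wrt (\<lambda>I J. snd I \<le> fst J) Is \<and> set Is = (\<lambda>I. (Inf I, Sup I)) ` C)"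

definition csteiner_finite :: "real \<Rightarrow> real set set \<Rightarrow> real set" where
  "csteiner_finite \<tau> C = (\<Union>(a, b)\<in>set (evolve \<tau> (interval_list C)). {a<..<b})"

text \<open>The intervals making up an open set are its connected components.\<close>

definition csteiner_bounded :: "real \<Rightarrow> real set \<Rightarrow> real set" where
  "csteiner_bounded \<tau> U =
     (if finite (components U) then csteiner_finite \<tau> (components U)
      else (\<Union>m. csteiner_finite \<tau> (from_nat_into (components U) ` {..<m})))"

text \<open>The formulas for the endpoints presuppose bounded intervals. A set with an unbounded
  component is exhausted by bounded sets, so that for instance \<open>{a<..}\<close> moves to \<open>{a - \<tau><..}\<close>.
  For a continuous integrable \<open>f\<close>, almost every line meets the sets \<open>{f > h}\<close>, \<open>h > 0\<close>, in sets
  of finite length, so this case does not influence the seminorm of the symmetrization.\<close>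

definition csteiner_set :: "real \<Rightarrow> real set \<Rightarrow> real set" where
  "csteiner_set \<tau> U =
     (if \<forall>I\<in>components U. bounded I then csteiner_bounded \<tau> U
      else (\<Union>k::nat. csteiner_bounded \<tau> (U \<inter> {- real k<..<real k})))"

section \<open>Continuous Steiner symmetrization of functions\<close>

text \<open>The hyperplane is \<open>{x. e \<bullet> x = c}\<close> with \<open>norm e = 1\<close>. A rigid motion taking it to
  \<open>{x. x\<^sub>n = 0}\<close> and \<open>e\<close> to the last unit vector turns \<open>x = z + t *\<^sub>R e\<close>, with \<open>z\<close> the foot point
  of \<open>x\<close> on the hyperplane, into the point with \<open>x'\<close> the image of \<open>z\<close> and \<open>x\<^sub>n = t\<close>.\<close>

definition csteiner :: "real^'n \<Rightarrow> real \<Rightarrow> real \<Rightarrow> (real^'n \<Rightarrow> real) \<Rightarrow> real^'n \<Rightarrow> real" where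
  "csteiner e c \<tau> f x =
     (let t = e \<bullet> x - c; z = x - t *\<^sub>R e
      in set_lebesgue_integral lborel {0<..}
           (\<lambda>h. indicator (csteiner_set \<tau> {r. f (z + r *\<^sub>R e) > h}) t))"

end

theory Submission
  imports Defs
begin

text \<open>Slicing all level sets of \<open>f\<close> by lines in the direction \<open>e\<close> and writing \<open>\<bar>a - b\<bar>\<^sup>p\<close> as a
  superposition of products of level indicators turns the energy into a constant minus a positive
  combination of interactions \<open>\<integral>\<integral> k (t - s)\<close> over pairs \<open>U \<times> V\<close> of one-dimensional level sets, with
  \<open>k\<close> even and decreasing. Under the flow the midpoint of an interval moves by soft thresholding,
  which is a contraction, and the interaction of two intervals increases as their midpoints
  approach each other; hence no interaction decreases.

  A linear rate needs only an open set of lines and levels on which two pieces approach each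
  other at a definite speed. If \<open>f\<close> has a valley on some line, put the hyperplane at its bottom.
  Otherwise all level sets are convex and every slice is an interval. If two slices in one direction
  have different midpoints, put the hyperplane between them. If this happens in no direction, \<open>f\<close> is
  symmetric about a hyperplane orthogonal to each direction, hence radially decreasing.\<close>

text \<open>With the singular kernel, the constant and the interaction are both infinite and cannot
  be subtracted, and the seminorm of \<open>f\<close> may be infinite too. So the kernel is first
  made bounded and compactly supported, and all estimates are additive in \<open>ennreal\<close>:
  new energy plus gain is at most old energy. For the gain to survive the removal of the truncation,
  it is derived from a lower bound on the slope of the kernel as a function of the squared distance,
  which is uniform in the truncation index. The geometric part of the gain is stated for all kernels
  at once, so that one \<open>\<tau>0\<close> serves every \<open>s\<close> and \<open>p\<close>.

  The flow has two awkward features. Sets with infinitely many components are accessible only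
  through finite lists inside them, which makes monotonicity of the flow under inclusion
  indispensable. And a superlevel set of \<open>f^\<tau>\<close> is the union of the symmetrized
  level sets of \<open>f\<close> at strictly higher levels; it can differ from the symmetrization at
  the same level, for instance by a point of contact at time \<open>\<tau>\<close>. Hence every
  inequality is proved at levels slightly above and passed to the limit.\<close>

section \<open>Ordered lists of open intervals and merging\<close>

definition interval_union :: "(real \<times> real) list \<Rightarrow> real set" where
  "interval_union Is = (\<Union>(a, b)\<in>set Is. {a<..<b})"

text \<open>The weak inequality admits common endpoints: at a contact time, before merging, the list
  is still ordered.\<close>

definition ordered_intervals :: "(real \<times> real) list \<Rightarrow> bool" where
  "ordered_intervals Is \<longleftrightarrow>
     sorted_wrt (\<lambda>I J. snd I \<le> fst J) Is \<and> (\<forall>I\<in>set Is. fst I < snd I)"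

definition subinterval :: "real \<times> real \<Rightarrow> real \<times> real \<Rightarrow> bool" where
  "subinterval I J \<longleftrightarrow> fst J \<le> fst I \<and> snd I \<le> snd J"

text \<open>Inclusion of the unions, recorded interval by interval. In this form it can be followed
  along the flow, which acts on each interval separately.\<close>

definition refines :: "(real \<times> real) list \<Rightarrow> (real \<times> real) list \<Rightarrow> bool" where
  "refines Is Js \<longleftrightarrow> (\<forall>I\<in>set Is. \<exists>J\<in>set Js. subinterval I J)"

lemma interval_union_Nil [simp]: "interval_union [] = {}"
  by (simp add: interval_union_def)

lemma interval_union_Cons [simp]:
  "interval_union (I # Is) = {fst I<..<snd I} \<union> interval_union Is"
  by (auto simp: interval_union_def split_beta)

lemma mem_interval_union: "x \<in> interval_union Is \<longleftrightarrow> (\<exists>I\<in>set Is. fst I < x \<and> x < snd I)"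
  by (auto simp: interval_union_def split_beta)

lemma open_interval_union [simp]: "open (interval_union Is)"
  by (auto simp: interval_union_def)

lemma refines_interval_union: "refines Is Js \<Longrightarrow> interval_union Is \<subseteq> interval_union Js"
  unfolding refines_def subinterval_def subset_iff mem_interval_union
  by (meson le_less_trans less_le_trans)

lemma refines_trans: "refines Is Js \<Longrightarrow> refines Js Ks \<Longrightarrow> refines Is Ks"
  unfolding refines_def subinterval_def by (meson order_trans)

lemma ordered_intervals_Cons [simp]:
  "ordered_intervals (I # Is) \<longleftrightarrow>
     fst I < snd I \<and> (\<forall>J\<in>set Is. snd I \<le> fst J) \<and> ordered_intervals Is"
  by (auto simp: ordered_intervals_def)

lemma ordered_intervals_Nil [simp]: "ordered_intervals []"
  by (simp add: ordered_intervals_def)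

lemma ordered_intervals_iff_nth:
  "ordered_intervals Is \<longleftrightarrow> (\<forall>I\<in>set Is. fst I < snd I) \<and>
     (\<forall>i. Suc i < length Is \<longrightarrow> snd (Is ! i) \<le> fst (Is ! Suc i))" (is "_ \<longleftrightarrow> ?r")
proof
  assume "ordered_intervals Is"
  then show ?r
    by (auto simp: ordered_intervals_def dest: sorted_wrt_nth_less)
next
  assume r: ?r
  \<comment> \<open>The order relation alone is not transitive; nondegeneracy of both intervals is
    added to make it so, and then neighbours suffice.\<close>
  define P where "P I J \<longleftrightarrow> fst I < snd I \<and> snd I \<le> fst J \<and> fst J < snd J"
    for I J :: "real \<times> real"
  have "transp P"
    unfolding P_def by (rule transpI) auto
  moreover have "P (Is ! i) (Is ! Suc i)" if "Suc i < length Is" for i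
    using r that unfolding P_def by (meson Suc_lessD nth_mem)
  ultimately have "sorted_wrt P Is"
    by (simp add: sorted_wrt_iff_nth_Suc_transp)
  then have "sorted_wrt (\<lambda>I J. snd I \<le> fst J) Is"
    by (rule sorted_wrt_mono_rel[rotated]) (auto simp: P_def)
  then show "ordered_intervals Is"
    using r by (simp add: ordered_intervals_def)
qed

lemma fst_merge_touching: "I \<in> set (merge_touching Is) \<Longrightarrow> \<exists>J\<in>set Is. fst I = fst J"
  by (induction Is rule: merge_touching.induct) (auto split: if_splits)

text \<open>The strict gaps are the gain of merging: two abutting intervals can then no longer lie
  in different members of the merged list.\<close>

lemma ordered_merge_touching:
  assumes "ordered_intervals Is"
  shows "ordered_intervals (merge_touching Is) \<and>
    sorted_wrt (\<lambda>I J. snd I < fst J) (merge_touching Is)"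
  using assms
proof (induction Is rule: merge_touching.induct)
  case (1 a b c d Is)
  show ?case
  proof (cases "b = c")
    case True
    then show ?thesis using 1 by auto
  next
    case False
    have b: "b < fst J" if "J \<in> set (merge_touching ((c, d) # Is))" for J
      using fst_merge_touching[OF that] 1(3) False by force
    show ?thesis using 1 False b by (auto intro: less_imp_le)
  qed
qed auto

lemma touching_Cons:
  "touching ((a, b) # (c, d) # Is) \<longleftrightarrow> b = c \<or> touching ((c, d) # Is)"
proof
  assume "touching ((a, b) # (c, d) # Is)"
  then obtain i where "Suc i < length ((a, b) # (c, d) # Is)"
    "snd (((a, b) # (c, d) # Is) ! i) = fst (((a, b) # (c, d) # Is) ! Suc i)"
    unfolding touching_def by blast
  then show "b = c \<or> touching ((c, d) # Is)"
    unfolding touching_def by (cases i) auto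
next
  assume "b = c \<or> touching ((c, d) # Is)"
  then show "touching ((a, b) # (c, d) # Is)"
  proof
    assume "b = c"
    then show ?thesis unfolding touching_def by (intro exI[of _ 0]) auto
  next
    assume "touching ((c, d) # Is)"
    then obtain i where "Suc i < length ((c, d) # Is)"
      "snd (((c, d) # Is) ! i) = fst (((c, d) # Is) ! Suc i)"
      unfolding touching_def by blast
    then show ?thesis unfolding touching_def by (intro exI[of _ "Suc i"]) auto
  qed
qed

text \<open>Allows an evolution to be interrupted and merged at a time when only the other list of a
  pair has a contact.\<close>

lemma merge_touching_id: "\<not> touching Is \<Longrightarrow> merge_touching Is = Is"
  by (induction Is rule: merge_touching.induct) (auto simp: touching_Cons)

lemma refines_merge_touching: "refines Is (merge_touching Is)" if "ordered_intervals Is"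
  using that
proof (induction Is rule: merge_touching.induct)
  case (1 a b c d Is)
  show ?case
  proof (cases "b = c")
    case True
    then have "refines ((a, d) # Is) (merge_touching ((a, d) # Is))"
      using 1 by auto
    moreover have "refines ((a, b) # (c, d) # Is) ((a, d) # Is)"
      using 1(3) True unfolding refines_def subinterval_def by auto
    ultimately show ?thesis
      using True refines_trans by auto
  next
    case False
    then show ?thesis using 1 unfolding refines_def subinterval_def by fastforce
  qed
qed (auto simp: refines_def subinterval_def)

lemma sorted_wrt_cases:
  assumes "sorted_wrt P xs" "x \<in> set xs" "y \<in> set xs"
  shows "x = y \<or> P x y \<or> P y x"
  using assms by (induction xs) auto

text \<open>Two intervals with a common endpoint lie in the same member of \<open>Js\<close>,
  because distinct members are separated by a gap of positive length. Hence their union still lies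
  in one member.\<close>

lemma merge_touching_refines:
  assumes "ordered_intervals Is" "ordered_intervals Js" "sorted_wrt (\<lambda>I J. snd I < fst J) Js"
    and "refines Is Js"
  shows "refines (merge_touching Is) Js"
  using assms
proof (induction Is rule: merge_touching.induct)
  case (1 a b c d Is)
  show ?case
  proof (cases "b = c")
    case True
    obtain J1 J2 where J: "J1 \<in> set Js" "J2 \<in> set Js" "subinterval (a, b) J1" "subinterval (c, d) J2"
      using 1(6) unfolding refines_def by auto
    have ab: "a < b" "c < d"
      using 1(3) by auto
    have "J1 = J2"
      using sorted_wrt_cases[OF 1(5) J(1,2)] J(3,4) True ab by (auto simp: subinterval_def)
    then have "subinterval (a, d) J1"
      using J by (auto simp: subinterval_def)
    then have "refines ((a, d) # Is) Js"
      using 1(6) J unfolding refines_def by auto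
    moreover have "ordered_intervals ((a, d) # Is)"
      using 1(3) True ab by auto
    ultimately show ?thesis
      using 1 True by simp
  next
    case False
    then have "refines (merge_touching ((c, d) # Is)) Js"
      using 1 unfolding refines_def by auto
    then show ?thesis
      using 1(6) False unfolding refines_def by auto
  qed
qed auto

lemma refines_merge_touching_mono:
  assumes "ordered_intervals Is" "ordered_intervals Js" "refines Is Js"
  shows "refines (merge_touching Is) (merge_touching Js)"
proof (rule merge_touching_refines)
  show "refines Is (merge_touching Js)"
    using assms(3) refines_merge_touching[OF assms(2)]
    unfolding refines_def subinterval_def by (meson order_trans)
qed (use assms ordered_merge_touching in auto)

text \<open>Merging adds only points of contact, so any closed set containing the union survives
  it.\<close>

lemma interval_union_merge_touching_closure:
  assumes "ordered_intervals Is"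
  shows "interval_union (merge_touching Is) \<subseteq> closure (interval_union Is)"
  using assms
proof (induction Is rule: merge_touching.induct)
  case (1 a b c d Is)
  show ?case
  proof (cases "b = c")
    case True
    have ab: "a < b" "b < d"
      using 1(3) True by auto
    have "{a<..<d} \<subseteq> {a..b} \<union> {b..d}"
      by auto
    also have "\<dots> = closure ({a<..<b} \<union> {c<..<d})"
      using ab True by (simp add: closure_Un)
    finally have "{a<..<d} \<subseteq> closure (interval_union ((a, b) # (c, d) # Is))"
      using closure_mono[of "{a<..<b} \<union> {c<..<d}" "interval_union ((a, b) # (c, d) # Is)"] by auto
    moreover have "interval_union Is \<subseteq> interval_union ((a, b) # (c, d) # Is)"
      by auto
    ultimately have "interval_union ((a, d) # Is) \<subseteq> closure (interval_union ((a, b) # (c, d) # Is))"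
      using closure_subset[of "interval_union ((a, b) # (c, d) # Is)"] by auto
    then have "closure (interval_union ((a, d) # Is)) \<subseteq> closure (interval_union ((a, b) # (c, d) # Is))"
      by (rule closure_minimal) (rule closed_closure)
    moreover have "ordered_intervals ((a, d) # Is)"
      using 1(3) True ab by auto
    ultimately show ?thesis
      using 1(1) True by auto
  next
    case False
    have "interval_union (merge_touching ((a, b) # (c, d) # Is)) =
        {a<..<b} \<union> interval_union (merge_touching ((c, d) # Is))"
      using False by simp
    also have "\<dots> \<subseteq> closure {a<..<b} \<union> closure (interval_union ((c, d) # Is))"
      using 1(2,3) False closure_subset[of "{a<..<b}"] by auto
    also have "\<dots> = closure (interval_union ((a, b) # (c, d) # Is))"
      by (simp add: closure_Un)
    finally show ?thesis .
  qed
qed (use closure_subset in auto)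

lemma sum_list_length_merge_touching:
  "(\<Sum>I\<leftarrow>merge_touching Is. snd I - fst I) = (\<Sum>I\<leftarrow>Is. snd I - fst I)"
  by (induction Is rule: merge_touching.induct) auto

section \<open>Pairs of evolutions\<close>

text \<open>Here \<open>c\<close> is the sum of the endpoints, twice the midpoint, and
  \<open>s\<close> the displacement up to time \<open>\<sigma>\<close>. A midpoint that travels to
  the origin at unit speed and rests there can be stopped and restarted.\<close>

lemma soft_threshold_add:
  fixes c :: real
  assumes "0 \<le> \<sigma>" "0 \<le> \<rho>" and "s = min \<sigma> (\<bar>c\<bar> / 2) * sgn c" "c' = c - 2 * s"
  shows "s + min \<rho> (\<bar>c'\<bar> / 2) * sgn c' = min (\<sigma> + \<rho>) (\<bar>c\<bar> / 2) * sgn c"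
proof (cases "\<bar>c\<bar> / 2 \<le> \<sigma>")
  case True
  then have "s = c / 2"
    using assms(3) by (simp add: min_absorb2) (simp add: sgn_if)
  then show ?thesis
    using True assms by (simp add: min_absorb2)
next
  case False
  then have s: "s = \<sigma> * sgn c"
    using assms(3) by simp
  consider "c > 0" | "c < 0"
    using False assms(1) by fastforce
  then show ?thesis
  proof cases
    case 1
    then show ?thesis using False s assms(4) by (simp add: min_def field_simps)
  next
    case 2
    then show ?thesis using False s assms(4) by (simp add: min_def field_simps)
  qed
qed

lemma move_interval_add:
  assumes "0 \<le> \<sigma>" "0 \<le> \<rho>"
  shows "move_interval \<rho> (move_interval \<sigma> I) = move_interval (\<sigma> + \<rho>) I"
proof -
  define c s where "c = snd I + fst I" and "s = min \<sigma> (\<bar>c\<bar> / 2) * sgn c"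
  have 1: "move_interval \<sigma> I = (fst I - s, snd I - s)"
    using assms by (simp add: move_interval_eq s_def c_def)
  have "(snd I - s) + (fst I - s) = c - 2 * s"
    by (simp add: c_def)
  then have "move_interval \<rho> (move_interval \<sigma> I) =
    (fst I - (s + min \<rho> (\<bar>c - 2 * s\<bar> / 2) * sgn (c - 2 * s)),
     snd I - (s + min \<rho> (\<bar>c - 2 * s\<bar> / 2) * sgn (c - 2 * s)))"
    unfolding 1 move_interval_eq[OF assms(2)] by simp
  also have "\<dots> = move_interval (\<sigma> + \<rho>) I"
    using soft_threshold_add[OF assms s_def refl] assms by (simp add: move_interval_eq c_def)
  finally show ?thesis .
qed

lemma map_move_interval_add:
  assumes "0 \<le> \<sigma>" "0 \<le> \<rho>"
  shows "map (move_interval \<rho>) (map (move_interval \<sigma>) Is) = map (move_interval (\<sigma> + \<rho>)) Is"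
  using assms by (simp add: move_interval_add)

lemma bdd_below_touching_times: "bdd_below (touching_times Is)"
  by (rule bdd_belowI[of _ 0]) (simp add: touching_times_def)

text \<open>Semigroup property up to the first contact. Either \<open>\<sigma>\<close> is the first
  contact time and this is the recursion itself, or nothing touches at \<open>\<sigma>\<close>,
  merging is the identity and all contact times are shifted by \<open>\<sigma>\<close>.\<close>

lemma evolve_step:
  assumes "0 \<le> \<sigma>" "\<sigma> \<le> \<tau>" and first: "\<And>\<rho>. \<rho> \<in> touching_times Is \<Longrightarrow> \<sigma> \<le> \<rho>"
  shows "evolve \<tau> Is = evolve (\<tau> - \<sigma>) (merge_touching (map (move_interval \<sigma>) Is))"
proof (cases "\<sigma> \<in> touching_times Is")
  case True
  then have "Inf (touching_times Is) = \<sigma>"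
    using first bdd_below_touching_times
    by (intro antisym cInf_lower cInf_greatest) auto
  then show ?thesis
    using True assms(2) by (subst evolve.simps) (auto simp: Let_def)
next
  case False
  let ?Js = "map (move_interval \<sigma>) Is"
  have nt: "\<not> touching ?Js"
    using False assms(1) by (simp add: touching_times_def)
  have shift: "\<rho> \<in> touching_times Is \<longleftrightarrow> \<rho> - \<sigma> \<in> touching_times ?Js" for \<rho>
  proof (cases "\<sigma> \<le> \<rho>")
    case True
    then show ?thesis
      using assms(1) map_move_interval_add[of \<sigma> "\<rho> - \<sigma>" Is]
      by (simp add: touching_times_def del: map_map)
  next
    case False
    then show ?thesis
      using first[of \<rho>] by (auto simp: touching_times_def)
  qed
  have ex: "(\<exists>\<rho>\<in>touching_times Is. \<rho> \<le> \<tau>) \<longleftrightarrow> (\<exists>\<rho>\<in>touching_times ?Js. \<rho> \<le> \<tau> - \<sigma>)"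
  proof
    assume "\<exists>\<rho>\<in>touching_times Is. \<rho> \<le> \<tau>"
    then show "\<exists>\<rho>\<in>touching_times ?Js. \<rho> \<le> \<tau> - \<sigma>"
      using shift by (metis diff_right_mono)
  next
    assume "\<exists>\<rho>\<in>touching_times ?Js. \<rho> \<le> \<tau> - \<sigma>"
    then obtain \<rho> where "\<rho> \<in> touching_times ?Js" "\<rho> \<le> \<tau> - \<sigma>" by blast
    then show "\<exists>\<rho>\<in>touching_times Is. \<rho> \<le> \<tau>"
      using shift[of "\<rho> + \<sigma>"] by (intro bexI[of _ "\<rho> + \<sigma>"]) auto
  qed
  show ?thesis
  proof (cases "\<exists>\<rho>\<in>touching_times Is. \<rho> \<le> \<tau>")
    case True
    have eq: "touching_times Is = (\<lambda>\<rho>. \<sigma> + \<rho>) ` touching_times ?Js"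
    proof (intro equalityI subsetI)
      fix \<rho> assume "\<rho> \<in> touching_times Is"
      then show "\<rho> \<in> (\<lambda>\<rho>. \<sigma> + \<rho>) ` touching_times ?Js"
        using shift[of \<rho>] by (intro image_eqI[of _ _ "\<rho> - \<sigma>"]) auto
    next
      fix \<rho> assume "\<rho> \<in> (\<lambda>\<rho>. \<sigma> + \<rho>) ` touching_times ?Js"
      then obtain \<rho>' where "\<rho> = \<sigma> + \<rho>'" "\<rho>' \<in> touching_times ?Js"
        by blast
      then show "\<rho> \<in> touching_times Is"
        using shift[of \<rho>] by simp
    qed
    have ne: "touching_times ?Js \<noteq> {}"
      using True ex by blast
    have "Inf (touching_times Is) = \<sigma> + Inf (touching_times ?Js)"
      unfolding eq using bdd_below_touching_times ne
      by (intro continuous_at_Inf_mono[symmetric]) (auto simp: mono_def intro!: continuous_intros)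
    moreover have "0 \<le> Inf (touching_times ?Js)"
      using Inf_touching_times[OF ne] by (simp add: touching_times_def)
    ultimately show ?thesis
      using True ex assms(1) nt
      by (subst (1 2) evolve.simps) (simp add: Let_def merge_touching_id move_interval_add comp_def algebra_simps)
  next
    case False
    then show ?thesis
      using ex assms nt
      by (subst (1 2) evolve.simps) (simp add: merge_touching_id move_interval_add comp_def)
  qed
qed

text \<open>The signed overlap \<open>g\<close> of two neighbours is continuous in time and starts
  nonpositive. If it were positive at \<open>\<sigma>\<close>, it would vanish at some earlier time,
  which would be a contact before the first one.\<close>

lemma ordered_map_move:
  assumes "ordered_intervals Is" "0 \<le> \<sigma>" and first: "\<And>\<rho>. \<rho> \<in> touching_times Is \<Longrightarrow> \<sigma> \<le> \<rho>"
  shows "ordered_intervals (map (move_interval \<sigma>) Is)"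
  unfolding ordered_intervals_iff_nth
proof (intro conjI allI impI ballI)
  fix I assume "I \<in> set (map (move_interval \<sigma>) Is)"
  then show "fst I < snd I"
    using assms(1,2) by (auto simp: move_interval_eq ordered_intervals_def)
next
  fix i assume i: "Suc i < length (map (move_interval \<sigma>) Is)"
  define g where "g \<rho> = snd (move_interval \<rho> (Is ! i)) - fst (move_interval \<rho> (Is ! Suc i))" for \<rho>
  have g0: "g 0 \<le> 0"
    using i assms(1) unfolding g_def ordered_intervals_iff_nth by (simp add: move_interval_eq)
  have cont: "continuous_on {0..\<sigma>} g"
  proof -
    have "continuous_on {0..\<sigma>} (\<lambda>\<rho>. (snd (Is ! i) - min \<rho> (\<bar>snd (Is ! i) + fst (Is ! i)\<bar> / 2) * sgn (snd (Is ! i) + fst (Is ! i)))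
      - (fst (Is ! Suc i) - min \<rho> (\<bar>snd (Is ! Suc i) + fst (Is ! Suc i)\<bar> / 2) * sgn (snd (Is ! Suc i) + fst (Is ! Suc i))))"
      by (intro continuous_intros)
    then show ?thesis
      by (rule continuous_on_eq) (simp add: g_def move_interval_eq)
  qed
  have "g \<sigma> \<le> 0"
  proof (rule ccontr)
    assume "\<not> g \<sigma> \<le> 0"
    then obtain \<rho> where \<rho>: "0 \<le> \<rho>" "\<rho> \<le> \<sigma>" "g \<rho> = 0"
      using IVT'[of g 0 0 \<sigma>] g0 cont assms(2) by auto
    then have "\<rho> \<in> touching_times Is"
      using i unfolding touching_times_def touching_def g_def by (auto intro!: exI[of _ i])
    with first have "\<rho> = \<sigma>"
      using \<rho> by force
    with \<rho> \<open>\<not> g \<sigma> \<le> 0\<close> show False by simp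
  qed
  then show "snd (map (move_interval \<sigma>) Is ! i) \<le> fst (map (move_interval \<sigma>) Is ! Suc i)"
    using i by (simp add: g_def)
qed

text \<open>Both lists are stopped at the first contact in either of them, so that they can be compared
  although their merging times differ.\<close>

lemma evolve_pair_induct:
  assumes "0 \<le> \<tau>" "ordered_intervals Is" "ordered_intervals Js" "R t Is Js"
    and move: "\<And>t \<sigma> Is Js. 0 \<le> \<sigma> \<Longrightarrow> ordered_intervals Is \<Longrightarrow> ordered_intervals Js \<Longrightarrow>
      ordered_intervals (map (move_interval \<sigma>) Is) \<Longrightarrow> ordered_intervals (map (move_interval \<sigma>) Js) \<Longrightarrow>
      R t Is Js \<Longrightarrow> R (t + \<sigma>) (map (move_interval \<sigma>) Is) (map (move_interval \<sigma>) Js)"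
    and merge: "\<And>t Is Js. ordered_intervals Is \<Longrightarrow> ordered_intervals Js \<Longrightarrow> R t Is Js \<Longrightarrow>
      R t (merge_touching Is) (merge_touching Js)"
  shows "R (t + \<tau>) (evolve \<tau> Is) (evolve \<tau> Js) \<and>
    ordered_intervals (evolve \<tau> Is) \<and> ordered_intervals (evolve \<tau> Js)"
  using assms(1-4)
proof (induction "length Is + length Js" arbitrary: \<tau> t Is Js rule: less_induct)
  case less
  define T where "T = touching_times Is \<union> touching_times Js"
  have T: "closed T" "bdd_below T"
    using closed_touching_times bdd_below_touching_times by (auto simp: T_def)
  show ?case
  proof (cases "\<exists>\<sigma>\<in>T. \<sigma> \<le> \<tau>")
    case False
    then have *: "\<tau> \<le> \<rho>" if "\<rho> \<in> T" for \<rho>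
      using that by force
    have "evolve \<tau> Is = map (move_interval \<tau>) Is" "evolve \<tau> Js = map (move_interval \<tau>) Js"
      using False by (subst evolve.simps, auto simp: T_def)+
    moreover have "ordered_intervals (map (move_interval \<tau>) Is)" "ordered_intervals (map (move_interval \<tau>) Js)"
      using * less.prems by (auto intro!: ordered_map_move simp: T_def)
    ultimately show ?thesis
      using move[of \<tau> Is Js t] less.prems by simp
  next
    case True
    define \<sigma> where "\<sigma> = Inf T"
    have \<sigma>: "\<sigma> \<in> T"
      unfolding \<sigma>_def using True T by (intro closed_contains_Inf) auto
    have *: "\<sigma> \<le> \<rho>" if "\<rho> \<in> T" for \<rho>
      unfolding \<sigma>_def using that T by (intro cInf_lower) auto
    have "0 \<le> \<sigma>"
      using \<sigma> by (auto simp: T_def touching_times_def)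
    have "\<sigma> \<le> \<tau>"
      using True * by (meson order_trans)
    let ?I = "map (move_interval \<sigma>) Is" and ?J = "map (move_interval \<sigma>) Js"
    have ord: "ordered_intervals ?I" "ordered_intervals ?J"
      using * less.prems \<open>0 \<le> \<sigma>\<close> by (auto intro!: ordered_map_move simp: T_def)
    have R: "R (t + \<sigma>) (merge_touching ?I) (merge_touching ?J)"
      using less.prems ord \<open>0 \<le> \<sigma>\<close> by (intro merge move)
    have "touching ?I \<or> touching ?J"
      using \<sigma> by (auto simp: T_def touching_times_def)
    \<comment> \<open>Only one list need have a contact at \<open>\<sigma>\<close>; the total length
      still drops, which drives the induction.\<close>
    then have len: "length (merge_touching ?I) + length (merge_touching ?J) < length Is + length Js"
      using length_merge_touching_le[of ?I] length_merge_touching_le[of ?J]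
        length_merge_touching_less[of ?I] length_merge_touching_less[of ?J] by auto
    have ev: "evolve \<tau> Is = evolve (\<tau> - \<sigma>) (merge_touching ?I)"
      "evolve \<tau> Js = evolve (\<tau> - \<sigma>) (merge_touching ?J)"
      using * \<open>0 \<le> \<sigma>\<close> \<open>\<sigma> \<le> \<tau>\<close> by (auto intro!: evolve_step simp: T_def)
    show ?thesis
      unfolding ev
      using less.hyps[OF len _ _ _ R, of "\<tau> - \<sigma>"] ord \<open>\<sigma> \<le> \<tau>\<close> ordered_merge_touching by simp
  qed
qed

section \<open>Monotonicity, length and speed of the evolution\<close>

text \<open>The displacement is the midpoint clamped to an interval of radius
  \<open>\<sigma>\<close>. Clamping is monotone and 1-Lipschitz, which is all that is used of the
  flow below.\<close>

lemma soft_threshold: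
  fixes c :: real
  assumes "0 \<le> \<sigma>"
  shows "min \<sigma> (\<bar>c\<bar> / 2) * sgn c = max (- \<sigma>) (min \<sigma> (c / 2))"
  using assms by (cases "c > 0"; cases "c < 0") (auto simp: min_def max_def)

lemma soft_threshold_diff:
  fixes x y :: real
  assumes "0 \<le> \<sigma>" "0 \<le> k" "y - x \<le> 2 * k"
  shows "max (- \<sigma>) (min \<sigma> (y / 2)) - max (- \<sigma>) (min \<sigma> (x / 2)) \<le> k"
  using assms by (auto simp: min_def max_def)

text \<open>The clamped midpoints of \<open>I\<close> and \<open>J\<close> differ by at most the
  room left between the left endpoints in one direction, and by at most that between the right
  endpoints in the other. So \<open>I\<close> cannot leave \<open>J\<close> on either side.\<close>

lemma subinterval_move:
  assumes "subinterval I J" "fst I < snd I" "0 \<le> \<sigma>"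
  shows "subinterval (move_interval \<sigma> I) (move_interval \<sigma> J)"
proof -
  have "fst J \<le> fst I" "snd I \<le> snd J"
    using assms by (auto simp: subinterval_def)
  then show ?thesis
    using soft_threshold_diff[OF assms(3), of "fst I - fst J" "snd I + fst I" "snd J + fst J"]
      soft_threshold_diff[OF assms(3), of "snd J - snd I" "snd J + fst J" "snd I + fst I"]
    unfolding subinterval_def move_interval_eq[OF assms(3)] soft_threshold[OF assms(3)]
    by simp
qed

text \<open>Monotonicity of the flow. It turns the symmetrization of an open set into a union over
  all finite lists inside it, free of any enumeration of components.\<close>

lemma evolve_refines:
  assumes "0 \<le> \<tau>" "ordered_intervals Is" "ordered_intervals Js" "refines Is Js"
  shows "refines (evolve \<tau> Is) (evolve \<tau> Js)"
proof -
  have "refines (map (move_interval \<sigma>) Is) (map (move_interval \<sigma>) Js)"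
    if "0 \<le> \<sigma>" "ordered_intervals Is" "refines Is Js" for \<sigma> Is Js
    unfolding refines_def
  proof
    fix I assume "I \<in> set (map (move_interval \<sigma>) Is)"
    then obtain I' where I': "I' \<in> set Is" "I = move_interval \<sigma> I'"
      by auto
    then obtain J' where J': "J' \<in> set Js" "subinterval I' J'"
      using \<open>refines Is Js\<close> by (auto simp: refines_def)
    have "subinterval I (move_interval \<sigma> J')"
      using subinterval_move[OF J'(2) _ \<open>0 \<le> \<sigma>\<close>] I' \<open>ordered_intervals Is\<close>
      by (auto simp: ordered_intervals_def)
    then show "\<exists>J\<in>set (map (move_interval \<sigma>) Js). subinterval I J"
      using J'(1) by auto
  qed
  then show ?thesis
    using evolve_pair_induct[OF assms(1-3), of "\<lambda>_. refines" 0] assms(4) refines_merge_touching_mono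
    by blast
qed

lemma ordered_evolve:
  assumes "0 \<le> \<tau>" "ordered_intervals Is"
  shows "ordered_intervals (evolve \<tau> Is)"
  using evolve_pair_induct[OF assms(1,2,2), of "\<lambda>_ _ _. True" 0] by simp

lemma emeasure_interval_union:
  assumes "ordered_intervals Is"
  shows "emeasure lborel (interval_union Is) = ennreal (\<Sum>I\<leftarrow>Is. snd I - fst I)"
  using assms
proof (induction Is)
  case (Cons I Is)
  have "{fst I<..<snd I} \<inter> interval_union Is = {}"
    using Cons.prems by (fastforce simp: mem_interval_union)
  moreover have "0 \<le> (\<Sum>I\<leftarrow>Is. snd I - fst I)"
    using Cons.prems by (intro sum_list_nonneg) (auto simp: ordered_intervals_def intro: less_imp_le)
  ultimately show ?case
    using Cons by (simp add: plus_emeasure[symmetric] ennreal_plus[symmetric] del: ennreal_plus)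
qed simp

lemma emeasure_evolve:
  assumes "0 \<le> \<tau>" "ordered_intervals Is"
  shows "emeasure lborel (interval_union (evolve \<tau> Is)) = emeasure lborel (interval_union Is)"
proof -
  \<comment> \<open>A single evolution is treated as a pair of equal ones; the relation ignores the
    second list.\<close>
  let ?R = "\<lambda>(_::real) Js (_::(real \<times> real) list). (\<Sum>I\<leftarrow>Js. snd I - fst I) = (\<Sum>I\<leftarrow>Is. snd I - fst I)"
  have "map (\<lambda>I. snd I - fst I) (map (move_interval \<sigma>) Js) = map (\<lambda>I. snd I - fst I) Js"
    if "0 \<le> \<sigma>" for Js \<sigma>
    using that by (simp add: move_interval_eq)
  then have "?R (0 + \<tau>) (evolve \<tau> Is) (evolve \<tau> Is)"
    using evolve_pair_induct[OF assms(1,2,2), of ?R 0] sum_list_length_merge_touching by metis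
  then show ?thesis
    using emeasure_interval_union[OF assms(2)] emeasure_interval_union[OF ordered_evolve[OF assms]] by simp
qed

text \<open>Points move at most at unit speed, so the set at time \<open>t\<close> stays in the
  closed \<open>t\<close>-neighbourhood \<open>N t\<close> of \<open>C\<close>; being closed,
  \<open>N t\<close> also absorbs the points added by merging. The bound keeps the levels
  contributing to \<open>f^\<tau>\<close> at a given point bounded.\<close>

lemma evolve_within_distance:
  assumes "0 \<le> \<tau>" "ordered_intervals Is" "x \<in> interval_union (evolve \<tau> Is)"
    and C: "closed C" "interval_union Is \<subseteq> C"
  shows "\<exists>y\<in>C. \<bar>y - x\<bar> \<le> \<tau>"
proof -
  define N where "N t = {x. infdist x C \<le> t}" for t
  have closed_N: "closed (N t)" for t
    unfolding N_def by (intro closed_Collect_le continuous_intros)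
  let ?R = "\<lambda>t Js (_::(real \<times> real) list). interval_union Js \<subseteq> N t"
  have move: "?R (t + \<sigma>) (map (move_interval \<sigma>) Js) Ks" if "0 \<le> \<sigma>" "?R t Js Ks" for t \<sigma> Js Ks
  proof
    fix x assume "x \<in> interval_union (map (move_interval \<sigma>) Js)"
    then obtain I where I: "I \<in> set Js" "fst (move_interval \<sigma> I) < x" "x < snd (move_interval \<sigma> I)"
      by (auto simp: mem_interval_union)
    define s where "s = min \<sigma> (\<bar>snd I + fst I\<bar> / 2) * sgn (snd I + fst I)"
    have "fst I < x + s" "x + s < snd I"
      using I(2,3) unfolding move_interval_eq[OF \<open>0 \<le> \<sigma>\<close>] s_def by auto
    then have "x + s \<in> interval_union Js"
      using I(1) by (auto simp: mem_interval_union)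
    then have "infdist (x + s) C \<le> t"
      using that by (auto simp: N_def)
    moreover have "dist x (x + s) \<le> \<sigma>"
      using \<open>0 \<le> \<sigma>\<close> by (auto simp: s_def dist_real_def abs_mult sgn_if)
    ultimately show "x \<in> N (t + \<sigma>)"
      unfolding N_def using infdist_triangle[of x C "x + s"] by simp
  qed
  have merge: "?R t (merge_touching Js) Ks" if "ordered_intervals Js" "?R t Js Ks" for t Js Ks
    using interval_union_merge_touching_closure[OF that(1)] closure_minimal[OF that(2) closed_N] by blast
  have "?R 0 Is Is"
    using C by (auto simp: N_def)
  then have "?R (0 + \<tau>) (evolve \<tau> Is) (evolve \<tau> Is)"
    using evolve_pair_induct[OF assms(1,2,2), of ?R 0] move merge by blast
  then have x: "infdist x C \<le> \<tau>"
    using assms(3) by (auto simp: N_def)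
  \<comment> \<open>\<open>infdist\<close> to the empty set is 0 by convention, so the distance
    bound yields a point only once \<open>C\<close> is known to be nonempty.\<close>
  have "C \<noteq> {}"
  proof
    assume "C = {}"
    then have "Is = []"
      using C assms(2) by (cases Is) auto
    then have "evolve \<tau> Is = []"
      by (subst evolve.simps) (simp add: touching_times_def touching_def)
    with assms(3) show False by simp
  qed
  then obtain y where "y \<in> C" "infdist x C = dist x y"
    using infdist_attains_inf C(1) by blast
  with x show ?thesis
    by (intro bexI[of _ y]) (auto simp: dist_real_def)
qed

section \<open>Interaction energies on the line\<close>

definition symmetric_decreasing :: "(real \<Rightarrow> ennreal) \<Rightarrow> bool" where
  "symmetric_decreasing k \<longleftrightarrow> (\<forall>s t. \<bar>s\<bar> \<le> \<bar>t\<bar> \<longrightarrow> k t \<le> k s)"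

definition interaction :: "(real \<Rightarrow> ennreal) \<Rightarrow> real set \<Rightarrow> real set \<Rightarrow> ennreal" where
  "interaction k U V =
     (\<integral>\<^sup>+t. (\<integral>\<^sup>+s. k (t - s) * indicator V s \<partial>lborel) * indicator U t \<partial>lborel)"

lemma symmetric_decreasingD: "symmetric_decreasing k \<Longrightarrow> \<bar>s\<bar> \<le> \<bar>t\<bar> \<Longrightarrow> k t \<le> k s"
  by (simp add: symmetric_decreasing_def)

lemma symmetric_decreasing_even: "symmetric_decreasing k \<Longrightarrow> k (- t) = k t"
  by (intro antisym symmetric_decreasingD[of k]) auto

lemma symmetric_decreasing_indicator: "symmetric_decreasing (indicator {- l<..<l})"
  by (auto simp: symmetric_decreasing_def indicator_def)

lemma nn_integral_translate:
  fixes a :: real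
  assumes "f \<in> borel_measurable borel"
  shows "(\<integral>\<^sup>+x. f (x + a) \<partial>lborel) = (\<integral>\<^sup>+x. f x \<partial>lborel)"
  using nn_integral_real_affine[OF assms, of 1 a] by (simp add: add.commute)

lemma nn_integral_reflect:
  fixes f :: "real \<Rightarrow> ennreal"
  assumes "f \<in> borel_measurable borel"
  shows "(\<integral>\<^sup>+x. f (- x) \<partial>lborel) = (\<integral>\<^sup>+x. f x \<partial>lborel)"
  using nn_integral_real_affine[OF assms, of "-1" 0] by simp

text \<open>The two sides differ by the product of the increments \<open>c\<close> and
  \<open>d\<close>. They are introduced additively because subtraction in \<open>ennreal\<close> is
  truncated.\<close>

lemma ennreal_rearrangement:
  fixes a b a' b' :: ennreal
  assumes "a' \<le> a" "b' \<le> b"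
  shows "a * b' + a' * b \<le> a * b + a' * b'"
proof -
  obtain c d where "a = a' + c" "b = b' + d"
    using assms by (auto simp: le_iff_add)
  then have "a * b + a' * b' = a * b' + a' * b + c * d"
    by (simp add: algebra_simps)
  then show ?thesis by simp
qed

lemma nn_integral_symmetrize:
  fixes f :: "real \<Rightarrow> ennreal"
  assumes [measurable]: "f \<in> borel_measurable borel"
  shows "2 * (\<integral>\<^sup>+x. f x \<partial>lborel) = (\<integral>\<^sup>+x. f x + f (- x) \<partial>lborel)"
  by (subst nn_integral_add) (auto simp: nn_integral_reflect mult_2)

lemma ennreal_two_mult_le: "2 * a \<le> 2 * b \<Longrightarrow> a \<le> b" for a b :: ennreal
  by (subst (asm) ennreal_mult_le_mult_iff) auto

text \<open>After centring, the two integrands are compared on \<open>{w, - w}\<close>, where the rearrangement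
  inequality for two numbers applies.\<close>

lemma symmetric_decreasing_convolution:
  assumes [measurable]: "k \<in> borel_measurable borel" "g \<in> borel_measurable borel"
    and k: "symmetric_decreasing k" and g: "symmetric_decreasing g"
  shows "symmetric_decreasing (\<lambda>d. \<integral>\<^sup>+v. k (v + d) * g v \<partial>lborel)" (is "symmetric_decreasing ?J")
proof -
  have even: "?J (- d) = ?J d" for d
  proof -
    have "?J (- d) = (\<integral>\<^sup>+v. k (- v + - d) * g (- v) \<partial>lborel)"
      by (subst nn_integral_reflect[symmetric]) auto
    also have "\<dots> = ?J d"
      using symmetric_decreasing_even[OF k] symmetric_decreasing_even[OF g]
      by (metis (no_types, opaque_lifting) minus_add_distrib)
    finally show ?thesis .
  qed
  have mono: "?J d \<le> ?J d'" if "0 \<le> d'" "d' \<le> d" for d d'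
  proof -
    \<comment> \<open>The shifts are \<open>d = e + \<delta>\<close> and
      \<open>d' = e - \<delta>\<close>. After translating by \<open>\<delta>\<close> either way,
      both integrands share the factor \<open>k (w + e)\<close> and differ only in the argument of
      \<open>g\<close>.\<close>
    define e \<delta> where "e = (d + d') / 2" and "\<delta> = (d - d') / 2"
    have e: "0 \<le> \<delta>" "0 \<le> e"
      using that by (auto simp: e_def \<delta>_def)
    have 1: "?J d = (\<integral>\<^sup>+w. k (w + e) * g (w - \<delta>) \<partial>lborel)"
      using nn_integral_translate[of "\<lambda>v. k (v + d) * g v" "- \<delta>"]
      by (simp add: e_def \<delta>_def algebra_simps add_divide_distrib diff_divide_distrib)
    have 2: "?J d' = (\<integral>\<^sup>+w. k (w + e) * g (w + \<delta>) \<partial>lborel)"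
      using nn_integral_translate[of "\<lambda>v. k (v + d') * g v" "\<delta>"]
      by (simp add: e_def \<delta>_def algebra_simps add_divide_distrib diff_divide_distrib)
    have "k (w + e) * g (w - \<delta>) + k (- w + e) * g (- w - \<delta>) \<le>
        k (w + e) * g (w + \<delta>) + k (- w + e) * g (- w + \<delta>)" for w
    proof -
      have g': "g (- w - \<delta>) = g (w + \<delta>)" "g (- w + \<delta>) = g (w - \<delta>)"
      proof -
        have "- w - \<delta> = - (w + \<delta>)" "- w + \<delta> = - (w - \<delta>)"
          by auto
        then show "g (- w - \<delta>) = g (w + \<delta>)" "g (- w + \<delta>) = g (w - \<delta>)"
          by (simp_all only: symmetric_decreasing_even[OF g])
      qed
      show ?thesis
      proof (cases "0 \<le> w")
        case True
        then have "k (w + e) \<le> k (- w + e)" "g (w + \<delta>) \<le> g (w - \<delta>)"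
          using e by (auto intro!: symmetric_decreasingD[OF k] symmetric_decreasingD[OF g])
        from ennreal_rearrangement[OF this] show ?thesis
          unfolding g' by (simp add: add.commute)
      next
        case False
        then have "k (- w + e) \<le> k (w + e)" "g (w - \<delta>) \<le> g (w + \<delta>)"
          using e by (auto intro!: symmetric_decreasingD[OF k] symmetric_decreasingD[OF g])
        from ennreal_rearrangement[OF this] show ?thesis
          unfolding g' by (simp add: add.commute)
      qed
    qed
    then have "2 * ?J d \<le> 2 * ?J d'"
      unfolding 1 2 by (subst (1 2) nn_integral_symmetrize) (auto intro!: nn_integral_mono)
    then show ?thesis
      by (rule ennreal_two_mult_le)
  qed
  show ?thesis
    unfolding symmetric_decreasing_def
  proof (intro allI impI)
    fix s t :: real assume "\<bar>s\<bar> \<le> \<bar>t\<bar>"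
    then have "?J \<bar>t\<bar> \<le> ?J \<bar>s\<bar>"
      by (intro mono) auto
    then show "?J t \<le> ?J s"
      using even[of s] even[of t] by (auto simp: abs_if split: if_splits)
  qed
qed

text \<open>The interaction of two intervals with half-lengths \<open>l\<close> and
  \<open>l'\<close> whose midpoints are \<open>d\<close> apart. The inner variable is reflected, so
  that it becomes two nested convolutions of \<open>k\<close> with indicators.\<close>

definition centered_interaction :: "(real \<Rightarrow> ennreal) \<Rightarrow> real \<Rightarrow> real \<Rightarrow> real \<Rightarrow> ennreal" where
  "centered_interaction k l l' d =
    (\<integral>\<^sup>+x. (\<integral>\<^sup>+y. k (y + (x + d)) * indicator {- l'<..<l'} y \<partial>lborel) * indicator {- l<..<l} x \<partial>lborel)"

text \<open>One convolution for each interval. This is the precise form of "closer midpoints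
  interact more strongly".\<close>

lemma symmetric_decreasing_centered_interaction:
  assumes [measurable]: "k \<in> borel_measurable borel" and k: "symmetric_decreasing k"
  shows "symmetric_decreasing (centered_interaction k l l')"
proof -
  have "symmetric_decreasing (\<lambda>d. \<integral>\<^sup>+y. k (y + d) * indicator {- l'<..<l'} y \<partial>lborel)"
    by (intro symmetric_decreasing_convolution k symmetric_decreasing_indicator) auto
  then have "symmetric_decreasing (\<lambda>d. \<integral>\<^sup>+x. (\<integral>\<^sup>+y. k (y + (x + d)) * indicator {- l'<..<l'} y \<partial>lborel)
      * indicator {- l<..<l} x \<partial>lborel)"
    by (intro symmetric_decreasing_convolution[of "\<lambda>d. \<integral>\<^sup>+y. k (y + d) * indicator {- l'<..<l'} y \<partial>lborel"]
        symmetric_decreasing_indicator) auto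
  then show ?thesis
    by (simp add: centered_interaction_def[abs_def])
qed

lemma interaction_intervals:
  assumes [measurable]: "k \<in> borel_measurable borel"
  shows "interaction k {a<..<b} {c<..<d} =
    centered_interaction k ((b - a) / 2) ((d - c) / 2) ((a + b) / 2 - (c + d) / 2)"
proof -
  define m l m' l' where "m = (a + b) / 2" "l = (b - a) / 2" "m' = (c + d) / 2" "l' = (d - c) / 2"
  have ab: "a = m - l" "b = m + l" "c = m' - l'" "d = m' + l'"
    by (auto simp: m_l_m'_l'_def field_simps)
  have inner: "(\<integral>\<^sup>+s. k (x + m - s) * indicator {c<..<d} s \<partial>lborel) =
      (\<integral>\<^sup>+y. k (y + (x + (m - m'))) * indicator {- l'<..<l'} y \<partial>lborel)" for x
  proof -
    have "(\<integral>\<^sup>+s. k (x + m - s) * indicator {c<..<d} s \<partial>lborel) =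
        (\<integral>\<^sup>+y. k (x + m - (- y + m')) * indicator {c<..<d} (- y + m') \<partial>lborel)"
      using nn_integral_translate[of "\<lambda>s. k (x + m - s) * indicator {c<..<d} s" m']
        nn_integral_reflect[of "\<lambda>y. k (x + m - (y + m')) * indicator {c<..<d} (y + m')"] by simp
    also have "\<dots> = (\<integral>\<^sup>+y. k (y + (x + (m - m'))) * indicator {- l'<..<l'} y \<partial>lborel)"
      by (intro nn_integral_cong arg_cong2[of _ _ _ _ "(*)"] arg_cong[of _ _ k])
         (auto simp: ab indicator_def)
    finally show ?thesis .
  qed
  have "interaction k {a<..<b} {c<..<d} = (\<integral>\<^sup>+x. (\<integral>\<^sup>+s. k (x + m - s) * indicator {c<..<d} s \<partial>lborel)
      * indicator {a<..<b} (x + m) \<partial>lborel)"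
    unfolding interaction_def
    by (subst nn_integral_translate[symmetric, where a = m]) auto
  also have "\<dots> = centered_interaction k l l' (m - m')"
    unfolding centered_interaction_def inner
    by (intro nn_integral_cong arg_cong2[of _ _ _ _ "(*)"]) (auto simp: ab indicator_def)
  finally show ?thesis
    by (simp add: m_l_m'_l'_def)
qed

lemma interaction_union_left:
  assumes [measurable]: "k \<in> borel_measurable borel" "A \<in> sets borel" "B \<in> sets borel" "V \<in> sets borel"
    and "A \<inter> B = {}"
  shows "interaction k (A \<union> B) V = interaction k A V + interaction k B V"
proof -
  have "indicator (A \<union> B) t = (indicator A t + indicator B t :: ennreal)" for t
    using assms(5) by (auto simp: indicator_def)
  then show ?thesis
    unfolding interaction_def by (simp add: distrib_left nn_integral_add)
qed

lemma interaction_union_right: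
  assumes [measurable]: "k \<in> borel_measurable borel" "A \<in> sets borel" "B \<in> sets borel" "V \<in> sets borel"
    and "A \<inter> B = {}"
  shows "interaction k V (A \<union> B) = interaction k V A + interaction k V B"
proof -
  have "indicator (A \<union> B) t = (indicator A t + indicator B t :: ennreal)" for t
    using assms(5) by (auto simp: indicator_def)
  then show ?thesis
    unfolding interaction_def by (simp add: distrib_left distrib_right nn_integral_add)
qed

lemma interaction_empty [simp]: "interaction k {} V = 0" "interaction k U {} = 0"
  by (simp_all add: interaction_def)

lemma interaction_mono: "U \<subseteq> U' \<Longrightarrow> V \<subseteq> V' \<Longrightarrow> interaction k U V \<le> interaction k U' V'"
  unfolding interaction_def
  by (intro nn_integral_mono mult_mono) (auto simp: indicator_def)

lemma disjoint_interval_union_Cons: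
  "ordered_intervals (I # Is) \<Longrightarrow> {fst I<..<snd I} \<inter> interval_union Is = {}"
  by (fastforce simp: mem_interval_union)

lemma borel_interval_union [measurable]: "interval_union Is \<in> sets borel"
  by (simp add: borel_open)

lemma interaction_interval_union:
  assumes [measurable]: "k \<in> borel_measurable borel" and "ordered_intervals Is" "ordered_intervals Js"
  shows "interaction k (interval_union Is) (interval_union Js) =
    (\<Sum>I\<leftarrow>Is. \<Sum>J\<leftarrow>Js. interaction k {fst I<..<snd I} {fst J<..<snd J})"
proof -
  have 1: "interaction k V (interval_union Js) = (\<Sum>J\<leftarrow>Js. interaction k V {fst J<..<snd J})"
    if [measurable]: "V \<in> sets borel" for V
    using assms(3)
    by (induction Js) (simp_all add: interaction_union_right disjoint_interval_union_Cons del: ordered_intervals_Cons, simp)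
  show ?thesis
    using assms(2)
    by (induction Is) (simp_all add: interaction_union_left disjoint_interval_union_Cons 1 del: ordered_intervals_Cons, simp)
qed

lemma interaction_move_interval:
  assumes [measurable]: "k \<in> borel_measurable borel" and k: "symmetric_decreasing k" and "0 \<le> \<sigma>"
  shows "interaction k {fst I<..<snd I} {fst J<..<snd J} \<le>
    interaction k {fst (move_interval \<sigma> I)<..<snd (move_interval \<sigma> I)}
      {fst (move_interval \<sigma> J)<..<snd (move_interval \<sigma> J)}"
proof -
  define x y where "x = snd I + fst I" "y = snd J + fst J"
  define u v where "u = max (- \<sigma>) (min \<sigma> (x / 2))" "v = max (- \<sigma>) (min \<sigma> (y / 2))"
  \<comment> \<open>\<open>x / 2 - u\<close> and \<open>y / 2 - v\<close> are the midpoints after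
    time \<open>\<sigma>\<close>; the half-lengths are unchanged.\<close>
  have *: "\<bar>(x / 2 - u) - (y / 2 - v)\<bar> \<le> \<bar>x / 2 - y / 2\<bar>"
    using assms(3) unfolding u_v_def by (auto simp: min_def max_def)
  have m: "move_interval \<sigma> I = (fst I - u, snd I - u)" "move_interval \<sigma> J = (fst J - v, snd J - v)"
    unfolding move_interval_eq[OF assms(3)] soft_threshold[OF assms(3)] u_v_def x_y_def by auto
  show ?thesis
    unfolding interaction_intervals[OF assms(1)] m fst_conv snd_conv
    using symmetric_decreasingD[OF symmetric_decreasing_centered_interaction[OF assms(1) k] *]
    by (simp add: x_y_def field_simps)
qed

text \<open>While both lists stay ordered, the interaction is a double sum over pairs of intervals,
  and a move increases each term. A merge enlarges both unions, so it increases the interaction by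
  monotonicity alone.\<close>

lemma interaction_evolve:
  assumes [measurable]: "k \<in> borel_measurable borel" and k: "symmetric_decreasing k" and "0 \<le> \<tau>"
    and Is: "ordered_intervals Is" and Js: "ordered_intervals Js"
  shows "interaction k (interval_union Is) (interval_union Js) \<le>
    interaction k (interval_union (evolve \<tau> Is)) (interval_union (evolve \<tau> Js))"
proof -
  let ?q = "\<lambda>Is Js. interaction k (interval_union Is) (interval_union Js)"
  let ?R = "\<lambda>(_::real) Is' Js'. ?q Is Js \<le> ?q Is' Js'"
  have move: "?q As Bs \<le> ?q (map (move_interval \<sigma>) As) (map (move_interval \<sigma>) Bs)"
    if "0 \<le> \<sigma>" "ordered_intervals As" "ordered_intervals Bs"
      "ordered_intervals (map (move_interval \<sigma>) As)" "ordered_intervals (map (move_interval \<sigma>) Bs)" for \<sigma> As Bs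
    using that by (simp add: interaction_interval_union comp_def)
      (intro sum_list_mono interaction_move_interval k assms(1))
  have merge: "?q As Bs \<le> ?q (merge_touching As) (merge_touching Bs)"
    if "ordered_intervals As" "ordered_intervals Bs" for As Bs
    using that by (intro interaction_mono refines_interval_union refines_merge_touching)
  have "?R (0 + \<tau>) (evolve \<tau> Is) (evolve \<tau> Js)"
    using evolve_pair_induct[OF \<open>0 \<le> \<tau>\<close> Is Js, of ?R 0] move merge order_trans by blast
  then show ?thesis .
qed

lemma interaction_incseq:
  assumes [measurable]: "k \<in> borel_measurable borel" "\<And>m. A m \<in> sets borel" "\<And>m. B m \<in> sets borel"
    and A: "incseq A" and B: "incseq B"
  shows "interaction k (\<Union>m. A m) (\<Union>m. B m) = (SUP m. interaction k (A m) (B m))"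
proof -
  have ind: "incseq (\<lambda>m. indicator (S m) t :: ennreal)" if "incseq S" for S :: "nat \<Rightarrow> real set" and t
    using that by (auto simp: incseq_def indicator_def)
  have SUP_ind: "(SUP m. indicator (S m) t :: ennreal) = indicator (\<Union>m. S m) t"
    if "incseq S" for S :: "nat \<Rightarrow> real set" and t
    by (rule antisym) (auto simp: indicator_def intro!: SUP_least intro: SUP_upper2)
  have inner: "(\<integral>\<^sup>+s. k (t - s) * indicator (\<Union>m. B m) s \<partial>lborel) =
      (SUP m. \<integral>\<^sup>+s. k (t - s) * indicator (B m) s \<partial>lborel)" for t
    unfolding SUP_ind[OF B, symmetric] SUP_mult_left_ennreal
    using ind[OF B] by (intro nn_integral_monotone_convergence_SUP)
      (auto simp: incseq_def le_fun_def intro!: mult_left_mono)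
  have inner_mono: "incseq (\<lambda>m. \<integral>\<^sup>+s. k (t - s) * indicator (B m) s \<partial>lborel)" for t
    using ind[OF B] by (auto simp: incseq_def intro!: nn_integral_mono mult_left_mono)
  define h where "h m t = (\<integral>\<^sup>+s. k (t - s) * indicator (B m) s \<partial>lborel)" for m t
  have h: "h m t \<le> h n t" if "m \<le> n" for m n t
    using inner_mono that by (auto simp: incseq_def h_def)
  \<comment> \<open>Both factors increase in \<open>m\<close>, so the product of the suprema is
    attained along the diagonal: once \<open>t\<close> lies in \<open>A n\<close>, the index
    \<open>max m n\<close> serves both.\<close>
  have "(SUP m. h m t) * indicator (\<Union>m. A m) t = (SUP m. h m t * indicator (A m) t)" for t
  proof (cases "t \<in> (\<Union>m. A m)")
    case True
    then obtain n where n: "t \<in> A n" by blast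
    have "h m t \<le> (SUP m. h m t * indicator (A m) t)" for m
    proof -
      have "t \<in> A (max m n)"
        using n incseqD[OF A, of n "max m n"] by auto
      then show ?thesis
        using h[of m "max m n" t] by (intro SUP_upper2[of "max m n"]) auto
    qed
    moreover have "h m t * indicator (A m) t \<le> (SUP m. h m t)" for m
      by (rule SUP_upper2[of m]) (auto simp: indicator_def)
    ultimately show ?thesis
      using True by (intro antisym) (auto intro!: SUP_least)
  next
    case False
    then show ?thesis by simp
  qed
  then have "interaction k (\<Union>m. A m) (\<Union>m. B m) = (\<integral>\<^sup>+t. (SUP m. h m t * indicator (A m) t) \<partial>lborel)"
    unfolding interaction_def inner by (simp add: h_def)
  also have "\<dots> = (SUP m. \<integral>\<^sup>+t. h m t * indicator (A m) t \<partial>lborel)"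
  proof (rule nn_integral_monotone_convergence_SUP)
    show "incseq (\<lambda>m t. h m t * indicator (A m) t)"
      using ind[OF A] h by (auto simp: incseq_def le_fun_def intro!: mult_mono)
    show "(\<lambda>t. h m t * indicator (A m) t) \<in> borel_measurable lborel" for m
      unfolding h_def by measurable
  qed
  also have "\<dots> = (SUP m. interaction k (A m) (B m))"
    by (simp add: interaction_def h_def)
  finally show ?thesis .
qed

section \<open>Symmetrization of open sets\<close>

lemma open_connected_bounded_eq:
  fixes S :: "real set"
  assumes "open S" "connected S" "bounded S" "S \<noteq> {}"
  shows "S = {Inf S<..<Sup S}" "Inf S < Sup S"
proof -
  have bdd: "bdd_above S" "bdd_below S"
    using assms(3) by (auto simp: bounded_imp_bdd_above bounded_imp_bdd_below)
  have 1: "Inf S < x \<and> x < Sup S" if x: "x \<in> S" for x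
  proof -
    obtain e where e: "0 < e" "ball x e \<subseteq> S"
      using open_contains_ball_eq[OF assms(1), of x] x by blast
    then have "x - e / 2 \<in> S" "x + e / 2 \<in> S"
      by (auto simp: subset_iff dist_real_def)
    then show ?thesis
      using e(1) cInf_lower[OF _ bdd(2), of "x - e / 2"] cSup_upper[OF _ bdd(1), of "x + e / 2"] by auto
  qed
  have 2: "x \<in> S" if x: "Inf S < x" "x < Sup S" for x
  proof -
    obtain a b where "a \<in> S" "a < x" "b \<in> S" "x < b"
      using x cInf_less_iff[OF assms(4) bdd(2), of x] less_cSup_iff[OF assms(4) bdd(1), of x] by blast
    then show ?thesis
      using connected_contains_Icc[OF assms(2), of a b] by auto
  qed
  show "S = {Inf S<..<Sup S}"
    using 1 2 by auto
  show "Inf S < Sup S"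
    using assms(4) 1 by fastforce
qed

text \<open>Needed for the definite description in \<open>interval_list\<close>. The left endpoints
  are strictly increasing, so the set determines their order, and each of them determines its
  interval.\<close>

lemma ordered_list_unique:
  assumes "ordered_intervals Is" "ordered_intervals Js" "set Is = set Js"
  shows "Is = Js"
proof -
  have sorted: "sorted_wrt (<) (map fst Ks)" if "ordered_intervals Ks" for Ks
    using that by (induction Ks) force+
  have "inj_on fst (set Is)"
  proof (rule inj_onI)
    fix I J assume "I \<in> set Is" "J \<in> set Is" "fst I = fst J"
    then show "I = J"
      using assms(1) sorted_wrt_cases[of "\<lambda>I J. snd I \<le> fst J" Is I J]
      by (fastforce simp: ordered_intervals_def)
  qed
  moreover have "map fst Is = map fst Js"
    using strict_sorted_equal[OF sorted[OF assms(1)] sorted[OF assms(2)]] assms(3) by simp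
  ultimately show ?thesis
    using assms(3) map_inj_on[of fst Is Js] by simp
qed

text \<open>Nondegenerate disjoint intervals have distinct left endpoints; these are sorted and then
  replaced by their intervals through \<open>g\<close>.\<close>

lemma ordered_list_exists:
  assumes "finite S" "\<And>I. I \<in> S \<Longrightarrow> fst I < snd I"
    and "\<And>I J. I \<in> S \<Longrightarrow> J \<in> S \<Longrightarrow> I \<noteq> J \<Longrightarrow> snd I \<le> fst J \<or> snd J \<le> (fst I :: real)"
  shows "\<exists>Is. ordered_intervals Is \<and> set Is = S"
proof -
  have inj: "inj_on fst S"
    using assms(2,3) by (intro inj_onI) (metis not_less order.strict_iff_not)
  define g where "g = inv_into S fst"
  define xs where "xs = sorted_list_of_set (fst ` S)"
  have g: "g a \<in> S" "fst (g a) = a" if "a \<in> fst ` S" for a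
    using that by (auto simp: g_def inv_into_into f_inv_into_f)
  have gf: "g (fst I) = I" if "I \<in> S" for I
    using that inj by (simp add: g_def)
  have xs: "sorted_wrt (<) xs" "set xs = fst ` S"
    using assms(1) by (auto simp: xs_def)
  have "sorted_wrt (\<lambda>a b. snd (g a) \<le> fst (g b)) xs"
  proof (rule sorted_wrt_mono_rel[OF _ xs(1)])
    fix a b assume ab: "a \<in> set xs" "b \<in> set xs" "a < b"
    then have "g a \<in> S" "g b \<in> S" "fst (g a) = a" "fst (g b) = b"
      using g xs(2) by auto
    then show "snd (g a) \<le> fst (g b)"
      using ab assms(2)[of "g b"] assms(3)[of "g a" "g b"] by fastforce
  qed
  moreover have "fst (g a) < snd (g a)" if "a \<in> set xs" for a
    using that g(1) xs(2) by (intro assms(2)) blast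
  ultimately have "ordered_intervals (map g xs)"
    unfolding ordered_intervals_def sorted_wrt_map set_map by blast
  moreover have "set (map g xs) = S"
    using xs gf by force
  ultimately show ?thesis by blast
qed

lemma interval_list:
  assumes "finite C" "pairwise disjnt C"
    and C: "\<And>S. S \<in> C \<Longrightarrow> open S \<and> connected S \<and> bounded S \<and> S \<noteq> {}"
  shows "ordered_intervals (interval_list C)"
    and "set (interval_list C) = (\<lambda>S. (Inf S, Sup S)) ` C"
    and "interval_union (interval_list C) = \<Union>C"
proof -
  let ?f = "\<lambda>S::real set. (Inf S, Sup S)"
  have C': "S = {Inf S<..<Sup S}" "Inf S < Sup S" if "S \<in> C" for S
    using open_connected_bounded_eq[of S] C[OF that] by blast+
  have "\<exists>Is. ordered_intervals Is \<and> set Is = ?f ` C"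
  proof (rule ordered_list_exists)
    show "finite (?f ` C)" using assms(1) by simp
    show "fst I < snd I" if "I \<in> ?f ` C" for I
      using that C'(2) by auto
    fix I J assume "I \<in> ?f ` C" "J \<in> ?f ` C" "I \<noteq> J"
    then obtain S T where ST: "S \<in> C" "T \<in> C" "I = ?f S" "J = ?f T" "S \<noteq> T"
      by auto
    then have "S \<inter> T = {}"
      using assms(2) by (auto simp: pairwise_def disjnt_def)
    then have "{Inf S<..<Sup S} \<inter> {Inf T<..<Sup T} = {}"
      using C'(1) ST by metis
    then have "\<not> max (Inf S) (Inf T) < min (Sup S) (Sup T)"
      using dense[of "max (Inf S) (Inf T)" "min (Sup S) (Sup T)"] by auto
    then show "snd I \<le> fst J \<or> snd J \<le> fst I"
      using C'(2)[OF ST(1)] C'(2)[OF ST(2)] ST(3,4) by (auto simp: min_def max_def split: if_splits)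
  qed
  then obtain Is where Is: "ordered_intervals Is" "set Is = ?f ` C" by blast
  have "interval_list C = Is"
    unfolding interval_list_def
  proof (rule the_equality)
    fix Js assume Js: "sorted_wrt (\<lambda>I J. snd I \<le> fst J) Js \<and> set Js = ?f ` C"
    then have "ordered_intervals Js"
      using C'(2) unfolding ordered_intervals_def by auto
    then show "Js = Is"
      using ordered_list_unique[of Js Is] Is Js by simp
  qed (use Is in \<open>auto simp: ordered_intervals_def\<close>)
  then show "ordered_intervals (interval_list C)" "set (interval_list C) = ?f ` C"
    using Is by auto
  then show "interval_union (interval_list C) = \<Union>C"
    using C'(1) unfolding interval_union_def by auto
qed

lemma refines_iff:
  assumes "ordered_intervals Is"
  shows "refines Is Js \<longleftrightarrow>
    (\<forall>I\<in>set Is. \<exists>J\<in>set Js. {fst I<..<snd I} \<subseteq> {fst J<..<snd J})"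
proof -
  have "subinterval I J \<longleftrightarrow> {fst I<..<snd I} \<subseteq> {fst J<..<snd J}" if "fst I < snd I" for I J
    using that by (auto simp: subinterval_def greaterThanLessThan_subseteq_greaterThanLessThan)
  then show ?thesis
    using assms by (simp add: refines_def ordered_intervals_def)
qed

lemma refines_interval_list:
  assumes "finite C" "pairwise disjnt C"
    and C: "\<And>S. S \<in> C \<Longrightarrow> open S \<and> connected S \<and> bounded S \<and> S \<noteq> {}"
    and Is: "ordered_intervals Is" "\<And>I. I \<in> set Is \<Longrightarrow> \<exists>S\<in>C. {fst I<..<snd I} \<subseteq> S"
  shows "refines Is (interval_list C)"
  unfolding refines_iff[OF Is(1)]
proof
  fix I assume "I \<in> set Is"
  then obtain S where S: "S \<in> C" "{fst I<..<snd I} \<subseteq> S"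
    using Is(2) by blast
  then have "(Inf S, Sup S) \<in> set (interval_list C)" "S = {Inf S<..<Sup S}"
    using interval_list(2)[OF assms(1-3)] open_connected_bounded_eq[of S] C by auto
  then show "\<exists>J\<in>set (interval_list C). {fst I<..<snd I} \<subseteq> {fst J<..<snd J}"
    using S(2) by (intro bexI[of _ "(Inf S, Sup S)"]) auto
qed

lemma evolve_subset:
  assumes "0 \<le> \<tau>" "ordered_intervals Is" "ordered_intervals Js" "refines Is Js"
  shows "interval_union (evolve \<tau> Is) \<subseteq> interval_union (evolve \<tau> Js)"
  by (intro refines_interval_union evolve_refines assms)

lemma csteiner_finite_eq: "csteiner_finite \<tau> C = interval_union (evolve \<tau> (interval_list C))"
  by (simp add: csteiner_finite_def interval_union_def)

lemma interval_in_component: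
  fixes U :: "real set"
  assumes "a < b" "{a<..<b} \<subseteq> U"
  shows "\<exists>S\<in>components U. {a<..<b} \<subseteq> S"
proof -
  have "{a<..<b} \<noteq> {}"
    using assms(1) by simp
  then show ?thesis
    using exists_component_superset[of "{a<..<b}" U] assms(2) connected_Ioo[of a b] by blast
qed

lemma components_real:
  fixes U :: "real set"
  assumes "open U" "\<forall>S\<in>components U. bounded S" "C \<subseteq> components U"
  shows "pairwise disjnt C" "\<And>S. S \<in> C \<Longrightarrow> open S \<and> connected S \<and> bounded S \<and> S \<noteq> {}"
proof -
  show "pairwise disjnt C"
    using assms(3) pairwise_disjoint_components[of U] unfolding pairwise_def disjnt_def by blast
  show "open S \<and> connected S \<and> bounded S \<and> S \<noteq> {}" if "S \<in> C" for S
    using that assms open_components[OF assms(1)] in_components_connected[of S U]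
      in_components_nonempty[of S U] by blast
qed

lemma countable_components:
  fixes U :: "real set"
  assumes "open U"
  shows "countable (components U)"
  using open_components[OF assms] pairwise_disjoint_components[of U]
  by (intro countable_disjoint_open_subsets) (auto simp: pairwise_def disjnt_def)

text \<open>By monotonicity it does not matter through which finite lists a set is exhausted: any
  list inside \<open>U\<close> refines a finite set of components, and these occur among the first
  \<open>m\<close> for large \<open>m\<close>. The distinction between finitely and infinitely many
  components disappears.\<close>

lemma csteiner_bounded_eq:
  assumes "0 \<le> \<tau>" "open U" and bdd: "\<forall>S\<in>components U. bounded S"
  shows "csteiner_bounded \<tau> U =
    (\<Union>Is\<in>{Is. ordered_intervals Is \<and> interval_union Is \<subseteq> U}. interval_union (evolve \<tau> Is))"
    (is "_ = ?r")
proof -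
  note C = components_real[OF assms(2) bdd]
  have sub: "csteiner_finite \<tau> C \<subseteq> ?r" if "finite C" "C \<subseteq> components U" for C
  proof -
    have "\<Union>C \<subseteq> U"
      using that(2) Union_components[of U] by blast
    then show ?thesis
      using interval_list[OF that(1) C[OF that(2)]] by (force simp: csteiner_finite_eq)
  qed
  have super: "interval_union (evolve \<tau> Is) \<subseteq> csteiner_finite \<tau> C"
    if "finite C" "C \<subseteq> components U" "ordered_intervals Is"
      "\<And>I. I \<in> set Is \<Longrightarrow> \<exists>S\<in>C. {fst I<..<snd I} \<subseteq> S" for C Is
    unfolding csteiner_finite_eq
    using that by (intro evolve_subset assms refines_interval_list interval_list C) auto
  have comp: "\<exists>S\<in>components U. {fst I<..<snd I} \<subseteq> S"
    if "ordered_intervals Is" "interval_union Is \<subseteq> U" "I \<in> set Is" for I Is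
    using that by (intro interval_in_component) (auto simp: ordered_intervals_def subset_iff mem_interval_union)
  show ?thesis
  proof (cases "finite (components U)")
    case True
    then show ?thesis
      using sub[OF True subset_refl] super[OF True subset_refl] comp
      unfolding csteiner_bounded_def if_P[OF True]
      by (intro equalityI UN_least) (assumption, blast)
  next
    case False
    have enum: "from_nat_into (components U) ` {..<m} \<subseteq> components U" for m
      using False by (auto intro: from_nat_into)
    have "interval_union (evolve \<tau> Is) \<subseteq> (\<Union>m. csteiner_finite \<tau> (from_nat_into (components U) ` {..<m}))"
      if Is: "ordered_intervals Is" "interval_union Is \<subseteq> U" for Is
    proof -
      obtain S where S: "\<And>I. I \<in> set Is \<Longrightarrow> S I \<in> components U \<and> {fst I<..<snd I} \<subseteq> S I"
        using comp[OF Is] by metis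
      define n where "n I = to_nat_on (components U) (S I)" for I
      define m where "m = Suc (Max (n ` set Is))"
      have n: "from_nat_into (components U) (n I) = S I" "n I < m" if "I \<in> set Is" for I
        using that S countable_components[OF assms(2)] by (auto simp: n_def m_def le_imp_less_Suc)
      have "interval_union (evolve \<tau> Is) \<subseteq> csteiner_finite \<tau> (from_nat_into (components U) ` {..<m})"
      proof (intro super enum Is)
        fix I assume "I \<in> set Is"
        then show "\<exists>S\<in>from_nat_into (components U) ` {..<m}. {fst I<..<snd I} \<subseteq> S"
          using S[of I] n[of I] by (intro bexI[of _ "S I"] image_eqI[of _ _ "n I"]) auto
      qed auto
      then show ?thesis by blast
    qed
    then show ?thesis
      using sub[OF _ enum] unfolding csteiner_bounded_def if_not_P[OF False]
      by (intro equalityI UN_least) (simp, blast)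
  qed
qed

text \<open>The working description of the symmetrization. Unbounded components fit in because a
  finite list is bounded and therefore lies in one of the exhausting sets.\<close>

lemma csteiner_set_eq:
  assumes "0 \<le> \<tau>" "open U"
  shows "csteiner_set \<tau> U =
    (\<Union>Is\<in>{Is. ordered_intervals Is \<and> interval_union Is \<subseteq> U}. interval_union (evolve \<tau> Is))"
proof (cases "\<forall>I\<in>components U. bounded I")
  case True
  then show ?thesis
    using csteiner_bounded_eq[OF assms] by (simp add: csteiner_set_def)
next
  case False
  let ?V = "\<lambda>k. U \<inter> {- real k<..<real k}"
  have V: "csteiner_bounded \<tau> (?V k) =
      (\<Union>Is\<in>{Is. ordered_intervals Is \<and> interval_union Is \<subseteq> ?V k}. interval_union (evolve \<tau> Is))" for k
    using assms by (intro csteiner_bounded_eq)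
      (auto intro!: bounded_subset[OF bounded_closed_interval[of "- real k" "real k"]] dest!: in_components_subset)
  have "\<exists>k. interval_union Is \<subseteq> {- real k<..<real k}" for Is
  proof -
    have "bounded (interval_union Is)"
      by (auto simp: interval_union_def)
    then obtain M where M: "\<And>x. x \<in> interval_union Is \<Longrightarrow> \<bar>x\<bar> \<le> M"
      by (auto simp: bounded_iff)
    obtain k where "M < real k"
      using reals_Archimedean2 by blast
    then show ?thesis
      using M by (intro exI[of _ k]) (force simp: abs_le_iff)
  qed
  then show ?thesis
    unfolding csteiner_set_def if_not_P[OF False] V
  proof (intro equalityI UN_least)
    fix Is assume "Is \<in> {Is. ordered_intervals Is \<and> interval_union Is \<subseteq> U}"
    moreover obtain k where "interval_union Is \<subseteq> {- real k<..<real k}"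
      using \<open>\<And>Is. \<exists>k. interval_union Is \<subseteq> {- real k<..<real k}\<close> by blast
    ultimately show "interval_union (evolve \<tau> Is) \<subseteq>
        (\<Union>k. \<Union>Is\<in>{Is. ordered_intervals Is \<and> interval_union Is \<subseteq> ?V k}. interval_union (evolve \<tau> Is))"
      by blast
  qed auto
qed

lemma open_csteiner_set: "0 \<le> \<tau> \<Longrightarrow> open U \<Longrightarrow> open (csteiner_set \<tau> U)"
  by (auto simp: csteiner_set_eq)

lemma csteiner_set_mono:
  "0 \<le> \<tau> \<Longrightarrow> open U \<Longrightarrow> open V \<Longrightarrow> U \<subseteq> V \<Longrightarrow> csteiner_set \<tau> U \<subseteq> csteiner_set \<tau> V"
  by (fastforce simp: csteiner_set_eq)

text \<open>A cofinal sequence among the finite lists inside \<open>U\<close>, chosen independently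
  of the time: the first \<open>m\<close> components, cut off at distance \<open>m\<close> from the
  origin. It makes monotone convergence available.\<close>

lemma open_exhaustion:
  fixes U :: "real set"
  assumes "open U"
  shows "\<exists>Ls :: nat \<Rightarrow> (real \<times> real) list. (\<forall>m. ordered_intervals (Ls m)) \<and>
    (\<forall>m n. m \<le> n \<longrightarrow> refines (Ls m) (Ls n)) \<and> (\<Union>m. interval_union (Ls m)) = U \<and>
    (\<forall>Is. ordered_intervals Is \<longrightarrow> interval_union Is \<subseteq> U \<longrightarrow> (\<exists>m. refines Is (Ls m)))"
proof -
  define c where "c = from_nat_into (components U)"
  \<comment> \<open>Membership in \<open>components U\<close> is required separately because
    \<open>from_nat_into\<close> returns an arbitrary value when there are no components. Empty
    pieces are removed so that \<open>interval_list\<close> applies.\<close>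
  define D where "D m = {S \<inter> {- real m<..<real m} |S. S \<in> components U \<and> S \<in> c ` {..<m}} - {{}}" for m
  have fin: "finite (D m)" for m
  proof (rule finite_subset)
    show "D m \<subseteq> (\<lambda>S. S \<inter> {- real m<..<real m}) ` c ` {..<m}"
      by (auto simp: D_def)
  qed auto
  have disj: "pairwise disjnt (D m)" for m
    using pairwise_disjoint_components[of U] unfolding pairwise_def disjnt_def D_def by blast
  have D: "open S \<and> connected S \<and> bounded S \<and> S \<noteq> {}" if S: "S \<in> D m" for S m
  proof -
    obtain T where T: "T \<in> components U" "S = T \<inter> {- real m<..<real m}" "S \<noteq> {}"
      using S unfolding D_def by blast
    moreover have "connected S"
      using T in_components_connected[of T U]
      by (auto simp: is_interval_connected_1[symmetric] intro!: is_interval_Int is_interval_oo)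
    ultimately show ?thesis
      using open_components[OF assms T(1)] by (auto intro: bounded_subset[OF bounded_closed_interval[of "- real m" "real m"]])
  qed
  define Ls where "Ls m = interval_list (D m)" for m
  note L = interval_list[OF fin disj D, folded Ls_def]
  have idx: "\<exists>n. c n = S" if "S \<in> components U" for S
    using that countable_components[OF assms] unfolding c_def
    by (metis from_nat_into_to_nat_on)
  have ord: "ordered_intervals (Ls m)" for m
    by (rule L)
  have "\<exists>T\<in>D n. S \<subseteq> T" if S: "S \<in> D m" "m \<le> n" for S m n
  proof -
    obtain T where T: "T \<in> components U" "T \<in> c ` {..<m}" "S = T \<inter> {- real m<..<real m}" "S \<noteq> {}"
      using S(1) by (auto simp: D_def)
    then have "T \<inter> {- real n<..<real n} \<in> D n"
      using S(2) unfolding D_def by fastforce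
    then show ?thesis
      using T S(2) by (intro bexI[of _ "T \<inter> {- real n<..<real n}"]) auto
  qed
  moreover have "{fst I<..<snd I} \<in> D m" if "I \<in> set (Ls m)" for I m
  proof -
    obtain S where S: "S \<in> D m" "I = (Inf S, Sup S)"
      using \<open>I \<in> set (Ls m)\<close> L(2)[of m] by auto
    then have "{fst I<..<snd I} = S"
      using open_connected_bounded_eq(1)[of S] D[of S m] by simp
    then show ?thesis using S by simp
  qed
  ultimately have sub: "\<exists>T\<in>D n. {fst I<..<snd I} \<subseteq> T" if "I \<in> set (Ls m)" "m \<le> n" for I m n
    using that by metis
  have ref: "refines (Ls m) (Ls n)" if "m \<le> n" for m n
    unfolding Ls_def[of n] using \<open>m \<le> n\<close>
    by (intro refines_interval_list fin disj D L(1) sub)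
  have cofinal: "\<exists>m. refines Is (Ls m)" if Is: "ordered_intervals Is" "interval_union Is \<subseteq> U" for Is
  proof -
    have "\<exists>S\<in>components U. {fst I<..<snd I} \<subseteq> S" if "I \<in> set Is" for I
      using that Is by (intro interval_in_component) (auto simp: ordered_intervals_def subset_iff mem_interval_union)
    then obtain n where n: "\<And>I. I \<in> set Is \<Longrightarrow> c (n I) \<in> components U \<and> {fst I<..<snd I} \<subseteq> c (n I)"
    proof -
      have "\<forall>I\<in>set Is. \<exists>n. c n \<in> components U \<and> {fst I<..<snd I} \<subseteq> c n"
        using idx \<open>\<And>I. I \<in> set Is \<Longrightarrow> \<exists>S\<in>components U. {fst I<..<snd I} \<subseteq> S\<close> by fastforce
      from bchoice[OF this] show thesis
        using that by blast
    qed
    have "\<exists>k. {fst I<..<snd I} \<subseteq> {- real k<..<real k}" for I :: "real \<times> real"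
    proof -
      obtain k where "max (snd I) (- fst I) < real k"
        using reals_Archimedean2 by blast
      then show ?thesis by (intro exI[of _ k]) auto
    qed
    then obtain k where k: "\<And>I :: real \<times> real. {fst I<..<snd I} \<subseteq> {- real (k I)<..<real (k I)}"
      by metis
    define m where "m = Suc (Max ((\<lambda>I. max (n I) (k I)) ` set Is))"
    have m: "n I < m" "k I \<le> m" if "I \<in> set Is" for I
    proof -
      have "max (n I) (k I) \<le> Max ((\<lambda>I. max (n I) (k I)) ` set Is)"
        using that by (intro Max_ge) auto
      then show "n I < m" "k I \<le> m" by (auto simp: m_def)
    qed
    have "refines Is (Ls m)"
      unfolding Ls_def
    proof (intro refines_interval_list fin disj D Is(1))
      fix I assume I: "I \<in> set Is"
      have "{fst I<..<snd I} \<subseteq> {- real m<..<real m}"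
        using k[of I] m(2)[OF I] by (force simp: subset_iff)
      then have sub: "{fst I<..<snd I} \<subseteq> c (n I) \<inter> {- real m<..<real m}"
        using n[OF I] by auto
      have "fst I < snd I"
        using I Is(1) unfolding ordered_intervals_def by blast
      then have "{fst I<..<snd I} \<noteq> {}"
        by simp
      then have "c (n I) \<inter> {- real m<..<real m} \<in> D m"
        using n[OF I] m(1)[OF I] sub unfolding D_def by blast
      then show "\<exists>S\<in>D m. {fst I<..<snd I} \<subseteq> S"
        using sub by blast
    qed
    then show ?thesis by blast
  qed
  have union: "(\<Union>m. interval_union (Ls m)) = U"
  proof
    show "(\<Union>m. interval_union (Ls m)) \<subseteq> U"
    proof (rule UN_least)
      fix m
      have "interval_union (Ls m) = \<Union>(D m)"
        by (rule L(3))
      also have "\<dots> \<subseteq> U"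
        unfolding D_def using in_components_subset[of _ U] by auto
      finally show "interval_union (Ls m) \<subseteq> U" .
    qed
    show "U \<subseteq> (\<Union>m. interval_union (Ls m))"
    proof
      fix x assume "x \<in> U"
      then obtain e where "e > 0" "ball x e \<subseteq> U"
        using open_contains_ball_eq[OF assms] by auto
      then obtain m where "refines [(x - e, x + e)] (Ls m)"
        using cofinal[of "[(x - e, x + e)]"] by (auto simp: ball_eq_greaterThanLessThan)
      then show "x \<in> (\<Union>m. interval_union (Ls m))"
        using refines_interval_union[of "[(x - e, x + e)]" "Ls m"] \<open>e > 0\<close> by (intro UN_I[of m]) auto
    qed
  qed
  show ?thesis
  using ord ref cofinal union by blast
qed

text \<open>The same lists exhaust \<open>U\<close> and, once evolved, its symmetrization. Measure
  and interaction statements thus pass from finite lists to all open sets.\<close>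

lemma csteiner_set_exhaustion:
  fixes U :: "real set"
  assumes "0 \<le> \<tau>" "open U"
  shows "\<exists>Ls :: nat \<Rightarrow> (real \<times> real) list. (\<forall>m. ordered_intervals (Ls m)) \<and>
    incseq (\<lambda>m. interval_union (Ls m)) \<and> (\<Union>m. interval_union (Ls m)) = U \<and>
    incseq (\<lambda>m. interval_union (evolve \<tau> (Ls m))) \<and>
    (\<Union>m. interval_union (evolve \<tau> (Ls m))) = csteiner_set \<tau> U"
proof -
  from open_exhaustion[OF assms(2)] show ?thesis
  proof (elim exE conjE)
    fix Ls :: "nat \<Rightarrow> (real \<times> real) list"
    assume L0: "\<forall>m. ordered_intervals (Ls m)" "\<forall>m n. m \<le> n \<longrightarrow> refines (Ls m) (Ls n)"
      "(\<Union>m. interval_union (Ls m)) = U"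
      "\<forall>Is. ordered_intervals Is \<longrightarrow> interval_union Is \<subseteq> U \<longrightarrow> (\<exists>m. refines Is (Ls m))"
    note L = L0[rule_format]
    show ?thesis
    proof (intro exI[of _ Ls] conjI)
      show "(\<Union>m. interval_union (evolve \<tau> (Ls m))) = csteiner_set \<tau> U"
        unfolding csteiner_set_eq[OF assms]
      proof (intro equalityI UN_least)
        fix m show "interval_union (evolve \<tau> (Ls m)) \<subseteq>
            (\<Union>Is\<in>{Is. ordered_intervals Is \<and> interval_union Is \<subseteq> U}. interval_union (evolve \<tau> Is))"
          using L(1,3) by blast
      next
        fix Is assume Is: "Is \<in> {Is. ordered_intervals Is \<and> interval_union Is \<subseteq> U}"
        then obtain m where "refines Is (Ls m)"
          using L(4) by blast
        then show "interval_union (evolve \<tau> Is) \<subseteq> (\<Union>m. interval_union (evolve \<tau> (Ls m)))"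
          using evolve_subset[OF assms(1), of Is "Ls m"] Is L(1) by blast
      qed
    qed (use L assms in \<open>auto simp: incseq_def intro!: evolve_subset evolve_refines refines_interval_union\<close>)
  qed
qed

lemma emeasure_csteiner_set:
  assumes "0 \<le> \<tau>" "open U"
  shows "emeasure lborel (csteiner_set \<tau> U) = emeasure lborel U"
proof -
  from csteiner_set_exhaustion[OF assms] show ?thesis
  proof (elim exE conjE)
    fix Ls :: "nat \<Rightarrow> (real \<times> real) list"
    assume L: "\<forall>m. ordered_intervals (Ls m)"
      "incseq (\<lambda>m. interval_union (Ls m))" "(\<Union>m. interval_union (Ls m)) = U"
      "incseq (\<lambda>m. interval_union (evolve \<tau> (Ls m)))"
      "(\<Union>m. interval_union (evolve \<tau> (Ls m))) = csteiner_set \<tau> U"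
    have "emeasure lborel (csteiner_set \<tau> U) = (SUP m. emeasure lborel (interval_union (evolve \<tau> (Ls m))))"
      unfolding L(5)[symmetric] using L(4) by (intro SUP_emeasure_incseq[symmetric]) auto
    also have "\<dots> = (SUP m. emeasure lborel (interval_union (Ls m)))"
      using emeasure_evolve[OF assms(1)] L(1) by simp
    also have "\<dots> = emeasure lborel U"
      unfolding L(3)[symmetric] using L(2) by (intro SUP_emeasure_incseq) auto
    finally show ?thesis .
  qed
qed

lemma interaction_csteiner_set:
  assumes [measurable]: "k \<in> borel_measurable borel" and "symmetric_decreasing k"
    and "0 \<le> \<tau>" "open U" "open V"
  shows "interaction k U V \<le> interaction k (csteiner_set \<tau> U) (csteiner_set \<tau> V)"
proof -
  from csteiner_set_exhaustion[OF assms(3,4)] show ?thesis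
  proof (elim exE conjE)
    fix Ls :: "nat \<Rightarrow> (real \<times> real) list"
    assume L: "\<forall>m. ordered_intervals (Ls m)"
      "incseq (\<lambda>m. interval_union (Ls m))" "(\<Union>m. interval_union (Ls m)) = U"
      "incseq (\<lambda>m. interval_union (evolve \<tau> (Ls m)))"
      "(\<Union>m. interval_union (evolve \<tau> (Ls m))) = csteiner_set \<tau> U"
    from csteiner_set_exhaustion[OF assms(3,5)] show ?thesis
    proof (elim exE conjE)
      fix Ms :: "nat \<Rightarrow> (real \<times> real) list"
      assume M: "\<forall>m. ordered_intervals (Ms m)"
        "incseq (\<lambda>m. interval_union (Ms m))" "(\<Union>m. interval_union (Ms m)) = V"
        "incseq (\<lambda>m. interval_union (evolve \<tau> (Ms m)))"
        "(\<Union>m. interval_union (evolve \<tau> (Ms m))) = csteiner_set \<tau> V"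
      have "interaction k U V = (SUP m. interaction k (interval_union (Ls m)) (interval_union (Ms m)))"
        unfolding L(3)[symmetric] M(3)[symmetric] by (intro interaction_incseq L M) auto
      also have "\<dots> \<le> interaction k (csteiner_set \<tau> U) (csteiner_set \<tau> V)"
      proof (rule SUP_least)
        fix m
        have "interaction k (interval_union (Ls m)) (interval_union (Ms m)) \<le>
            interaction k (interval_union (evolve \<tau> (Ls m))) (interval_union (evolve \<tau> (Ms m)))"
          by (intro interaction_evolve assms L(1)[rule_format] M(1)[rule_format])
        also have "\<dots> \<le> interaction k (csteiner_set \<tau> U) (csteiner_set \<tau> V)"
          using L(5) M(5) by (intro interaction_mono) blast+
        finally show "interaction k (interval_union (Ls m)) (interval_union (Ms m)) \<le>
          interaction k (csteiner_set \<tau> U) (csteiner_set \<tau> V)" .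
      qed
      finally show ?thesis .
    qed
  qed
qed

lemma csteiner_set_within_distance:
  assumes "0 \<le> \<tau>" "open U" "x \<in> csteiner_set \<tau> U" "closed C" "U \<subseteq> C"
  shows "\<exists>y\<in>C. \<bar>y - x\<bar> \<le> \<tau>"
  using assms evolve_within_distance[OF assms(1)] by (auto simp: csteiner_set_eq)

text \<open>A one-element list has no contacts and just translates; monotonicity places the result
  inside the symmetrization of any larger open set, whatever merges there. All lower bounds on the
  gain rest on this.\<close>

lemma move_interval_subset_csteiner_set:
  assumes "0 \<le> \<tau>" "open U" "a < b" "{a<..<b} \<subseteq> U" "(a', b') = move_interval \<tau> (a, b)"
  shows "{a'<..<b'} \<subseteq> csteiner_set \<tau> U"
proof -
  have "evolve \<tau> [(a, b)] = [(a', b')]"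
    using assms(5) by (subst evolve.simps) (simp add: touching_times_def touching_def)
  then have "interval_union (evolve \<tau> [(a, b)]) = {a'<..<b'}"
    by simp
  moreover have "ordered_intervals [(a, b)]" "interval_union [(a, b)] \<subseteq> U"
    using assms by auto
  ultimately show ?thesis
    unfolding csteiner_set_eq[OF assms(1,2)] by blast
qed

section \<open>First-order gain of interaction\<close>

lemma interaction_commute:
  assumes [measurable]: "k \<in> borel_measurable borel" "U \<in> sets borel" "V \<in> sets borel"
    and k: "symmetric_decreasing k"
  shows "interaction k U V = interaction k V U"
proof -
  have "interaction k U V = (\<integral>\<^sup>+t. \<integral>\<^sup>+s. k (t - s) * indicator V s * indicator U t \<partial>lborel \<partial>lborel)"
    unfolding interaction_def by (simp add: nn_integral_multc)
  also have "\<dots> = (\<integral>\<^sup>+s. \<integral>\<^sup>+t. k (t - s) * indicator V s * indicator U t \<partial>lborel \<partial>lborel)"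
    by (rule lborel_pair.Fubini') measurable
  also have "\<dots> = (\<integral>\<^sup>+s. \<integral>\<^sup>+t. k (s - t) * indicator U t * indicator V s \<partial>lborel \<partial>lborel)"
    using symmetric_decreasing_even[OF k] by (intro nn_integral_cong) (metis minus_diff_eq mult.assoc mult.commute)
  also have "\<dots> = interaction k V U"
    unfolding interaction_def by (simp add: nn_integral_multc)
  finally show ?thesis .
qed

text \<open>The kernels for which a first-order gain can be quantified: subtracting a multiple of the
  concave parabola \<open>P\<^sup>2 - t\<^sup>2\<close> leaves a kernel that is still decreasing on \<open>[0, P]\<close>.\<close>

definition strongly_decreasing :: "real \<Rightarrow> real \<Rightarrow> (real \<Rightarrow> real) \<Rightarrow> bool" where
  "strongly_decreasing \<theta> P \<kappa> \<longleftrightarrow>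
     (\<forall>t. 0 \<le> \<kappa> t) \<and> (\<forall>s t. \<bar>s\<bar> \<le> \<bar>t\<bar> \<longrightarrow> \<kappa> t \<le> \<kappa> s) \<and>
     (\<forall>s t. \<bar>s\<bar> \<le> \<bar>t\<bar> \<longrightarrow> \<bar>t\<bar> \<le> P \<longrightarrow> \<kappa> t + \<theta> * (t\<^sup>2 - s\<^sup>2) \<le> \<kappa> s)"

lemma strongly_decreasing_imp: "strongly_decreasing \<theta> P \<kappa> \<Longrightarrow> symmetric_decreasing (\<lambda>t. ennreal (\<kappa> t))"
  by (auto simp: strongly_decreasing_def symmetric_decreasing_def intro: ennreal_leI)

lemma ennreal_mult3:
  "0 \<le> a \<Longrightarrow> 0 \<le> b \<Longrightarrow> 0 \<le> c \<Longrightarrow> ennreal (a * b * c) = ennreal a * ennreal b * ennreal c"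
  by (simp add: ennreal_mult)

lemma centered_interaction_add:
  assumes [measurable]: "k \<in> borel_measurable borel" "g \<in> borel_measurable borel"
  shows "centered_interaction (\<lambda>t. k t + g t) l l' d =
    centered_interaction k l l' d + centered_interaction g l l' d"
  unfolding centered_interaction_def by (simp add: distrib_right nn_integral_add)

lemma centered_interaction_cmult:
  assumes [measurable]: "k \<in> borel_measurable borel"
  shows "centered_interaction (\<lambda>t. c * k t) l l' d = c * centered_interaction k l l' d"
  unfolding centered_interaction_def by (simp add: nn_integral_cmult mult.assoc)

lemma centered_interaction_symmetrize:
  assumes [measurable]: "k \<in> borel_measurable borel"
  shows "2 * centered_interaction k l l' d =
    (\<integral>\<^sup>+x. (\<integral>\<^sup>+y. (k (y + x + d) + k (- (y + x) + d)) * indicator {- l'<..<l'} y \<partial>lborel) *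
      indicator {- l<..<l} x \<partial>lborel)"
proof -
  have ind: "indicator {- l<..<l} (- x) = (indicator {- l<..<l} x :: ennreal)" for l x :: real
    by (auto simp: indicator_def)
  have "(\<integral>\<^sup>+y. k (y + (- x + d)) * indicator {- l'<..<l'} y \<partial>lborel) =
      (\<integral>\<^sup>+y. k (- (y + x) + d) * indicator {- l'<..<l'} y \<partial>lborel)" for x
    using nn_integral_reflect[of "\<lambda>y. k (y + (- x + d)) * indicator {- l'<..<l'} y"]
    by (simp add: ind algebra_simps)
  then show ?thesis
    unfolding centered_interaction_def
    by (subst nn_integral_symmetrize)
       (simp_all add: ind distrib_right[symmetric] nn_integral_add[symmetric] add.assoc)
qed

text \<open>Adding the values at \<open>u\<close> and \<open>- u\<close> removes the term linear in
  \<open>u\<close>: what remains depends on \<open>d\<close> only through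
  \<open>- 2 * d\<^sup>2\<close>. So each pair of points gains the same amount \<open>g\<close>, and
  integration over an area \<open>4 * l * l'\<close>, halved for the symmetrization, gives the
  constant. The bound by \<open>P\<close> keeps all arguments where the parabola is not cut
  off.\<close>

lemma parabola_gain:
  fixes P d d' l l' :: real
  defines "L \<equiv> \<lambda>t. ennreal (max 0 (P\<^sup>2 - t\<^sup>2))"
  assumes d: "0 \<le> d'" "d' \<le> d" "l + l' + d \<le> P" "0 \<le> l" "0 \<le> l'"
  shows "centered_interaction L l l' d + ennreal (4 * l * l' * (d\<^sup>2 - d'\<^sup>2)) \<le> centered_interaction L l l' d'"
proof -
  have [measurable]: "L \<in> borel_measurable borel"
    unfolding L_def by measurable
  define g where "g = 2 * (d\<^sup>2 - d'\<^sup>2)"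
  have "0 \<le> g"
    using d unfolding g_def by (simp add: power_mono)
  have L: "L t = ennreal (P\<^sup>2 - t\<^sup>2)" if "\<bar>t\<bar> \<le> P" for t
  proof -
    have "t\<^sup>2 \<le> P\<^sup>2"
      using power_mono[OF that, of 2] by simp
    then show ?thesis by (simp add: L_def)
  qed
  have pos: "0 \<le> P\<^sup>2 - t\<^sup>2" if "\<bar>t\<bar> \<le> P" for t
    using power_mono[OF that, of 2] by simp
  have pt: "L (u + d) + L (- u + d) + ennreal g = L (u + d') + L (- u + d')" if "\<bar>u\<bar> \<le> l + l'" for u
  proof -
    have b: "\<bar>u + d\<bar> \<le> P" "\<bar>- u + d\<bar> \<le> P" "\<bar>u + d'\<bar> \<le> P" "\<bar>- u + d'\<bar> \<le> P"
      using that d by auto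
    show ?thesis
      unfolding L[OF b(1)] L[OF b(2)] L[OF b(3)] L[OF b(4)]
      using pos[OF b(1)] pos[OF b(2)] pos[OF b(3)] pos[OF b(4)] \<open>0 \<le> g\<close>
      by (simp add: ennreal_plus[symmetric] g_def power2_eq_square algebra_simps del: ennreal_plus)
  qed
  define F where "F d = (\<integral>\<^sup>+x. (\<integral>\<^sup>+y. (L (y + x + d) + L (- (y + x) + d)) * indicator {- l'<..<l'} y \<partial>lborel) *
      indicator {- l<..<l} x \<partial>lborel)" for d
  have "(\<integral>\<^sup>+x. ennreal g * ennreal (2 * l') * indicator {- l<..<l} x \<partial>lborel) =
      ennreal g * ennreal (2 * l') * ennreal (2 * l)"
    using d by (subst nn_integral_cmult_indicator) auto
  then have "F d + ennreal g * ennreal (2 * l') * ennreal (2 * l) =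
      (\<integral>\<^sup>+x. (\<integral>\<^sup>+y. (L (y + x + d) + L (- (y + x) + d) + ennreal g) * indicator {- l'<..<l'} y \<partial>lborel) *
      indicator {- l<..<l} x \<partial>lborel)"
    unfolding F_def using d
    by (simp add: distrib_right nn_integral_add nn_integral_cmult_indicator)
  also have "\<dots> = F d'"
    unfolding F_def
  proof (intro nn_integral_cong)
    fix x
    have "(L (y + x + d) + L (- (y + x) + d) + ennreal g) * indicator {- l'<..<l'} y =
        (L (y + x + d') + L (- (y + x) + d')) * indicator {- l'<..<l'} y" if "x \<in> {- l<..<l}" for y
      using that pt[of "y + x"] by (cases "y \<in> {- l'<..<l'}") auto
    then show "(\<integral>\<^sup>+y. (L (y + x + d) + L (- (y + x) + d) + ennreal g) * indicator {- l'<..<l'} y \<partial>lborel) *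
        indicator {- l<..<l} x =
      (\<integral>\<^sup>+y. (L (y + x + d') + L (- (y + x) + d')) * indicator {- l'<..<l'} y \<partial>lborel) * indicator {- l<..<l} x"
      by (cases "x \<in> {- l<..<l}") (auto intro!: nn_integral_cong)
  qed
  finally have F: "F d + ennreal g * ennreal (2 * l') * ennreal (2 * l) = F d'" .
  have "ennreal g * ennreal (2 * l') * ennreal (2 * l) = ennreal (g * (2 * l') * (2 * l))"
    using d \<open>0 \<le> g\<close> by (intro ennreal_mult3[symmetric]) auto
  also have "g * (2 * l') * (2 * l) = 2 * (4 * l * l' * (d\<^sup>2 - d'\<^sup>2))"
    by (simp add: g_def algebra_simps)
  also have "ennreal \<dots> = 2 * ennreal (4 * l * l' * (d\<^sup>2 - d'\<^sup>2))"
    using d by (subst ennreal_mult) (auto simp: power_mono)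
  finally have e: "ennreal g * ennreal (2 * l') * ennreal (2 * l) = 2 * ennreal (4 * l * l' * (d\<^sup>2 - d'\<^sup>2))" .
  have c: "2 * centered_interaction L l l' d = F d" for d
    unfolding F_def by (rule centered_interaction_symmetrize) measurable
  have "2 * (centered_interaction L l l' d + ennreal (4 * l * l' * (d\<^sup>2 - d'\<^sup>2))) =
      2 * centered_interaction L l l' d'"
    by (simp only: distrib_left c e[symmetric] F)
  then show ?thesis
    using ennreal_two_mult_le eq_refl by blast
qed

text \<open>Write \<open>\<kappa>\<close> as \<open>r + \<theta> * L\<close> with the cut-off
  parabola \<open>L\<close>. The remainder \<open>r\<close> is still symmetric decreasing and loses
  nothing; the whole gain comes from \<open>L\<close>.\<close>

lemma strongly_decreasing_gain:
  assumes [measurable]: "\<kappa> \<in> borel_measurable borel" and \<kappa>: "strongly_decreasing \<theta> P \<kappa>"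
    and "0 \<le> \<theta>" and d: "0 \<le> d'" "d' \<le> d" "l + l' + d \<le> P" "0 \<le> l" "0 \<le> l'"
  shows "centered_interaction (\<lambda>t. ennreal (\<kappa> t)) l l' d + ennreal (\<theta> * (4 * l * l' * (d\<^sup>2 - d'\<^sup>2))) \<le>
    centered_interaction (\<lambda>t. ennreal (\<kappa> t)) l l' d'"
proof -
  define L where "L t = max 0 (P\<^sup>2 - t\<^sup>2)" for t
  define r where "r t = \<kappa> t - \<theta> * L t" for t
  have [measurable]: "L \<in> borel_measurable borel"
    unfolding L_def[abs_def] by measurable
  have [measurable]: "r \<in> borel_measurable borel"
    unfolding r_def[abs_def] by measurable
  have "0 \<le> P" using d by simp
  have \<kappa>': "\<And>t. 0 \<le> \<kappa> t" "\<And>s t. \<bar>s\<bar> \<le> \<bar>t\<bar> \<Longrightarrow> \<kappa> t \<le> \<kappa> s"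
    "\<And>s t. \<bar>s\<bar> \<le> \<bar>t\<bar> \<Longrightarrow> \<bar>t\<bar> \<le> P \<Longrightarrow> \<kappa> t + \<theta> * (t\<^sup>2 - s\<^sup>2) \<le> \<kappa> s"
    using \<kappa> by (auto simp: strongly_decreasing_def)
  have L_in: "L t = P\<^sup>2 - t\<^sup>2" if "\<bar>t\<bar> \<le> P" for t
    using power_mono[OF that, of 2] by (simp add: L_def)
  have L_out: "L t = 0" if "P \<le> \<bar>t\<bar>" for t
    using power_mono[OF that, of 2] \<open>0 \<le> P\<close> by (simp add: L_def)
  have mono: "r t \<le> r s" if "\<bar>s\<bar> \<le> \<bar>t\<bar>" for s t
  proof -
    have *: "r t \<le> r s" if "\<bar>s\<bar> \<le> \<bar>t\<bar>" "\<bar>t\<bar> \<le> P" for s t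
      using \<kappa>'(3)[OF that] that by (simp add: r_def L_in algebra_simps)
    \<comment> \<open>When \<open>s\<close> and \<open>t\<close> lie on different sides of the
      cutoff, they are compared through the value at \<open>P\<close>, where \<open>L\<close>
      vanishes.\<close>
    consider "\<bar>t\<bar> \<le> P" | "\<bar>s\<bar> \<le> P" "P \<le> \<bar>t\<bar>" | "P \<le> \<bar>s\<bar>" "P \<le> \<bar>t\<bar>"
      using that by linarith
    then show ?thesis
    proof cases
      case 2
      have "r t \<le> r P"
        using 2 \<kappa>'(2)[of P t] \<open>0 \<le> P\<close> by (simp add: r_def L_out)
      also have "\<dots> \<le> r s"
        using 2 \<open>0 \<le> P\<close> by (intro *) auto
      finally show ?thesis .
    qed (use * that \<kappa>'(2) in \<open>auto simp: r_def L_out\<close>)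
  qed
  have r0: "0 \<le> r t" for t
  proof (cases "P \<le> \<bar>t\<bar>")
    case True
    then show ?thesis using \<kappa>'(1) by (simp add: r_def L_out)
  next
    case False
    then have "r P \<le> r t" using \<open>0 \<le> P\<close> by (intro mono) auto
    moreover have "0 \<le> r P" using \<kappa>'(1) \<open>0 \<le> P\<close> by (simp add: r_def L_out)
    ultimately show ?thesis by simp
  qed
  have "symmetric_decreasing (\<lambda>t. ennreal (r t))"
    using mono by (auto simp: symmetric_decreasing_def intro: ennreal_leI)
  then have 1: "centered_interaction (\<lambda>t. ennreal (r t)) l l' d \<le> centered_interaction (\<lambda>t. ennreal (r t)) l l' d'"
    using d by (intro symmetric_decreasingD[OF symmetric_decreasing_centered_interaction]) auto
  have 2: "centered_interaction (\<lambda>t. ennreal (L t)) l l' d + ennreal (4 * l * l' * (d\<^sup>2 - d'\<^sup>2)) \<le>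
      centered_interaction (\<lambda>t. ennreal (L t)) l l' d'"
    unfolding L_def by (rule parabola_gain) (use d in auto)
  have "ennreal (\<kappa> t) = ennreal (r t) + ennreal \<theta> * ennreal (L t)" for t
  proof -
    have "\<kappa> t = r t + \<theta> * L t" by (simp add: r_def)
    moreover have "0 \<le> L t" by (simp add: L_def)
    ultimately show ?thesis
      using r0[of t] \<open>0 \<le> \<theta>\<close> by (simp add: ennreal_mult)
  qed
  then have eq: "centered_interaction (\<lambda>t. ennreal (\<kappa> t)) l l' d =
      centered_interaction (\<lambda>t. ennreal (r t)) l l' d + ennreal \<theta> * centered_interaction (\<lambda>t. ennreal (L t)) l l' d" for d
    by (simp add: centered_interaction_add centered_interaction_cmult)
  have "0 \<le> 4 * l * l' * (d\<^sup>2 - d'\<^sup>2)"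
    using d by (simp add: power_mono)
  then have "ennreal \<theta> * centered_interaction (\<lambda>t. ennreal (L t)) l l' d + ennreal (\<theta> * (4 * l * l' * (d\<^sup>2 - d'\<^sup>2)))
      \<le> ennreal \<theta> * centered_interaction (\<lambda>t. ennreal (L t)) l l' d'"
    using mult_left_mono[OF 2, of "ennreal \<theta>"] \<open>0 \<le> \<theta>\<close> by (simp add: distrib_left ennreal_mult)
  then show ?thesis
    unfolding eq using add_mono[OF 1] by (simp add: add.assoc)
qed

text \<open>Both midpoints are at least \<open>\<tau>\<close> from the origin, on opposite sides, so
  they travel the full time and their distance \<open>D\<close> drops by \<open>2 * \<tau>\<close>.
  The factor \<open>\<eta> ^ 3\<close> bounds the two lengths and \<open>D\<close> from below. The
  largest distance between points of the two intervals is \<open>b - c\<close>, hence the bound by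
  \<open>P\<close>.\<close>

lemma gain_of_intervals:
  assumes [measurable]: "\<kappa> \<in> borel_measurable borel" and \<kappa>: "strongly_decreasing \<theta> P \<kappa>"
    and "0 \<le> \<theta>" "0 \<le> \<tau>" "a < b" "c < d" "\<tau> \<le> (a + b) / 2" "(c + d) / 2 \<le> - \<tau>" "b - c \<le> P"
    and \<eta>: "0 \<le> \<eta>" "\<eta> \<le> b - a" "\<eta> \<le> d - c" "\<eta> \<le> (a + b) / 2"
  shows "interaction (\<lambda>t. ennreal (\<kappa> t)) {a<..<b} {c<..<d} + ennreal (2 * \<theta> * \<eta> ^ 3 * \<tau>) \<le>
    interaction (\<lambda>t. ennreal (\<kappa> t)) (csteiner_set \<tau> {a<..<b}) (csteiner_set \<tau> {c<..<d})"
proof -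
  define l l' D where "l = (b - a) / 2" "l' = (d - c) / 2" "D = (a + b) / 2 - (c + d) / 2"
  have *: "0 \<le> D - 2 * \<tau>" "D - 2 * \<tau> \<le> D" "l + l' + D \<le> P" "0 \<le> l" "0 \<le> l'"
    using assms by (auto simp: l_l'_D_def field_simps)
  have D: "2 * D * \<tau> \<le> D\<^sup>2 - (D - 2 * \<tau>)\<^sup>2"
    using mult_nonneg_nonneg[OF *(1) \<open>0 \<le> \<tau>\<close>] by (simp add: power2_eq_square algebra_simps)
  have "\<eta> ^ 3 \<le> (2 * l) * (2 * l') * D"
  proof -
    have "\<eta> \<le> D" "\<eta> \<le> 2 * l" "\<eta> \<le> 2 * l'"
      using assms(4,8) \<eta> unfolding l_l'_D_def by (simp_all, linarith)
    then have "\<eta> * \<eta> * \<eta> \<le> (2 * l) * (2 * l') * D"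
      using \<eta>(1) * by (intro mult_mono) auto
    then show ?thesis by (simp add: power3_eq_cube)
  qed
  then have "\<eta> ^ 3 * (2 * \<tau>) \<le> (2 * l) * (2 * l') * D * (2 * \<tau>)"
    using \<open>0 \<le> \<tau>\<close> by (intro mult_right_mono) auto
  also have "\<dots> = 4 * l * l' * (2 * D * \<tau>)"
    by simp
  also have "\<dots> \<le> 4 * l * l' * (D\<^sup>2 - (D - 2 * \<tau>)\<^sup>2)"
    using D * by (intro mult_left_mono) auto
  finally have "\<theta> * (\<eta> ^ 3 * (2 * \<tau>)) \<le> \<theta> * (4 * l * l' * (D\<^sup>2 - (D - 2 * \<tau>)\<^sup>2))"
    using \<open>0 \<le> \<theta>\<close> by (intro mult_left_mono)
  then have "ennreal (2 * \<theta> * \<eta> ^ 3 * \<tau>) \<le> ennreal (\<theta> * (4 * l * l' * (D\<^sup>2 - (D - 2 * \<tau>)\<^sup>2)))"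
    by (intro ennreal_leI) (simp add: algebra_simps)
  then have "interaction (\<lambda>t. ennreal (\<kappa> t)) {a<..<b} {c<..<d} + ennreal (2 * \<theta> * \<eta> ^ 3 * \<tau>) \<le>
      centered_interaction (\<lambda>t. ennreal (\<kappa> t)) l l' D + ennreal (\<theta> * (4 * l * l' * (D\<^sup>2 - (D - 2 * \<tau>)\<^sup>2)))"
    by (intro add_mono) (auto simp: interaction_intervals l_l'_D_def)
  also have "\<dots> \<le> centered_interaction (\<lambda>t. ennreal (\<kappa> t)) l l' (D - 2 * \<tau>)"
    by (rule strongly_decreasing_gain[OF assms(1) \<kappa> \<open>0 \<le> \<theta>\<close>]) (use * \<open>0 \<le> \<tau>\<close> in auto)
  also have "\<dots> = interaction (\<lambda>t. ennreal (\<kappa> t)) {a - \<tau><..<b - \<tau>} {c + \<tau><..<d + \<tau>}"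
    by (simp add: interaction_intervals l_l'_D_def field_simps)
  also have "\<dots> \<le> interaction (\<lambda>t. ennreal (\<kappa> t)) (csteiner_set \<tau> {a<..<b}) (csteiner_set \<tau> {c<..<d})"
  proof (intro interaction_mono move_interval_subset_csteiner_set)
    have "\<tau> = 0 \<or> 0 < b + a" "\<tau> = 0 \<or> d + c < 0"
      using assms by auto
    then show "(a - \<tau>, b - \<tau>) = move_interval \<tau> (a, b)" "(c + \<tau>, d + \<tau>) = move_interval \<tau> (c, d)"
      using assms by (auto simp: sgn_if field_simps)
  qed (use assms in auto)
  finally show ?thesis .
qed

text \<open>All components on one side of a gap around the origin move towards it at unit speed.\<close>

lemma shifted_subset_csteiner_set:
  assumes "open U" "0 \<le> \<tau>" "\<tau> \<le> \<epsilon>" "U \<inter> {- \<epsilon>..\<epsilon>} = {}"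
  shows "{t. (0 < t \<and> t + \<tau> \<in> U) \<or> (t < 0 \<and> t - \<tau> \<in> U)} \<subseteq> csteiner_set \<tau> U"
proof
  fix t assume "t \<in> {t. (0 < t \<and> t + \<tau> \<in> U) \<or> (t < 0 \<and> t - \<tau> \<in> U)}"
  then consider "0 < t" "t + \<tau> \<in> U" | "t < 0" "t - \<tau> \<in> U" by blast
  then show "t \<in> csteiner_set \<tau> U"
  proof cases
    case 1
    then obtain r where r: "0 < r" "ball (t + \<tau>) r \<subseteq> U"
      using assms(1) open_contains_ball_eq by metis
    \<comment> \<open>Only a small interval around \<open>t + \<tau>\<close> is tracked, not its
      component: its midpoint exceeds \<open>\<tau>\<close>, so it moves by exactly
      \<open>\<tau>\<close>.\<close>
    have "{t - r<..<t + r} \<subseteq> csteiner_set \<tau> U"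
      using r 1 assms(1,2) by (intro move_interval_subset_csteiner_set[of \<tau> U "t + \<tau> - r" "t + \<tau> + r"])
        (auto simp: ball_eq_greaterThanLessThan)
    then show ?thesis using r by auto
  next
    case 2
    then obtain r where r: "0 < r" "ball (t - \<tau>) r \<subseteq> U"
      using assms(1) open_contains_ball_eq by metis
    have "{t - r<..<t + r} \<subseteq> csteiner_set \<tau> U"
      using r 2 assms(1,2) by (intro move_interval_subset_csteiner_set[of \<tau> U "t - \<tau> - r" "t - \<tau> + r"])
        (auto simp: ball_eq_greaterThanLessThan)
    then show ?thesis using r by auto
  qed
qed

text \<open>Change of variables for the map pushing both half-lines inwards by
  \<open>\<tau>\<close>. Because of the gap the image splits into a left translate on the positive
  side and a right translate on the negative side.\<close>

lemma nn_integral_shifted: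
  fixes U :: "real set"
  assumes [measurable]: "F \<in> borel_measurable borel" "U \<in> sets borel"
    and U: "U \<inter> {- \<tau>..\<tau>} = {}" "0 \<le> \<tau>"
  shows "(\<integral>\<^sup>+t. F t * indicator {t. (0 < t \<and> t + \<tau> \<in> U) \<or> (t < 0 \<and> t - \<tau> \<in> U)} t \<partial>lborel) =
    (\<integral>\<^sup>+t. F (t - \<tau> * sgn t) * indicator U t \<partial>lborel)"
proof -
  have *: "x < - \<tau> \<or> \<tau> < x" if "x \<in> U" for x
  proof (rule ccontr)
    assume "\<not> ?thesis"
    then have "x \<in> U \<inter> {- \<tau>..\<tau>}" using that by (simp add: not_less)
    with U(1) show False by simp
  qed
  have "indicator {t. (0 < t \<and> t + \<tau> \<in> U) \<or> (t < 0 \<and> t - \<tau> \<in> U)} t =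
      (indicator (U \<inter> {0<..}) (t + \<tau>) + indicator (U \<inter> {..<0}) (t - \<tau>) :: ennreal)" for t
    using *[of "t + \<tau>"] *[of "t - \<tau>"] U(2) by (cases "t + \<tau> \<in> U"; cases "t - \<tau> \<in> U") (auto simp: indicator_def)
  then have "(\<integral>\<^sup>+t. F t * indicator {t. (0 < t \<and> t + \<tau> \<in> U) \<or> (t < 0 \<and> t - \<tau> \<in> U)} t \<partial>lborel) =
      (\<integral>\<^sup>+t. F t * indicator (U \<inter> {0<..}) (t + \<tau>) + F t * indicator (U \<inter> {..<0}) (t - \<tau>) \<partial>lborel)"
    by (simp add: distrib_left)
  also have "\<dots> = (\<integral>\<^sup>+t. F t * indicator (U \<inter> {0<..}) (t + \<tau>) \<partial>lborel) +
      (\<integral>\<^sup>+t. F t * indicator (U \<inter> {..<0}) (t - \<tau>) \<partial>lborel)"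
    by (rule nn_integral_add) auto
  also have "(\<integral>\<^sup>+t. F t * indicator (U \<inter> {0<..}) (t + \<tau>) \<partial>lborel) =
      (\<integral>\<^sup>+t. F (t - \<tau>) * indicator (U \<inter> {0<..}) t \<partial>lborel)"
    by (subst nn_integral_translate[symmetric, where a = "- \<tau>"]) auto
  also have "(\<integral>\<^sup>+t. F t * indicator (U \<inter> {..<0}) (t - \<tau>) \<partial>lborel) =
      (\<integral>\<^sup>+t. F (t + \<tau>) * indicator (U \<inter> {..<0}) t \<partial>lborel)"
    by (subst nn_integral_translate[symmetric, where a = "\<tau>"]) auto
  also have "(\<integral>\<^sup>+t. F (t - \<tau>) * indicator (U \<inter> {0<..}) t \<partial>lborel) +
      (\<integral>\<^sup>+t. F (t + \<tau>) * indicator (U \<inter> {..<0}) t \<partial>lborel) =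
      (\<integral>\<^sup>+t. F (t - \<tau>) * indicator (U \<inter> {0<..}) t + F (t + \<tau>) * indicator (U \<inter> {..<0}) t \<partial>lborel)"
    by (rule nn_integral_add[symmetric]) auto
  also have "\<dots> = (\<integral>\<^sup>+t. F (t - \<tau> * sgn t) * indicator U t \<partial>lborel)"
  proof (intro nn_integral_cong)
    fix t
    show "F (t - \<tau>) * indicator (U \<inter> {0<..}) t + F (t + \<tau>) * indicator (U \<inter> {..<0}) t =
        F (t - \<tau> * sgn t) * indicator U t"
      using *[of t] U(2) by (cases "t \<in> U"; cases "0 < t") (auto simp: sgn_if)
  qed
  finally show ?thesis .
qed

text \<open>No decomposition into components is needed: pushing all points inwards by
  \<open>\<tau>\<close> brings every pair closer or keeps its distance. For \<open>t\<close> near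
  \<open>p\<close> and \<open>s\<close> near \<open>q\<close> the distance is at least
  \<open>2 * \<epsilon>\<close> and drops by \<open>2 * \<tau>\<close>, so its square drops by at
  least \<open>4 * \<tau> * \<epsilon>\<close>. Integration over a square of side
  \<open>2 * \<eta>\<close> gives the factor 16.\<close>

lemma gain_across_gap:
  assumes [measurable]: "\<kappa> \<in> borel_measurable borel" and \<kappa>: "strongly_decreasing \<theta> P \<kappa>"
    and "0 \<le> \<theta>" "0 \<le> \<tau>" "\<tau> \<le> \<epsilon>" and UV: "open U" "open V"
    and gap: "U \<inter> {- \<epsilon>..\<epsilon>} = {}" "V \<inter> {- \<epsilon>..\<epsilon>} = {}"
    and \<eta>: "0 \<le> \<eta>" "{p - \<eta><..<p + \<eta>} \<subseteq> U" "{q - \<eta><..<q + \<eta>} \<subseteq> V" "\<epsilon> \<le> p - \<eta>" "q + \<eta> \<le> - \<epsilon>"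
    and P: "p - q + 2 * \<eta> \<le> P"
  shows "interaction (\<lambda>t. ennreal (\<kappa> t)) U V + ennreal (16 * \<theta> * \<epsilon> * \<eta>\<^sup>2 * \<tau>) \<le>
    interaction (\<lambda>t. ennreal (\<kappa> t)) (csteiner_set \<tau> U) (csteiner_set \<tau> V)"
proof -
  define T where "T W = {t. (0 < t \<and> t + \<tau> \<in> W) \<or> (t < 0 \<and> t - \<tau> \<in> W)}" for W
  let ?k = "\<lambda>t. ennreal (\<kappa> t)"
  let ?I = "{p - \<eta><..<p + \<eta>}" and ?J = "{q - \<eta><..<q + \<eta>}"
  have [measurable]: "U \<in> sets borel" "V \<in> sets borel"
    using UV by (auto simp: borel_open)
  have \<kappa>': "\<And>t. 0 \<le> \<kappa> t" "\<And>s t. \<bar>s\<bar> \<le> \<bar>t\<bar> \<Longrightarrow> \<kappa> t \<le> \<kappa> s"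
    "\<And>s t. \<bar>s\<bar> \<le> \<bar>t\<bar> \<Longrightarrow> \<bar>t\<bar> \<le> P \<Longrightarrow> \<kappa> t + \<theta> * (t\<^sup>2 - s\<^sup>2) \<le> \<kappa> s"
    using \<kappa> by (auto simp: strongly_decreasing_def)
  have gap': "U \<inter> {- \<tau>..\<tau>} = {}" "V \<inter> {- \<tau>..\<tau>} = {}"
    using gap \<open>\<tau> \<le> \<epsilon>\<close> by fastforce+
  have "interaction ?k (T U) (T V) =
      (\<integral>\<^sup>+t. (\<integral>\<^sup>+s. ?k (t - \<tau> * sgn t - (s - \<tau> * sgn s)) * indicator V s \<partial>lborel) * indicator U t \<partial>lborel)"
    unfolding interaction_def T_def
    by (subst nn_integral_shifted[OF _ _ gap'(1) \<open>0 \<le> \<tau>\<close>], measurable, measurable)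
       (subst nn_integral_shifted[OF _ _ gap'(2) \<open>0 \<le> \<tau>\<close>], measurable, measurable)
  moreover have "interaction ?k U V + ennreal (16 * \<theta> * \<epsilon> * \<eta>\<^sup>2 * \<tau>) \<le> \<dots>"
  proof -
    define g where "g = 4 * \<theta> * \<epsilon> * \<tau>"
    have "0 \<le> g" using assms by (auto simp: g_def)
    have pt: "?k (t - s) + ennreal g * indicator ?J s * indicator ?I t \<le>
        ?k (t - \<tau> * sgn t - (s - \<tau> * sgn s))" if "t \<in> U" "s \<in> V" for t s
    proof -
      have ts: "\<not> (- \<epsilon> \<le> t \<and> t \<le> \<epsilon>)" "\<not> (- \<epsilon> \<le> s \<and> s \<le> \<epsilon>)"
        using that gap by auto
      have le: "\<bar>t - \<tau> * sgn t - (s - \<tau> * sgn s)\<bar> \<le> \<bar>t - s\<bar>"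
        using ts assms(4,5) by (auto simp: sgn_if)
      show ?thesis
      proof (cases "s \<in> ?J \<and> t \<in> ?I")
        case True
        then have *: "\<epsilon> \<le> t" "s \<le> - \<epsilon>" "0 \<le> t - s" "t - s \<le> P"
          using \<eta> P assms(4,5) by auto
        then have sg: "t - \<tau> * sgn t - (s - \<tau> * sgn s) = t - s - 2 * \<tau>"
          using ts assms(4,5) by (auto simp: sgn_if)
        have "4 * \<tau> * \<epsilon> \<le> 4 * \<tau> * (t - s - \<tau>)"
          using * assms(4,5) by (intro mult_left_mono) auto
        also have "\<dots> = (t - s)\<^sup>2 - (t - s - 2 * \<tau>)\<^sup>2"
          by (simp add: power2_eq_square algebra_simps)
        finally have "\<theta> * (4 * \<tau> * \<epsilon>) \<le> \<theta> * ((t - s)\<^sup>2 - (t - s - 2 * \<tau>)\<^sup>2)"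
          using \<open>0 \<le> \<theta>\<close> by (intro mult_left_mono)
        moreover have "\<kappa> (t - s) + \<theta> * ((t - s)\<^sup>2 - (t - s - 2 * \<tau>)\<^sup>2) \<le> \<kappa> (t - s - 2 * \<tau>)"
          using \<kappa>'(3) le * unfolding sg by simp
        ultimately have "\<kappa> (t - s) + g \<le> \<kappa> (t - s - 2 * \<tau>)"
          by (simp add: g_def algebra_simps)
        then show ?thesis
          using True \<kappa>'(1) \<open>0 \<le> g\<close> unfolding sg
          by (simp add: ennreal_plus[symmetric] ennreal_leI del: ennreal_plus)
      next
        case False
        then show ?thesis
          using \<kappa>'(2)[OF le] by (auto simp: ennreal_leI indicator_def)
      qed
    qed
    have "(\<integral>\<^sup>+t. (\<integral>\<^sup>+s. ennreal g * indicator ?J s * indicator ?I t \<partial>lborel) \<partial>lborel) =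
        (\<integral>\<^sup>+t. ennreal g * ennreal (2 * \<eta>) * indicator ?I t \<partial>lborel)"
      using \<eta>(1) by (simp add: nn_integral_multc nn_integral_cmult_indicator)
    also have "\<dots> = ennreal g * ennreal (2 * \<eta>) * ennreal (2 * \<eta>)"
      using \<eta>(1) by (subst nn_integral_cmult_indicator) auto
    also have "\<dots> = ennreal (g * (2 * \<eta>) * (2 * \<eta>))"
      using \<eta>(1) \<open>0 \<le> g\<close> by (intro ennreal_mult3[symmetric]) auto
    also have "g * (2 * \<eta>) * (2 * \<eta>) = 16 * \<theta> * \<epsilon> * \<eta>\<^sup>2 * \<tau>"
      by (simp add: g_def power2_eq_square algebra_simps)
    finally have "interaction ?k U V + ennreal (16 * \<theta> * \<epsilon> * \<eta>\<^sup>2 * \<tau>) =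
        interaction ?k U V + (\<integral>\<^sup>+t. (\<integral>\<^sup>+s. ennreal g * indicator ?J s * indicator ?I t \<partial>lborel) \<partial>lborel)"
      by simp
    also have "\<dots> = (\<integral>\<^sup>+t. (\<integral>\<^sup>+s. ?k (t - s) * indicator V s * indicator U t +
        ennreal g * indicator ?J s * indicator ?I t \<partial>lborel) \<partial>lborel)"
      unfolding interaction_def by (simp add: nn_integral_add nn_integral_multc)
    also have "\<dots> \<le> (\<integral>\<^sup>+t. (\<integral>\<^sup>+s. ?k (t - \<tau> * sgn t - (s - \<tau> * sgn s)) * indicator V s * indicator U t \<partial>lborel) \<partial>lborel)"
    proof (intro nn_integral_mono)
      fix t s :: real
      show "?k (t - s) * indicator V s * indicator U t + ennreal g * indicator ?J s * indicator ?I t \<le>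
        ?k (t - \<tau> * sgn t - (s - \<tau> * sgn s)) * indicator V s * indicator U t"
      proof (cases "t \<in> U \<and> s \<in> V")
        case True
        then show ?thesis using pt by simp
      next
        case False
        then have "\<not> (s \<in> ?J \<and> t \<in> ?I)" using \<eta> by blast
        then show ?thesis using False by (auto simp: indicator_def)
      qed
    qed
    also have "\<dots> = (\<integral>\<^sup>+t. (\<integral>\<^sup>+s. ?k (t - \<tau> * sgn t - (s - \<tau> * sgn s)) * indicator V s \<partial>lborel) * indicator U t \<partial>lborel)"
      by (simp add: nn_integral_multc)
    finally show ?thesis .
  qed
  moreover have "interaction ?k (T U) (T V) \<le> interaction ?k (csteiner_set \<tau> U) (csteiner_set \<tau> V)"
    unfolding T_def using UV gap assms(4,5)
    by (intro interaction_mono shifted_subset_csteiner_set) auto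
  ultimately show ?thesis by simp
qed

section \<open>Integration along parallel lines\<close>

text \<open>For a unit vector \<open>e\<close>, the orthogonal projection onto the hyperplane. Lines
  in direction \<open>e\<close> are indexed by points of the ambient space, so that no coordinates
  on the hyperplane have to be chosen.\<close>

definition foot :: "'a::euclidean_space \<Rightarrow> real \<Rightarrow> 'a \<Rightarrow> 'a" where
  "foot e c y = y - (e \<bullet> y - c) *\<^sub>R e"

lemma continuous_on_foot [continuous_intros]:
  "continuous_on A g \<Longrightarrow> continuous_on A (\<lambda>x. foot e c (g x))"
  unfolding foot_def by (intro continuous_intros)

lemma borel_measurable_foot [measurable]: "foot e c \<in> borel_measurable borel"
  by (intro borel_measurable_continuous_onI continuous_on_foot continuous_on_id)

lemma inner_foot: "norm e = 1 \<Longrightarrow> e \<bullet> foot e c y = c"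
  by (simp add: foot_def inner_diff_right dot_square_norm)

lemma norm_foot_line:
  assumes "norm e = 1"
  shows "norm (foot e c y1 + t *\<^sub>R e - (foot e c y2 + s *\<^sub>R e)) =
    sqrt ((dist (foot e c y1) (foot e c y2))\<^sup>2 + (t - s)\<^sup>2)"
proof -
  define u where "u = foot e c y1 - foot e c y2"
  have eu: "e \<bullet> u = 0"
    using inner_foot[OF assms] by (simp add: u_def inner_diff_right)
  have ee: "e \<bullet> e = 1"
    using assms by (simp add: dot_square_norm)
  have "foot e c y1 + t *\<^sub>R e - (foot e c y2 + s *\<^sub>R e) = u + (t - s) *\<^sub>R e"
    by (simp add: u_def algebra_simps)
  moreover have "(norm (u + (t - s) *\<^sub>R e))\<^sup>2 = (norm u)\<^sup>2 + (t - s)\<^sup>2"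
    unfolding power2_norm_eq_inner
    using eu ee by (simp add: inner_add_left inner_add_right inner_commute power2_eq_square)
  ultimately show ?thesis
    unfolding dist_norm u_def[symmetric] by (metis norm_ge_zero real_sqrt_unique)
qed

lemma nn_integral_translate_euclidean:
  fixes a :: "'a::euclidean_space"
  assumes [measurable]: "f \<in> borel_measurable borel"
  shows "(\<integral>\<^sup>+x. f (a + x) \<partial>lborel) = (\<integral>\<^sup>+x. f x \<partial>lborel)"
proof -
  have "(\<integral>\<^sup>+x. f x \<partial>lborel) = (\<integral>\<^sup>+x. f x \<partial>distr lborel borel ((+) a))"
    by (simp add: lborel_distr_plus)
  also have "\<dots> = (\<integral>\<^sup>+x. f (a + x) \<partial>lborel)"
    by (subst nn_integral_distr) auto
  finally show ?thesis by simp
qed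

text \<open>Fubini without coordinates: each point is met by the lines issuing from a slab of unit
  width, so averaging over the slab replaces a rotation of the axes.\<close>

lemma nn_integral_lines:
  fixes e :: "'a::euclidean_space"
  assumes [measurable]: "F \<in> borel_measurable borel" and e: "norm e = 1"
  shows "(\<integral>\<^sup>+x. F x \<partial>lborel) =
    (\<integral>\<^sup>+y. (\<integral>\<^sup>+t. F (foot e c y + t *\<^sub>R e) \<partial>lborel) * indicator {0..1} (e \<bullet> y) \<partial>lborel)"
proof -
  have ee: "e \<bullet> e = 1"
    using e by (simp add: dot_square_norm)
  \<comment> \<open>A point and its foot differ by a multiple of \<open>e\<close>, a shift along the
    line that the integral does not see.\<close>
  have "(\<integral>\<^sup>+t. F (foot e c y + t *\<^sub>R e) \<partial>lborel) = (\<integral>\<^sup>+t. F (y + t *\<^sub>R e) \<partial>lborel)" for y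
    using nn_integral_translate[of "\<lambda>t. F (foot e c y + t *\<^sub>R e)" "e \<bullet> y - c"]
    by (simp add: foot_def algebra_simps)
  then have "(\<integral>\<^sup>+y. (\<integral>\<^sup>+t. F (foot e c y + t *\<^sub>R e) \<partial>lborel) * indicator {0..1} (e \<bullet> y) \<partial>lborel) =
      (\<integral>\<^sup>+y. (\<integral>\<^sup>+t. F (y + t *\<^sub>R e) * indicator {0..1} (e \<bullet> y) \<partial>lborel) \<partial>lborel)"
    by (simp add: nn_integral_multc)
  also have "\<dots> = (\<integral>\<^sup>+t. (\<integral>\<^sup>+y. F (y + t *\<^sub>R e) * indicator {0..1} (e \<bullet> y) \<partial>lborel) \<partial>lborel)"
    by (rule lborel_pair.Fubini'[symmetric]) measurable
  also have "\<dots> = (\<integral>\<^sup>+t. (\<integral>\<^sup>+y. F y * indicator {0..1} (e \<bullet> y - t) \<partial>lborel) \<partial>lborel)"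
  proof (rule nn_integral_cong)
    fix t
    show "(\<integral>\<^sup>+y. F (y + t *\<^sub>R e) * indicator {0..1} (e \<bullet> y) \<partial>lborel) =
        (\<integral>\<^sup>+y. F y * indicator {0..1} (e \<bullet> y - t) \<partial>lborel)"
      using nn_integral_translate_euclidean[of "\<lambda>y. F y * indicator {0..1} (e \<bullet> y - t)" "t *\<^sub>R e"]
      by (simp add: inner_add_right ee add.commute)
  qed
  also have "\<dots> = (\<integral>\<^sup>+y. (\<integral>\<^sup>+t. F y * indicator {0..1} (e \<bullet> y - t) \<partial>lborel) \<partial>lborel)"
    by (rule lborel_pair.Fubini') measurable
  also have "\<dots> = (\<integral>\<^sup>+y. F y \<partial>lborel)"
  proof (rule nn_integral_cong)
    fix y
    have "(\<integral>\<^sup>+t. F y * indicator {0..1} (e \<bullet> y - t) \<partial>lborel) =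
        (\<integral>\<^sup>+t. F y * indicator {e \<bullet> y - 1..e \<bullet> y} t \<partial>lborel)"
      by (intro nn_integral_cong) (auto simp: indicator_def)
    then show "(\<integral>\<^sup>+t. F y * indicator {0..1} (e \<bullet> y - t) \<partial>lborel) = F y"
      by (simp add: nn_integral_cmult_indicator)
  qed
  finally show ?thesis by simp
qed

section \<open>Interactions in space as averages over pairs of parallel lines\<close>

definition pair_interaction :: "('a::euclidean_space \<Rightarrow> ennreal) \<Rightarrow> 'a set \<Rightarrow> 'a set \<Rightarrow> ennreal" where
  "pair_interaction K A B = (\<integral>\<^sup>+x. (\<integral>\<^sup>+y. K (x - y) * indicator B y \<partial>lborel) * indicator A x \<partial>lborel)"

text \<open>By Pythagoras, a radial kernel between two parallel lines at distance \<open>d\<close>,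
  as a function of the difference of the line parameters.\<close>

definition line_kernel :: "(real \<Rightarrow> real) \<Rightarrow> real \<Rightarrow> real \<Rightarrow> real" where
  "line_kernel \<kappa> d t = \<kappa> (sqrt (d\<^sup>2 + t\<^sup>2))"

definition line_section :: "'a::real_vector \<Rightarrow> 'a \<Rightarrow> 'a set \<Rightarrow> real set" where
  "line_section e z A = {t. z + t *\<^sub>R e \<in> A}"

abbreviation slice :: "('a::real_vector \<Rightarrow> real) \<Rightarrow> 'a \<Rightarrow> 'a \<Rightarrow> real \<Rightarrow> real set" where
  "slice f e z h \<equiv> line_section e z {x. f x > h}"

lemma borel_measurable_line_kernel [measurable]:
  assumes [measurable]: "\<kappa> \<in> borel_measurable borel"
  shows "line_kernel \<kappa> d \<in> borel_measurable borel"
  unfolding line_kernel_def[abs_def] by measurable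

lemma line_section_measurable [measurable]:
  fixes e z :: "'a::euclidean_space"
  assumes [measurable]: "A \<in> sets borel"
  shows "line_section e z A \<in> sets borel"
proof -
  have "line_section e z A = (\<lambda>t. z + t *\<^sub>R e) -` A \<inter> space borel"
    by (auto simp: line_section_def)
  also have "\<dots> \<in> sets borel"
    by measurable
  finally show ?thesis .
qed

definition line_interaction ::
  "(real \<Rightarrow> real) \<Rightarrow> 'a::euclidean_space \<Rightarrow> real \<Rightarrow> 'a set \<Rightarrow> 'a set \<Rightarrow> 'a \<Rightarrow> 'a \<Rightarrow> ennreal" where
  "line_interaction \<kappa> e c A B y1 y2 =
     interaction (\<lambda>t. ennreal (line_kernel \<kappa> (dist (foot e c y1) (foot e c y2)) t))
       (line_section e (foot e c y1) A) (line_section e (foot e c y2) B)"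

lemma line_interaction_eq:
  assumes e: "norm e = 1"
  shows "line_interaction \<kappa> e c A B y1 y2 =
    (\<integral>\<^sup>+t. (\<integral>\<^sup>+s. ennreal (\<kappa> (norm (foot e c y1 + t *\<^sub>R e - (foot e c y2 + s *\<^sub>R e)))) *
      indicator B (foot e c y2 + s *\<^sub>R e) \<partial>lborel) * indicator A (foot e c y1 + t *\<^sub>R e) \<partial>lborel)"
  unfolding line_interaction_def interaction_def line_kernel_def line_section_def norm_foot_line[OF e]
  by (simp add: indicator_def)

lemma line_interaction_measurable:
  fixes A B :: "'a::euclidean_space set"
  assumes e: "norm e = 1"
    and [measurable]: "\<kappa> \<in> borel_measurable borel" "A \<in> sets borel" "B \<in> sets borel"
  shows "(\<lambda>(y1, y2). line_interaction \<kappa> e c A B y1 y2) \<in> borel_measurable (borel \<Otimes>\<^sub>M borel)"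
  unfolding line_interaction_eq[OF e] split_beta by measurable

text \<open>The line formula in each variable, then an exchange of integrals that brings the two
  line parameters together.\<close>

lemma pair_interaction_lines:
  fixes A B :: "'a::euclidean_space set"
  assumes e: "norm e = 1"
    and [measurable]: "\<kappa> \<in> borel_measurable borel" "A \<in> sets borel" "B \<in> sets borel"
  shows "pair_interaction (\<lambda>z. ennreal (\<kappa> (norm z))) A B =
    (\<integral>\<^sup>+y1. (\<integral>\<^sup>+y2. line_interaction \<kappa> e c A B y1 y2 * indicator {0..1} (e \<bullet> y2) \<partial>lborel) *
       indicator {0..1} (e \<bullet> y1) \<partial>lborel)"
proof -
  let ?K = "\<lambda>z. ennreal (\<kappa> (norm z))"
  let ?p = "\<lambda>y t. foot e c y + t *\<^sub>R e"
  have "pair_interaction ?K A B =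
      (\<integral>\<^sup>+y1. (\<integral>\<^sup>+t. (\<integral>\<^sup>+y. ?K (?p y1 t - y) * indicator B y \<partial>lborel) * indicator A (?p y1 t) \<partial>lborel) *
        indicator {0..1} (e \<bullet> y1) \<partial>lborel)"
    unfolding pair_interaction_def
    by (subst nn_integral_lines[OF _ e, where c = c]) auto
  also have "\<dots> = (\<integral>\<^sup>+y1. (\<integral>\<^sup>+y2. line_interaction \<kappa> e c A B y1 y2 * indicator {0..1} (e \<bullet> y2) \<partial>lborel) *
       indicator {0..1} (e \<bullet> y1) \<partial>lborel)"
  proof (intro nn_integral_cong arg_cong2[of _ _ _ _ "(*)"] refl)
    fix y1
    have "(\<integral>\<^sup>+t. (\<integral>\<^sup>+y. ?K (?p y1 t - y) * indicator B y \<partial>lborel) * indicator A (?p y1 t) \<partial>lborel) =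
        (\<integral>\<^sup>+t. (\<integral>\<^sup>+y2. (\<integral>\<^sup>+s. ?K (?p y1 t - ?p y2 s) * indicator B (?p y2 s) \<partial>lborel) *
          indicator {0..1} (e \<bullet> y2) \<partial>lborel) * indicator A (?p y1 t) \<partial>lborel)"
      by (subst nn_integral_lines[OF _ e, where c = c]) auto
    also have "\<dots> = (\<integral>\<^sup>+t. (\<integral>\<^sup>+y2. (\<integral>\<^sup>+s. ?K (?p y1 t - ?p y2 s) * indicator B (?p y2 s) \<partial>lborel) *
          indicator {0..1} (e \<bullet> y2) * indicator A (?p y1 t) \<partial>lborel) \<partial>lborel)"
      by (intro nn_integral_cong nn_integral_multc[symmetric]) measurable
    also have "\<dots> = (\<integral>\<^sup>+y2. (\<integral>\<^sup>+t. (\<integral>\<^sup>+s. ?K (?p y1 t - ?p y2 s) * indicator B (?p y2 s) \<partial>lborel) *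
          indicator {0..1} (e \<bullet> y2) * indicator A (?p y1 t) \<partial>lborel) \<partial>lborel)"
      by (rule lborel_pair.Fubini') measurable
    also have "\<dots> = (\<integral>\<^sup>+y2. (\<integral>\<^sup>+t. (\<integral>\<^sup>+s. ?K (?p y1 t - ?p y2 s) * indicator B (?p y2 s) \<partial>lborel) *
          indicator A (?p y1 t) * indicator {0..1} (e \<bullet> y2) \<partial>lborel) \<partial>lborel)"
      by (simp only: mult.assoc mult.commute[of "indicator {0..1} _"])
    also have "\<dots> = (\<integral>\<^sup>+y2. line_interaction \<kappa> e c A B y1 y2 * indicator {0..1} (e \<bullet> y2) \<partial>lborel)"
      unfolding line_interaction_eq[OF e] by (intro nn_integral_cong nn_integral_multc) measurable
    finally show "(\<integral>\<^sup>+t. (\<integral>\<^sup>+y. ?K (?p y1 t - y) * indicator B y \<partial>lborel) * indicator A (?p y1 t) \<partial>lborel) =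
      (\<integral>\<^sup>+y2. line_interaction \<kappa> e c A B y1 y2 * indicator {0..1} (e \<bullet> y2) \<partial>lborel)" .
  qed
  finally show ?thesis .
qed

lemma emeasure_lines:
  fixes A :: "'a::euclidean_space set"
  assumes e: "norm e = 1" and [measurable]: "A \<in> sets borel"
  shows "emeasure lborel A =
    (\<integral>\<^sup>+y. emeasure lborel (line_section e (foot e c y) A) * indicator {0..1} (e \<bullet> y) \<partial>lborel)"
proof -
  have sec: "(\<integral>\<^sup>+t. indicator A (foot e c y + t *\<^sub>R e) \<partial>lborel) =
      emeasure lborel (line_section e (foot e c y) A)" for y
  proof -
    have "(\<integral>\<^sup>+t. indicator A (foot e c y + t *\<^sub>R e) \<partial>lborel) =
        (\<integral>\<^sup>+t. indicator (line_section e (foot e c y) A) t \<partial>lborel)"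
      by (intro nn_integral_cong) (simp add: line_section_def indicator_def)
    then show ?thesis by simp
  qed
  have "emeasure lborel A = (\<integral>\<^sup>+x. indicator A x \<partial>lborel)"
    by simp
  also have "\<dots> = (\<integral>\<^sup>+y. (\<integral>\<^sup>+t. indicator A (foot e c y + t *\<^sub>R e) \<partial>lborel) * indicator {0..1} (e \<bullet> y) \<partial>lborel)"
    by (rule nn_integral_lines[OF _ e]) simp
  finally show ?thesis
    by (simp add: sec)
qed

section \<open>Level sets of the symmetrized function\<close>

lemma open_superlevel:
  fixes f :: "'a::topological_space \<Rightarrow> real"
  shows "continuous_on UNIV f \<Longrightarrow> open {x. f x > h}"
  by (intro open_Collect_less continuous_intros)

lemma open_line_section:
  fixes e z :: "'a::euclidean_space"
  assumes "open A"
  shows "open (line_section e z A)"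
proof -
  have "line_section e z A = (\<lambda>t. z + t *\<^sub>R e) -` A"
    by (auto simp: line_section_def)
  then show ?thesis
    using assms by (auto intro!: open_vimage continuous_intros)
qed

text \<open>A bounded initial segment of the positive reals has length \<open>Sup S\<close>, whether
  or not it contains its endpoint. Boundedness matters: the Bochner integral of the indicator of a
  set of infinite measure is 0.\<close>

lemma lebesgue_integral_down_closed:
  fixes S :: "real set"
  assumes S: "S \<subseteq> {0<..}" "\<And>h h'. h' \<in> S \<Longrightarrow> 0 < h \<Longrightarrow> h < h' \<Longrightarrow> h \<in> S" "bdd_above S" and "0 \<le> a"
  shows "a < (LINT h|lborel. indicator S h) \<longleftrightarrow> (\<exists>h\<in>S. a < h)"
proof (cases "S = {}")
  case False
  define s where "s = Sup S"
  have sub: "{0<..<s} \<subseteq> S" "S \<subseteq> {0<..s}"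
  proof -
    show "{0<..<s} \<subseteq> S"
    proof
      fix h assume "h \<in> {0<..<s}"
      then obtain h' where "h' \<in> S" "h < h'"
        using less_cSup_iff[OF False S(3), of h] by (auto simp: s_def)
      then show "h \<in> S"
        using S(2)[of h' h] \<open>h \<in> {0<..<s}\<close> by simp
    qed
    show "S \<subseteq> {0<..s}"
      using S(1) cSup_upper[OF _ S(3)] by (auto simp: s_def)
  qed
  have "S = {0<..<s} \<or> S = {0<..s}"
  proof (cases "s \<in> S")
    case True
    have "{0<..s} \<subseteq> S"
    proof
      fix h assume "h \<in> {0<..s}"
      then show "h \<in> S" using True sub(1) by (cases "h = s") auto
    qed
    then show ?thesis using sub(2) by blast
  next
    case False
    have "S \<subseteq> {0<..<s}"
    proof
      fix h assume "h \<in> S"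
      then show "h \<in> {0<..<s}" using False sub(2) by (cases "h = s") auto
    qed
    then show ?thesis using sub(1) by blast
  qed
  moreover have "0 < s"
    using sub False by fastforce
  ultimately have "(LINT h|lborel. indicator S h) = s"
    by auto
  moreover have "a < s \<longleftrightarrow> (\<exists>h\<in>S. a < h)"
    unfolding s_def by (rule less_cSup_iff[OF False S(3)])
  ultimately show ?thesis by simp
qed (use assms(4) in simp)

context
  fixes f :: "real^'n \<Rightarrow> real" and e :: "real^'n" and c \<tau> :: real
  assumes cont: "continuous_on UNIV f" and e: "norm e = 1" and \<tau>: "0 \<le> \<tau>"
begin

lemma continuous_on_f: "continuous_on A g \<Longrightarrow> continuous_on A (\<lambda>x. f (g x))"
  using continuous_on_compose2[OF cont] by simp

text \<open>The levels whose symmetrized slice contains \<open>t\<close> form an initial segment by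
  monotonicity. It is bounded, since level sets travel at most \<open>\<tau>\<close> and
  \<open>f\<close> is bounded on \<open>{t - \<tau>..t + \<tau>}\<close>. Its length, the value of
  \<open>f^\<tau>\<close>, exceeds \<open>h\<close> exactly if it contains a level beyond
  \<open>h\<close>.\<close>

lemma csteiner_greater_iff:
  assumes z: "e \<bullet> z = c" and "0 \<le> h"
  shows "h < csteiner e c \<tau> f (z + t *\<^sub>R e) \<longleftrightarrow>
    (\<exists>h'>h. t \<in> csteiner_set \<tau> (slice f e z h'))"
proof -
  let ?U = "\<lambda>h. slice f e z h"
  have U: "open (?U h)" for h
    by (intro open_line_section open_superlevel cont)
  define S where "S = {h. 0 < h \<and> t \<in> csteiner_set \<tau> (?U h)}"
  have ee: "e \<bullet> e = 1"
    using e by (simp add: dot_square_norm)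
  have "csteiner e c \<tau> f (z + t *\<^sub>R e) = (LINT h|lborel. indicator S h)"
    unfolding csteiner_def set_lebesgue_integral_def S_def Let_def line_section_def
    by (simp add: inner_add_right z ee indicator_def cong: if_cong)
       (intro Bochner_Integration.integral_cong, auto)
  moreover have "h < (LINT h|lborel. indicator S h) \<longleftrightarrow> (\<exists>h'\<in>S. h < h')"
  proof (rule lebesgue_integral_down_closed)
    show "h \<in> S" if "h' \<in> S" "0 < h" "h < h'" for h h'
    proof -
      have "?U h' \<subseteq> ?U h"
        using that by (auto simp: line_section_def)
      then show ?thesis
        using csteiner_set_mono[OF \<tau> U U] that unfolding S_def by blast
    qed
    obtain M where M: "\<And>r. r \<in> {t - \<tau>..t + \<tau>} \<Longrightarrow> f (z + r *\<^sub>R e) \<le> M"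
    proof -
      have "compact ((\<lambda>r. f (z + r *\<^sub>R e)) ` {t - \<tau>..t + \<tau>})"
        by (intro compact_continuous_image continuous_on_f continuous_intros) auto
      then show ?thesis
        using that by (meson bdd_above_def bounded_imp_bdd_above compact_imp_bounded imageI)
    qed
    show "bdd_above S"
    proof (rule bdd_aboveI)
      fix h assume "h \<in> S"
      have "closed {r. f (z + r *\<^sub>R e) \<ge> h}"
        by (intro closed_Collect_le continuous_on_f continuous_intros)
      then have "\<exists>y\<in>{r. f (z + r *\<^sub>R e) \<ge> h}. \<bar>y - t\<bar> \<le> \<tau>"
        using \<open>h \<in> S\<close> by (intro csteiner_set_within_distance[OF \<tau> U]) (auto simp: S_def line_section_def)
      then obtain y where "h \<le> f (z + y *\<^sub>R e)" "\<bar>y - t\<bar> \<le> \<tau>" by auto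
      then show "h \<le> M"
        using M[of y] by (auto simp: abs_le_iff)
    qed
  qed (use \<open>0 \<le> h\<close> in \<open>auto simp: S_def\<close>)
  moreover have "(\<exists>h'\<in>S. h < h') \<longleftrightarrow> (\<exists>h'>h. t \<in> csteiner_set \<tau> (?U h'))"
    unfolding S_def using le_less_trans[OF \<open>0 \<le> h\<close>] by blast
  ultimately show ?thesis by simp
qed

lemma csteiner_nonneg: "0 \<le> csteiner e c \<tau> f x"
  unfolding csteiner_def Let_def set_lebesgue_integral_def
  by (intro integral_nonneg_AE) (auto simp: indicator_def)

text \<open>Lower semicontinuity of \<open>f^\<tau>\<close>, which yields measurability. A finite
  list witnessing that \<open>x\<close> lies in the set also fits into the slightly lower slices
  along neighbouring lines, and the evolved list is open.\<close>

lemma open_csteiner_superlevel: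
  assumes "0 \<le> a"
  shows "open {x. csteiner e c \<tau> f x > a}"
proof (subst open_subopen, intro ballI)
  fix x assume "x \<in> {x. csteiner e c \<tau> f x > a}"
  have x: "x = foot e c x + (e \<bullet> x - c) *\<^sub>R e" for x
    by (simp add: foot_def)
  obtain h where h: "a < h" "e \<bullet> x - c \<in> csteiner_set \<tau> (slice f e (foot e c x) h)"
    using \<open>x \<in> _\<close> x[of x] csteiner_greater_iff[OF inner_foot[OF e] assms, of x "e \<bullet> x - c"] by auto
  then obtain Is where Is: "ordered_intervals Is" "interval_union Is \<subseteq> slice f e (foot e c x) h"
    "e \<bullet> x - c \<in> interval_union (evolve \<tau> Is)"
    using csteiner_set_eq[OF \<tau> open_line_section[OF open_superlevel[OF cont]]] by auto
  define b where "b = (a + h) / 2"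
  have b: "a < b" "b < h"
    using h by (auto simp: b_def)
  define C where "C = closure (interval_union Is)"
  have "compact C"
    unfolding C_def compact_closure by (auto simp: interval_union_def)
  have "C \<subseteq> {r. h \<le> f (foot e c x + r *\<^sub>R e)}"
    unfolding C_def using Is(2)
    by (intro closure_minimal closed_Collect_le continuous_on_f continuous_intros) (auto simp: line_section_def)
  then have sub: "{x} \<times> C \<subseteq> {p. b < f (foot e c (fst p) + snd p *\<^sub>R e)}" (is "_ \<subseteq> ?W")
    using b by auto
  have "open ?W"
    by (intro open_Collect_less continuous_on_f continuous_intros)
  \<comment> \<open>On the compact set \<open>C\<close> the values of \<open>f\<close> along the
    line through \<open>x\<close> are at least \<open>h\<close>, hence above \<open>b\<close>; the
    tube lemma extends this to all lines through a neighbourhood of \<open>x\<close>.\<close>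
  then obtain X0 where X0: "x \<in> X0" "open X0" "X0 \<times> C \<subseteq> ?W"
    using Elementary_Topology.tube_lemma[OF \<open>compact C\<close> _ sub] by auto
  define T where "T = X0 \<inter> {y. e \<bullet> y - c \<in> interval_union (evolve \<tau> Is)}"
  have "open {y. e \<bullet> y - c \<in> interval_union (evolve \<tau> Is)}"
    using open_vimage[OF open_interval_union[of "evolve \<tau> Is"], of "\<lambda>y. e \<bullet> y - c"]
    by (simp add: vimage_def continuous_intros)
  then have "open T" "x \<in> T"
    using X0 Is by (auto simp: T_def)
  moreover have "T \<subseteq> {x. csteiner e c \<tau> f x > a}"
  proof
    fix y assume y: "y \<in> T"
    have "interval_union Is \<subseteq> slice f e (foot e c y) b"
    proof
      fix r assume "r \<in> interval_union Is"
      then have "(y, r) \<in> X0 \<times> C"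
        using y closure_subset[of "interval_union Is"] by (auto simp: T_def C_def)
      then have "(y, r) \<in> ?W"
        using X0(3) by blast
      then show "r \<in> slice f e (foot e c y) b"
        by (simp add: line_section_def)
    qed
    then have "e \<bullet> y - c \<in> csteiner_set \<tau> (slice f e (foot e c y) b)"
      using csteiner_set_eq[OF \<tau> open_line_section[OF open_superlevel[OF cont]]] y Is(1) by (auto simp: T_def)
    then have "a < csteiner e c \<tau> f (foot e c y + (e \<bullet> y - c) *\<^sub>R e)"
      using csteiner_greater_iff[OF inner_foot[OF e] assms] b(1) by blast
    then show "y \<in> {x. csteiner e c \<tau> f x > a}"
      using x[of y] by simp
  qed
  ultimately show "\<exists>T. open T \<and> x \<in> T \<and> T \<subseteq> {x. csteiner e c \<tau> f x > a}" by blast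
qed

lemma borel_measurable_csteiner: "csteiner e c \<tau> f \<in> borel_measurable borel"
proof (rule borel_measurableI_greater)
  fix a :: real
  show "{x \<in> space borel. a < csteiner e c \<tau> f x} \<in> sets borel"
  proof (cases "0 \<le> a")
    case True
    then show ?thesis
      using borel_open[OF open_csteiner_superlevel] by simp
  next
    case False
    then have "{x \<in> space borel. a < csteiner e c \<tau> f x} = UNIV"
      using csteiner_nonneg by (auto intro: less_le_trans[of a 0])
    then show ?thesis by simp
  qed
qed

text \<open>Countably many higher levels suffice. This presents slices of \<open>f\<close> and of
  \<open>f^\<tau>\<close> as increasing unions over the same levels, ready for monotone
  limits.\<close>

lemma section_csteiner:
  assumes z: "e \<bullet> z = c" and "0 \<le> h"
  shows "slice (csteiner e c \<tau> f) e z h =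
    (\<Union>m. csteiner_set \<tau> (slice f e z (h + 1 / real (Suc m))))"
    and "incseq (\<lambda>m. csteiner_set \<tau> (slice f e z (h + 1 / real (Suc m))))"
    and "slice f e z h = (\<Union>m. slice f e z (h + 1 / real (Suc m)))"
    and "incseq (\<lambda>m. slice f e z (h + 1 / real (Suc m)))"
proof -
  let ?U = "\<lambda>h. slice f e z h"
  have U: "open (?U h)" for h
    by (intro open_line_section open_superlevel cont)
  have mono: "?U h' \<subseteq> ?U h" if "h \<le> h'" for h h'
    using that by (auto simp: line_section_def)
  have arch: "\<exists>m. h + 1 / real (Suc m) < h'" if "h < h'" for h'
    using reals_Archimedean[of "h' - h"] that by (auto simp: inverse_eq_divide algebra_simps)
  show "slice (csteiner e c \<tau> f) e z h = (\<Union>m. csteiner_set \<tau> (?U (h + 1 / real (Suc m))))"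
  proof (intro equalityI subsetI)
    fix t assume "t \<in> slice (csteiner e c \<tau> f) e z h"
    then obtain h' where h': "h < h'" "t \<in> csteiner_set \<tau> (?U h')"
      using csteiner_greater_iff[OF z \<open>0 \<le> h\<close>] by (auto simp: line_section_def)
    moreover obtain m where "h + 1 / real (Suc m) < h'"
      using arch h' by blast
    ultimately show "t \<in> (\<Union>m. csteiner_set \<tau> (?U (h + 1 / real (Suc m))))"
      using csteiner_set_mono[OF \<tau> U U mono, of "h + 1 / real (Suc m)" h'] by auto
  next
    fix t assume "t \<in> (\<Union>m. csteiner_set \<tau> (?U (h + 1 / real (Suc m))))"
    then obtain m where "t \<in> csteiner_set \<tau> (?U (h + 1 / real (Suc m)))" by blast
    then have "\<exists>h'>h. t \<in> csteiner_set \<tau> (?U h')"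
      by (intro exI[of _ "h + 1 / real (Suc m)"]) auto
    then show "t \<in> slice (csteiner e c \<tau> f) e z h"
      using csteiner_greater_iff[OF z \<open>0 \<le> h\<close>] by (auto simp: line_section_def)
  qed
  have dec: "h + 1 / real (Suc n) \<le> h + 1 / real (Suc m)" if "m \<le> n" for m n
    using that by (auto intro!: divide_left_mono)
  show "incseq (\<lambda>m. csteiner_set \<tau> (?U (h + 1 / real (Suc m))))"
    by (intro incseq_def[THEN iffD2] allI impI csteiner_set_mono \<tau> U mono dec)
  show "incseq (\<lambda>m. ?U (h + 1 / real (Suc m)))"
    by (intro incseq_def[THEN iffD2] allI impI mono dec)
  show "?U h = (\<Union>m. ?U (h + 1 / real (Suc m)))"
  proof (intro equalityI subsetI)
    fix t assume "t \<in> ?U h"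
    then obtain m where "h + 1 / real (Suc m) < f (z + t *\<^sub>R e)"
      using arch[of "f (z + t *\<^sub>R e)"] by (auto simp: line_section_def)
    then show "t \<in> (\<Union>m. ?U (h + 1 / real (Suc m)))"
      by (auto simp: line_section_def)
  next
    fix t assume "t \<in> (\<Union>m. ?U (h + 1 / real (Suc m)))"
    then obtain m where "t \<in> ?U (h + 1 / real (Suc m))" by blast
    then show "t \<in> ?U h"
      using mono[of h "h + 1 / real (Suc m)"] by auto
  qed
qed

lemma emeasure_section_csteiner:
  assumes z: "e \<bullet> z = c" and "0 \<le> h"
  shows "emeasure lborel (slice (csteiner e c \<tau> f) e z h) =
    emeasure lborel (slice f e z h)"
proof -
  let ?U = "\<lambda>m. slice f e z (h + 1 / real (Suc m))"
  have U: "open (?U m)" for m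
    by (intro open_line_section open_superlevel cont)
  note S = section_csteiner[OF assms]
  have "emeasure lborel (slice (csteiner e c \<tau> f) e z h) =
      (SUP m. emeasure lborel (csteiner_set \<tau> (?U m)))"
    unfolding S(1) using S(2) open_csteiner_set[OF \<tau> U]
    by (intro SUP_emeasure_incseq[symmetric]) (auto simp: borel_open)
  also have "\<dots> = (SUP m. emeasure lborel (?U m))"
    using emeasure_csteiner_set[OF \<tau> U] by simp
  also have "\<dots> = emeasure lborel (slice f e z h)"
    unfolding S(3) using S(4) U by (intro SUP_emeasure_incseq) (auto simp: borel_open)
  finally show ?thesis .
qed

text \<open>The gain is asked for only eventually because it will hold on open ranges of levels,
  which \<open>h + 1 / real (Suc m)\<close> may leave for small \<open>m\<close>.\<close>

lemma interaction_section_csteiner: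
  assumes z: "e \<bullet> z1 = c" "e \<bullet> z2 = c" and hk: "0 \<le> h" "0 \<le> k"
    and [measurable]: "\<kappa> \<in> borel_measurable borel"
    and gain: "\<forall>\<^sub>F m in sequentially.
      interaction \<kappa> (slice f e z1 (k + 1 / real (Suc m))) (slice f e z2 (h + 1 / real (Suc m))) + g \<le>
      interaction \<kappa> (csteiner_set \<tau> (slice f e z1 (k + 1 / real (Suc m))))
        (csteiner_set \<tau> (slice f e z2 (h + 1 / real (Suc m))))"
  shows "interaction \<kappa> (slice f e z1 k) (slice f e z2 h) + g \<le>
    interaction \<kappa> (slice (csteiner e c \<tau> f) e z1 k) (slice (csteiner e c \<tau> f) e z2 h)"
proof -
  note S1 = section_csteiner[OF z(1) hk(2)] and S2 = section_csteiner[OF z(2) hk(1)]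
  let ?U = "\<lambda>m. slice f e z1 (k + 1 / real (Suc m))"
  let ?V = "\<lambda>m. slice f e z2 (h + 1 / real (Suc m))"
  have [measurable]: "?U m \<in> sets borel" "?V m \<in> sets borel" for m
    by (intro borel_open open_line_section open_superlevel cont)+
  have "interaction \<kappa> (slice f e z1 k) (slice f e z2 h) =
      (SUP m. interaction \<kappa> (?U m) (?V m))"
    unfolding S1(3) S2(3) by (intro interaction_incseq S1(4) S2(4)) measurable
  moreover have "incseq (\<lambda>m. interaction \<kappa> (?U m) (?V m))"
    by (intro incseq_def[THEN iffD2] allI impI interaction_mono incseqD[OF S1(4)] incseqD[OF S2(4)])
  ultimately have "(\<lambda>m. interaction \<kappa> (?U m) (?V m)) \<longlonglongrightarrow>
      interaction \<kappa> (slice f e z1 k) (slice f e z2 h)"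
    using LIMSEQ_SUP[of "\<lambda>m. interaction \<kappa> (?U m) (?V m)"] by (simp only:)
  then have lim: "(\<lambda>m. interaction \<kappa> (?U m) (?V m) + g) \<longlonglongrightarrow>
      interaction \<kappa> (slice f e z1 k) (slice f e z2 h) + g"
    by (intro tendsto_intros)
  have "\<forall>\<^sub>F m in sequentially. interaction \<kappa> (?U m) (?V m) + g \<le>
      interaction \<kappa> (slice (csteiner e c \<tau> f) e z1 k) (slice (csteiner e c \<tau> f) e z2 h)"
    using gain
  proof eventually_elim
    case (elim m)
    also have "interaction \<kappa> (csteiner_set \<tau> (?U m)) (csteiner_set \<tau> (?V m)) \<le>
      interaction \<kappa> (slice (csteiner e c \<tau> f) e z1 k) (slice (csteiner e c \<tau> f) e z2 h)"
      unfolding S1(1) S2(1) by (intro interaction_mono) auto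
    finally show ?case .
  qed
  then show ?thesis
    by (rule tendsto_upperbound[OF lim]) (rule sequentially_bot)
qed

end

section \<open>Layer-cake representation of the energy\<close>

text \<open>With \<open>h = fst q\<close> and \<open>k = snd q\<close>, this is minus the mixed
  second derivative of \<open>(k - h) powr p\<close>. Only positive levels are charged, where
  superlevel sets of an integrable function have finite measure.\<close>

definition layer_weight :: "real \<Rightarrow> real \<times> real \<Rightarrow> real" where
  "layer_weight p q = (if 0 < fst q \<and> fst q < snd q then p * (p - 1) * (snd q - fst q) powr (p - 2) else 0)"

lemma layer_weight_measurable [measurable]: "layer_weight p \<in> borel_measurable borel"
  unfolding layer_weight_def[abs_def] borel_prod[symmetric] by measurable

lemma nn_integral_powr:
  fixes r c :: real
  assumes "- 1 < r" "0 \<le> c"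
  shows "(\<integral>\<^sup>+x. ennreal (x powr r) * indicator {0<..<c} x \<partial>lborel) = ennreal (c powr (r + 1) / (r + 1))"
    and "(\<integral>\<^sup>+x. ennreal (x powr r) * indicator {0<..c} x \<partial>lborel) = ennreal (c powr (r + 1) / (r + 1))"
proof -
  have 1: "(\<integral>\<^sup>+x. ennreal (x powr r) * indicator {0..c} x \<partial>lborel) = ennreal (c powr (r + 1) / (r + 1))"
    by (rule nn_integral_has_integral_lebesgue'[OF _ has_integral_powr_from_0[OF assms]]) simp
  show "(\<integral>\<^sup>+x. ennreal (x powr r) * indicator {0<..<c} x \<partial>lborel) = ennreal (c powr (r + 1) / (r + 1))"
    unfolding 1[symmetric] using AE_lborel_singleton[of c]
    by (intro nn_integral_cong_AE) (auto simp: indicator_def elim!: eventually_mono)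
  show "(\<integral>\<^sup>+x. ennreal (x powr r) * indicator {0<..c} x \<partial>lborel) = ennreal (c powr (r + 1) / (r + 1))"
    unfolding 1[symmetric] by (intro nn_integral_cong) (auto simp: indicator_def)
qed

text \<open>Integrate the weight over \<open>b \<le> h < k < a\<close>: first in \<open>k\<close>,
  which gives \<open>p * (a - h) powr (p - 1)\<close>, then in \<open>h\<close>. For
  \<open>p < 2\<close> the weight is singular at \<open>h = k\<close>, but integrable since
  \<open>p > 1\<close>.\<close>

lemma layer_cake_ordered:
  fixes a b p :: real
  assumes p: "1 < p" and ab: "0 \<le> b" "b \<le> a"
  shows "ennreal ((a - b) powr p) =
    (\<integral>\<^sup>+q. ennreal (layer_weight p q) * (indicator {..<a} (snd q) * indicator {b..} (fst q)) \<partial>lborel)"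
proof -
  \<comment> \<open>\<open>h = 0\<close> is excluded since the weight vanishes there while the
    right-hand side need not if \<open>b = 0\<close>; it is a null set.\<close>
  have inner: "(\<integral>\<^sup>+k. ennreal (layer_weight p (h, k)) * (indicator {..<a} k * indicator {b..} h) \<partial>lborel) =
      ennreal p * (ennreal ((a - h) powr (p - 1)) * indicator {0<..a - b} (a - h))" if "h \<noteq> 0" for h
  proof (cases "0 < h \<and> b \<le> h \<and> h \<le> a")
    case True
    have "(\<integral>\<^sup>+k. ennreal (layer_weight p (h, k)) * (indicator {..<a} k * indicator {b..} h) \<partial>lborel) =
        (\<integral>\<^sup>+x. ennreal (layer_weight p (h, x + h)) * (indicator {..<a} (x + h) * indicator {b..} h) \<partial>lborel)"
      by (subst nn_integral_translate[symmetric, where a = h]) (auto simp: borel_prod[symmetric] layer_weight_def)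
    also have "\<dots> = (\<integral>\<^sup>+x. ennreal (p * (p - 1)) * (ennreal (x powr (p - 2)) * indicator {0<..<a - h} x) \<partial>lborel)"
      using True p by (intro nn_integral_cong) (auto simp: layer_weight_def indicator_def ennreal_mult[symmetric])
    also have "\<dots> = ennreal (p * (p - 1)) * ennreal ((a - h) powr (p - 1) / (p - 1))"
      using True p by (simp add: nn_integral_cmult nn_integral_powr(1)[of "p - 2"])
    also have "\<dots> = ennreal p * ennreal ((a - h) powr (p - 1))"
      using p by (simp add: ennreal_mult[symmetric])
    also have "\<dots> = ennreal p * (ennreal ((a - h) powr (p - 1)) * indicator {0<..a - b} (a - h))"
      using True p by (auto simp: indicator_def)
    finally show ?thesis .
  next
    case False
    then have "ennreal (layer_weight p (h, k)) * (indicator {..<a} k * indicator {b..} h) = 0" for k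
      by (auto simp: layer_weight_def indicator_def)
    then have "(\<integral>\<^sup>+k. ennreal (layer_weight p (h, k)) * (indicator {..<a} k * indicator {b..} h) \<partial>lborel) = 0"
      by (simp only:) simp
    moreover have "indicator {0<..a - b} (a - h) = (0 :: ennreal)"
      using False that ab by (auto simp: indicator_def)
    ultimately show ?thesis by simp
  qed
  have "(\<integral>\<^sup>+q. ennreal (layer_weight p q) * (indicator {..<a} (snd q) * indicator {b..} (fst q)) \<partial>lborel) =
      (\<integral>\<^sup>+h. (\<integral>\<^sup>+k. ennreal (layer_weight p (h, k)) * (indicator {..<a} k * indicator {b..} h) \<partial>lborel) \<partial>lborel)"
    unfolding lborel_prod[symmetric]
    by (subst lborel.nn_integral_fst[symmetric]) (auto simp: borel_prod[symmetric] layer_weight_def)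
  also have "\<dots> = (\<integral>\<^sup>+h. ennreal p * (ennreal ((a - h) powr (p - 1)) * indicator {0<..a - b} (a - h)) \<partial>lborel)"
    using AE_lborel_singleton[of 0] by (intro nn_integral_cong_AE) (auto elim!: eventually_mono simp: inner)
  also have "\<dots> = ennreal p * (\<integral>\<^sup>+h. ennreal ((a - h) powr (p - 1)) * indicator {0<..a - b} (a - h) \<partial>lborel)"
    by (rule nn_integral_cmult) measurable
  also have "(\<integral>\<^sup>+h. ennreal ((a - h) powr (p - 1)) * indicator {0<..a - b} (a - h) \<partial>lborel) =
      (\<integral>\<^sup>+x. ennreal (x powr (p - 1)) * indicator {0<..a - b} x \<partial>lborel)"
    using nn_integral_real_affine[of "\<lambda>x. ennreal (x powr (p - 1)) * indicator {0<..a - b} x" "-1" a] by simp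
  also have "\<dots> = ennreal ((a - b) powr p / p)"
    using p ab by (simp add: nn_integral_powr(2))
  also have "ennreal p * \<dots> = ennreal ((a - b) powr p)"
    using p by (simp add: ennreal_mult[symmetric])
  finally show ?thesis by simp
qed

lemma layer_cake:
  fixes a b p :: real
  assumes p: "1 < p" and ab: "0 \<le> a" "0 \<le> b"
  shows "ennreal (\<bar>a - b\<bar> powr p) =
    (\<integral>\<^sup>+q. ennreal (layer_weight p q) * (indicator {..<a} (snd q) * indicator {b..} (fst q) +
      indicator {..<b} (snd q) * indicator {a..} (fst q)) \<partial>lborel)"
proof -
  have *: "ennreal (layer_weight p q) * (indicator {..<a} (snd q) * indicator {b..} (fst q)) =
      ennreal (layer_weight p q) * (indicator {..<a} (snd q) * indicator {b..} (fst q) +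
      indicator {..<b} (snd q) * indicator {a..} (fst q))" if "b \<le> a" for a b q
    using that by (auto simp: layer_weight_def indicator_def)
  show ?thesis
  proof (cases "b \<le> a")
    case True
    then show ?thesis
      using layer_cake_ordered[OF p ab(2) True] by (simp only: *[OF True] abs_of_nonneg diff_ge_0_iff_ge)
  next
    case False
    then have "a \<le> b" by simp
    then show ?thesis
      using layer_cake_ordered[OF p ab(1) \<open>a \<le> b\<close>]
      by (simp only: *[OF \<open>a \<le> b\<close>] abs_minus_commute[of a b] abs_of_nonneg diff_ge_0_iff_ge add.commute)
  qed
qed

definition kernel_energy :: "real \<Rightarrow> (real \<Rightarrow> real) \<Rightarrow> ('a::euclidean_space \<Rightarrow> real) \<Rightarrow> ennreal" where
  "kernel_energy p \<kappa> F =
     (\<integral>\<^sup>+y. (\<integral>\<^sup>+x. ennreal (\<bar>F x - F y\<bar> powr p) * ennreal (\<kappa> (norm (x - y))) \<partial>lborel) \<partial>lborel)"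

lemma nn_integral_norm_translate:
  fixes y :: "'a::euclidean_space"
  assumes [measurable]: "\<kappa> \<in> borel_measurable borel"
  shows "(\<integral>\<^sup>+x. ennreal (\<kappa> (norm (y - x))) \<partial>lborel) = (\<integral>\<^sup>+x. ennreal (\<kappa> (norm (x::'a))) \<partial>lborel)"
proof -
  have "(\<integral>\<^sup>+x. ennreal (\<kappa> (norm (y - x))) \<partial>lborel) = (\<integral>\<^sup>+x. ennreal (\<kappa> (norm (y - (y + x)))) \<partial>lborel)"
    by (rule nn_integral_translate_euclidean[symmetric]) measurable
  then show ?thesis by simp
qed

text \<open>The "constant minus interaction" of the energy, stated as a sum because the terms may be
  infinite.\<close>

lemma pair_interaction_split:
  fixes A B :: "'a::euclidean_space set"
  assumes [measurable]: "\<kappa> \<in> borel_measurable borel" "A \<in> sets borel" "B \<in> sets borel"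
  shows "pair_interaction (\<lambda>z. ennreal (\<kappa> (norm z))) A (- B) +
    pair_interaction (\<lambda>z. ennreal (\<kappa> (norm z))) A B =
    emeasure lborel A * (\<integral>\<^sup>+x. ennreal (\<kappa> (norm (x::'a))) \<partial>lborel)"
proof -
  let ?k = "\<lambda>z::'a. ennreal (\<kappa> (norm z))"
  have ind: "indicator (- B) y + indicator B y = (1 :: ennreal)" for y
    by (auto simp: indicator_def)
  have "(\<integral>\<^sup>+y. ?k (x - y) * (indicator (- B) y + indicator B y) \<partial>lborel) =
      (\<integral>\<^sup>+y. ?k (x - y) * indicator (- B) y \<partial>lborel) + (\<integral>\<^sup>+y. ?k (x - y) * indicator B y \<partial>lborel)" for x
    by (simp add: distrib_left nn_integral_add)
  then have "pair_interaction ?k A (- B) + pair_interaction ?k A B =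
      (\<integral>\<^sup>+x. (\<integral>\<^sup>+y. ?k (x - y) * (indicator (- B) y + indicator B y) \<partial>lborel) * indicator A x \<partial>lborel)"
    unfolding pair_interaction_def by (simp add: distrib_right nn_integral_add)
  also have "\<dots> = (\<integral>\<^sup>+x. (\<integral>\<^sup>+z. ?k z \<partial>lborel) * indicator A x \<partial>lborel)"
    by (simp add: ind nn_integral_norm_translate)
  also have "\<dots> = emeasure lborel A * (\<integral>\<^sup>+z. ?k z \<partial>lborel)"
    by (subst nn_integral_cmult_indicator) (auto simp: mult.commute)
  finally show ?thesis .
qed

text \<open>The two terms of the layer-cake formula are exchanged by swapping \<open>x\<close> and
  \<open>y\<close>; as the kernel is even they contribute equally, hence the factor 2.\<close>

lemma kernel_energy_layers:
  fixes F :: "'a::euclidean_space \<Rightarrow> real"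
  assumes p: "1 < p" and [measurable]: "\<kappa> \<in> borel_measurable borel" "F \<in> borel_measurable borel"
    and F: "\<And>x. 0 \<le> F x"
  shows "kernel_energy p \<kappa> F = (\<integral>\<^sup>+q. ennreal (layer_weight p q) *
    (2 * pair_interaction (\<lambda>z. ennreal (\<kappa> (norm z))) {x. F x > snd q} (- {x. F x > fst q})) \<partial>lborel)"
proof -
  let ?k = "\<lambda>z::'a. ennreal (\<kappa> (norm z))"
  define G where "G q x y = indicator {..<F x} (snd q) * indicator {F y..} (fst q) * ?k (x - y)"
    for q :: "real \<times> real" and x y
  have [measurable]: "(\<lambda>(q, x, y). G q x y) \<in> borel_measurable (borel \<Otimes>\<^sub>M borel \<Otimes>\<^sub>M borel)"
  proof -
    have "G = (\<lambda>q x y. (if snd q < F x then 1 else 0) * (if F y \<le> fst q then 1 else 0) * ?k (x - y))"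
      by (auto simp: G_def fun_eq_iff indicator_def)
    then show ?thesis
      by (simp add: split_beta borel_prod[symmetric])
  qed
  note G_meas = this
  have [measurable]: "(\<lambda>x. G (g1 x) (g2 x) (g3 x)) \<in> borel_measurable M"
    if [measurable]: "g1 \<in> M \<rightarrow>\<^sub>M borel" "g2 \<in> M \<rightarrow>\<^sub>M borel" "g3 \<in> M \<rightarrow>\<^sub>M borel"
    for M :: "'c measure" and g1 g2 g3
    using measurable_compose[OF measurable_Pair[OF that(1) measurable_Pair[OF that(2,3)]] G_meas] by simp
  have G2: "(\<integral>\<^sup>+y. (\<integral>\<^sup>+x. G q x y \<partial>lborel) \<partial>lborel) = pair_interaction ?k {x. F x > snd q} (- {x. F x > fst q})" for q
  proof -
    have "(\<integral>\<^sup>+y. (\<integral>\<^sup>+x. G q x y \<partial>lborel) \<partial>lborel) = (\<integral>\<^sup>+x. (\<integral>\<^sup>+y. G q x y \<partial>lborel) \<partial>lborel)"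
      by (rule lborel_pair.Fubini') measurable
    also have "\<dots> = (\<integral>\<^sup>+x. (\<integral>\<^sup>+y. ?k (x - y) * indicator (- {x. F x > fst q}) y * indicator {x. F x > snd q} x \<partial>lborel) \<partial>lborel)"
      by (intro nn_integral_cong) (auto simp: G_def indicator_def)
    also have "\<dots> = pair_interaction ?k {x. F x > snd q} (- {x. F x > fst q})"
      unfolding pair_interaction_def by (simp add: nn_integral_multc)
    finally show ?thesis .
  qed
  have G3: "(\<integral>\<^sup>+y. (\<integral>\<^sup>+x. G q y x \<partial>lborel) \<partial>lborel) = pair_interaction ?k {x. F x > snd q} (- {x. F x > fst q})" for q
  proof -
    have "(\<integral>\<^sup>+y. (\<integral>\<^sup>+x. G q y x \<partial>lborel) \<partial>lborel) = (\<integral>\<^sup>+y. (\<integral>\<^sup>+x. G q x y \<partial>lborel) \<partial>lborel)"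
      by (rule lborel_pair.Fubini'[symmetric]) measurable
    then show ?thesis by (rule trans[OF _ G2])
  qed
  have "kernel_energy p \<kappa> F =
      (\<integral>\<^sup>+y. (\<integral>\<^sup>+x. (\<integral>\<^sup>+q. ennreal (layer_weight p q) * (G q x y + G q y x) \<partial>lborel) \<partial>lborel) \<partial>lborel)"
    unfolding kernel_energy_def
  proof (rule nn_integral_cong, rule nn_integral_cong)
    fix x y
    have "ennreal (\<bar>F x - F y\<bar> powr p) * ?k (x - y) =
        (\<integral>\<^sup>+q. ennreal (layer_weight p q) * (indicator {..<F x} (snd q) * indicator {F y..} (fst q) +
          indicator {..<F y} (snd q) * indicator {F x..} (fst q)) * ?k (x - y) \<partial>lborel)"
      unfolding layer_cake[OF p F F]
      by (rule nn_integral_multc[symmetric]) (auto simp: borel_prod[symmetric] layer_weight_def)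
    also have "\<dots> = (\<integral>\<^sup>+q. ennreal (layer_weight p q) * (G q x y + G q y x) \<partial>lborel)"
      by (intro nn_integral_cong) (simp add: G_def distrib_right norm_minus_commute[of x y] mult.assoc)
    finally show "ennreal (\<bar>F x - F y\<bar> powr p) * ?k (x - y) =
      (\<integral>\<^sup>+q. ennreal (layer_weight p q) * (G q x y + G q y x) \<partial>lborel)" .
  qed
  also have "\<dots> = (\<integral>\<^sup>+y. (\<integral>\<^sup>+q. (\<integral>\<^sup>+x. ennreal (layer_weight p q) * (G q x y + G q y x) \<partial>lborel) \<partial>lborel) \<partial>lborel)"
    by (rule nn_integral_cong, rule lborel_pair.Fubini') measurable
  also have "\<dots> = (\<integral>\<^sup>+q. (\<integral>\<^sup>+y. (\<integral>\<^sup>+x. ennreal (layer_weight p q) * (G q x y + G q y x) \<partial>lborel) \<partial>lborel) \<partial>lborel)"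
    by (rule lborel_pair.Fubini') measurable
  also have "\<dots> = (\<integral>\<^sup>+q. ennreal (layer_weight p q) *
      ((\<integral>\<^sup>+y. (\<integral>\<^sup>+x. G q x y \<partial>lborel) \<partial>lborel) + (\<integral>\<^sup>+y. (\<integral>\<^sup>+x. G q y x \<partial>lborel) \<partial>lborel)) \<partial>lborel)"
    by (simp add: nn_integral_cmult nn_integral_add)
  finally show ?thesis
    unfolding G2 G3 mult_2 .
qed

section \<open>Truncated kernels\<close>

text \<open>With \<open>2 * a\<close> the exponent of the seminorm, an approximation of
  \<open>r powr - (2 * a)\<close> that increases with \<open>N\<close>. The summand
  \<open>1 / real N\<close> bounds it at the origin and the cutoff bounds its support, so it is
  integrable over the whole space.\<close>

definition trunc_kernel :: "real \<Rightarrow> nat \<Rightarrow> real \<Rightarrow> real" where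
  "trunc_kernel a N r = (if r < real N then (1 / real N + r\<^sup>2) powr - a else 0)"

lemma trunc_kernel_measurable [measurable]: "trunc_kernel a N \<in> borel_measurable borel"
  unfolding trunc_kernel_def[abs_def] by measurable

lemma trunc_kernel_nonneg: "0 \<le> trunc_kernel a N r"
  by (simp add: trunc_kernel_def)

lemma trunc_kernel_decreasing:
  assumes "0 < a" "0 < N" "0 \<le> r" "r \<le> r'"
  shows "trunc_kernel a N r' \<le> trunc_kernel a N r"
proof -
  have "r\<^sup>2 \<le> r'\<^sup>2" "0 < 1 / real N"
    using assms by (auto intro: power_mono)
  moreover have "0 < 1 / real N + r\<^sup>2"
    using assms(2) by (intro add_pos_nonneg) auto
  ultimately have "(1 / real N + r'\<^sup>2) powr - a \<le> (1 / real N + r\<^sup>2) powr - a"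
    using assms by (intro powr_mono2') auto
  then show ?thesis
    using assms by (auto simp: trunc_kernel_def)
qed

text \<open>Mean value theorem: on the interval up to \<open>V\<close> the slope of
  \<open>v powr - a\<close> has modulus at least \<open>a * V powr (- a - 1)\<close>.\<close>

lemma powr_neg_diff_ge:
  fixes a u v V :: real
  assumes "0 < a" "0 < u" "u \<le> v" "v \<le> V"
  shows "v powr - a + a * V powr (- a - 1) * (v - u) \<le> u powr - a"
proof (cases "u = v")
  case False
  then have "u < v" using assms by simp
  have "\<exists>z>u. z < v \<and> v powr - a - u powr - a = (v - u) * (- a * z powr (- a - 1))"
  proof (rule MVT2[OF \<open>u < v\<close>])
    fix x assume "u \<le> x" "x \<le> v"
    then have "0 < x" using assms by simp
    then show "((\<lambda>x. x powr - a) has_real_derivative - a * x powr (- a - 1)) (at x)"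
      by (auto intro!: derivative_eq_intros)
  qed
  then obtain z where z: "u < z" "z < v" "v powr - a - u powr - a = (v - u) * (- a * z powr (- a - 1))"
    by blast
  have "V powr (- a - 1) \<le> z powr (- a - 1)"
    using assms z by (intro powr_mono2') auto
  then have "a * V powr (- a - 1) * (v - u) \<le> a * z powr (- a - 1) * (v - u)"
    using assms \<open>u < v\<close> by (intro mult_right_mono mult_left_mono) auto
  then show ?thesis
    using z(3) by (simp add: algebra_simps)
qed simp

text \<open>As a function of \<open>v = 1 / real N + (d\<^sup>2 + t\<^sup>2)\<close> the kernel is
  \<open>v powr - a\<close>, and \<open>v\<close> stays below
  \<open>1 + D\<^sup>2 + P\<^sup>2\<close>. The resulting slope depends neither on \<open>N\<close>
  nor on \<open>d\<close>; this uniformity lets the gain survive the limit in \<open>N\<close>. The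
  bound on \<open>N\<close> moves the cutoff out of the relevant range.\<close>

lemma strongly_decreasing_trunc_kernel:
  assumes "0 < a" "0 < N" and d: "0 \<le> d" "d \<le> D" and P: "D\<^sup>2 + P\<^sup>2 < (real N)\<^sup>2"
  shows "strongly_decreasing (a * (1 + D\<^sup>2 + P\<^sup>2) powr (- a - 1)) P (line_kernel (trunc_kernel a N) d)"
  unfolding strongly_decreasing_def
proof (intro conjI allI impI)
  fix s t :: real
  show "0 \<le> line_kernel (trunc_kernel a N) d t"
    by (simp add: line_kernel_def trunc_kernel_nonneg)
  assume st: "\<bar>s\<bar> \<le> \<bar>t\<bar>"
  then have sq: "s\<^sup>2 \<le> t\<^sup>2"
    by (metis abs_ge_zero power2_abs power_mono)
  show "line_kernel (trunc_kernel a N) d t \<le> line_kernel (trunc_kernel a N) d s"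
    unfolding line_kernel_def using assms sq by (intro trunc_kernel_decreasing) auto
  assume "\<bar>t\<bar> \<le> P"
  then have tP: "t\<^sup>2 \<le> P\<^sup>2"
    by (metis abs_ge_zero power2_abs power_mono)
  have dD: "d\<^sup>2 \<le> D\<^sup>2"
    using d by (simp add: power_mono)
  have lt: "sqrt (d\<^sup>2 + x\<^sup>2) < real N" if "x\<^sup>2 \<le> P\<^sup>2" for x
  proof -
    have "d\<^sup>2 + x\<^sup>2 < (real N)\<^sup>2"
      using P dD that by linarith
    then show ?thesis
      by (metis of_nat_0_le_iff real_less_lsqrt real_sqrt_less_iff real_sqrt_unique)
  qed
  have eq: "line_kernel (trunc_kernel a N) d x = (1 / real N + (d\<^sup>2 + x\<^sup>2)) powr - a" if "x\<^sup>2 \<le> P\<^sup>2" for x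
    using lt[OF that] by (simp add: line_kernel_def trunc_kernel_def)
  have "(1 / real N + (d\<^sup>2 + t\<^sup>2)) powr - a + a * (1 + D\<^sup>2 + P\<^sup>2) powr (- a - 1) *
      ((1 / real N + (d\<^sup>2 + t\<^sup>2)) - (1 / real N + (d\<^sup>2 + s\<^sup>2))) \<le> (1 / real N + (d\<^sup>2 + s\<^sup>2)) powr - a"
  proof (rule powr_neg_diff_ge)
    have "0 < 1 / real N" "1 / real N \<le> 1"
      using assms(2) by auto
    then show "0 < 1 / real N + (d\<^sup>2 + s\<^sup>2)"
      by (intro add_pos_nonneg) auto
    show "1 / real N + (d\<^sup>2 + t\<^sup>2) \<le> 1 + D\<^sup>2 + P\<^sup>2"
      using \<open>1 / real N \<le> 1\<close> tP dD by linarith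
  qed (use assms sq in auto)
  then show "line_kernel (trunc_kernel a N) d t + a * (1 + D\<^sup>2 + P\<^sup>2) powr (- a - 1) * (t\<^sup>2 - s\<^sup>2) \<le>
      line_kernel (trunc_kernel a N) d s"
    using tP sq by (simp add: eq)
qed

lemma trunc_kernel_finite:
  assumes "0 < a"
  shows "(\<integral>\<^sup>+x. ennreal (trunc_kernel a N (norm (x::'a::euclidean_space))) \<partial>lborel) < \<infinity>"
proof -
  have "ennreal (trunc_kernel a N (norm x)) \<le> ennreal ((1 / real N) powr - a) * indicator (ball 0 (real N)) x" for x :: 'a
  proof (cases "norm x < real N")
    case True
    then have "0 < real N"
      using norm_ge_zero le_less_trans by blast
    then have "(1 / real N + (norm x)\<^sup>2) powr - a \<le> (1 / real N) powr - a"
      using assms by (intro powr_mono2') auto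
    then show ?thesis using True by (simp add: trunc_kernel_def ennreal_leI)
  qed (simp add: trunc_kernel_def)
  then have "(\<integral>\<^sup>+x. ennreal (trunc_kernel a N (norm (x::'a))) \<partial>lborel) \<le>
      (\<integral>\<^sup>+x. ennreal ((1 / real N) powr - a) * indicator (ball 0 (real N)) (x::'a) \<partial>lborel)"
    by (intro nn_integral_mono)
  also have "\<dots> < \<infinity>"
    using emeasure_lborel_ball_finite[of "0::'a" "real N"]
    by (simp add: nn_integral_cmult_indicator ennreal_mult_less_top)
  finally show ?thesis .
qed

lemma trunc_kernel_LIMSEQ:
  assumes "0 < r"
  shows "(\<lambda>N. trunc_kernel a N r) \<longlonglongrightarrow> r powr - (2 * a)"
proof -
  have "(\<lambda>N. (1 / real N + r\<^sup>2) powr - a) \<longlonglongrightarrow> (0 + r\<^sup>2) powr - a"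
    using assms by (intro tendsto_powr tendsto_add tendsto_const lim_1_over_n) auto
  moreover have "(0 + r\<^sup>2) powr - a = r powr - (2 * a)"
    using assms by (simp add: powr_powr flip: powr_numeral)
  moreover have "\<forall>\<^sub>F N in sequentially. (1 / real N + r\<^sup>2) powr - a = trunc_kernel a N r"
  proof -
    obtain M where "r < real M"
      using reals_Archimedean2 by blast
    then have "\<And>N. M \<le> N \<Longrightarrow> (1 / real N + r\<^sup>2) powr - a = trunc_kernel a N r"
      by (simp add: trunc_kernel_def)
    then show ?thesis
      by (auto simp: eventually_sequentially)
  qed
  ultimately show ?thesis
    using Lim_transform_eventually by fastforce
qed

lemma trunc_kernel_index_mono:
  assumes "0 < a" "m \<le> n" "0 \<le> r"
  shows "trunc_kernel a m r \<le> trunc_kernel a n r"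
proof (cases "r < real m")
  case True
  then have "0 < m" using assms(3) by (cases m) auto
  then have "1 / real n \<le> 1 / real m" "0 < 1 / real n"
    using assms by (auto intro!: divide_left_mono)
  then have "(1 / real m + r\<^sup>2) powr - a \<le> (1 / real n + r\<^sup>2) powr - a"
    using assms by (intro powr_mono2') (auto intro: add_pos_nonneg)
  then show ?thesis using True assms by (simp add: trunc_kernel_def)
qed (simp add: trunc_kernel_def)

lemma sobolev_seminorm_eq_SUP:
  fixes F :: "real^'n \<Rightarrow> real"
  assumes "0 < s" "1 < p" and [measurable]: "F \<in> borel_measurable borel"
  defines "a \<equiv> (real CARD('n) + s * p) / 2"
  shows "sobolev_seminorm_powr s p F = (SUP N. kernel_energy p (trunc_kernel a N) F)"
    and "incseq (\<lambda>N. kernel_energy p (trunc_kernel a N) F)"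
proof -
  have a: "0 < a"
    using assms by (simp add: a_def add_pos_pos)
  define G where "G N x y = ennreal (\<bar>F x - F y\<bar> powr p) * ennreal (trunc_kernel a N (norm (x - y)))" for N x y
  have mono: "G m x y \<le> G n x y" if "m \<le> n" for m n x y
    using that a unfolding G_def by (intro mult_left_mono ennreal_leI trunc_kernel_index_mono) auto
  have lim: "ennreal (\<bar>F x - F y\<bar> powr p / norm (x - y) powr (real CARD('n) + s * p)) = (SUP N. G N x y)" for x y
  proof (cases "x = y")
    case True
    \<comment> \<open>On the diagonal the numerator vanishes and division by zero also gives 0, so
      both sides are 0.\<close>
    then show ?thesis by (simp add: G_def)
  next
    case False
    have "(\<lambda>N. ennreal (\<bar>F x - F y\<bar> powr p * trunc_kernel a N (norm (x - y)))) \<longlonglongrightarrow>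
        ennreal (\<bar>F x - F y\<bar> powr p * norm (x - y) powr - (2 * a))"
      using False by (intro tendsto_ennrealI tendsto_mult tendsto_const trunc_kernel_LIMSEQ) simp
    then have "(\<lambda>N. G N x y) \<longlonglongrightarrow> ennreal (\<bar>F x - F y\<bar> powr p * norm (x - y) powr - (2 * a))"
      by (simp add: G_def ennreal_mult trunc_kernel_nonneg)
    moreover have "(\<lambda>N. G N x y) \<longlonglongrightarrow> (SUP N. G N x y)"
      using mono by (intro LIMSEQ_SUP) (simp add: incseq_def)
    ultimately have "ennreal (\<bar>F x - F y\<bar> powr p * norm (x - y) powr - (2 * a)) = (SUP N. G N x y)"
      using LIMSEQ_unique by blast
    moreover have "2 * a = real CARD('n) + s * p"
      by (simp add: a_def)
    then have "\<bar>F x - F y\<bar> powr p * norm (x - y) powr - (2 * a) =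
        \<bar>F x - F y\<bar> powr p / norm (x - y) powr (real CARD('n) + s * p)"
      by (simp only: powr_minus_divide times_divide_eq_right mult_1_right)
    ultimately show ?thesis by simp
  qed
  have [measurable]: "(\<lambda>(x, y). G N x y) \<in> borel_measurable (borel \<Otimes>\<^sub>M borel)" for N
    unfolding G_def split_beta by measurable
  have inner: "(\<integral>\<^sup>+x. (SUP N. G N x y) \<partial>lborel) = (SUP N. \<integral>\<^sup>+x. G N x y \<partial>lborel)" for y
    by (rule nn_integral_monotone_convergence_SUP) (auto simp: incseq_def le_fun_def mono)
  show "sobolev_seminorm_powr s p F = (SUP N. kernel_energy p (trunc_kernel a N) F)"
    unfolding sobolev_seminorm_powr_def lim inner kernel_energy_def G_def[symmetric]
    by (rule nn_integral_monotone_convergence_SUP)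
       (auto simp: incseq_def le_fun_def intro!: nn_integral_mono mono)
  show "incseq (\<lambda>N. kernel_energy p (trunc_kernel a N) F)"
    unfolding kernel_energy_def G_def[symmetric] by (auto simp: incseq_def intro!: nn_integral_mono mono)
qed

section \<open>Decrease of the energy\<close>

text \<open>Quantified over all kernels, so that \<open>C\<close>, \<open>P\<close> and
  \<open>\<tau>0\<close> record only the geometry of the two sets; \<open>s\<close>,
  \<open>p\<close> and the truncation enter later through \<open>\<theta>\<close>.\<close>

definition interaction_gain :: "real \<Rightarrow> real \<Rightarrow> real \<Rightarrow> real set \<Rightarrow> real set \<Rightarrow> bool" where
  "interaction_gain C P \<tau>0 U V \<longleftrightarrow> (\<forall>\<kappa> \<theta> \<tau>. \<kappa> \<in> borel_measurable borel \<longrightarrow> strongly_decreasing \<theta> P \<kappa> \<longrightarrow>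
     0 \<le> \<theta> \<longrightarrow> 0 \<le> \<tau> \<longrightarrow> \<tau> \<le> \<tau>0 \<longrightarrow>
     interaction (\<lambda>t. ennreal (\<kappa> t)) U V + ennreal (\<theta> * C * \<tau>) \<le>
     interaction (\<lambda>t. ennreal (\<kappa> t)) (csteiner_set \<tau> U) (csteiner_set \<tau> V))"

text \<open>The two balls parametrize lines by points of the slab over which the line formula averages.
  The two ranges of levels are kept apart so that the layer weight is bounded below on them.\<close>

definition gain_configuration ::
  "(real^'n \<Rightarrow> real) \<Rightarrow> real^'n \<Rightarrow> real \<Rightarrow> real \<Rightarrow> real \<Rightarrow> real \<Rightarrow>
   real \<Rightarrow> real \<Rightarrow> real \<Rightarrow> real \<Rightarrow> real^'n \<Rightarrow> real^'n \<Rightarrow> real \<Rightarrow> bool" where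
  "gain_configuration f e c \<tau>0 C P \<alpha> \<beta> \<alpha>' \<beta>' p1 p2 r \<longleftrightarrow>
     0 < \<tau>0 \<and> 0 < C \<and> 0 < \<alpha> \<and> \<alpha> < \<beta> \<and> \<beta> < \<alpha>' \<and> \<alpha>' < \<beta>' \<and> 0 < r \<and> norm e = 1 \<and>
     ball p1 r \<subseteq> {y. e \<bullet> y \<in> {0..1}} \<and> ball p2 r \<subseteq> {y. e \<bullet> y \<in> {0..1}} \<and>
     (\<forall>y1\<in>ball p1 r. \<forall>y2\<in>ball p2 r. \<forall>h\<in>{\<alpha><..<\<beta>}. \<forall>k\<in>{\<alpha>'<..<\<beta>'}.
        interaction_gain C P \<tau>0 (slice f e (foot e c y1) k)
          (slice f e (foot e c y2) h))"

lemma dist_foot: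
  assumes "norm e = 1"
  shows "dist (foot e c y1) (foot e c y2) \<le> 2 * dist y1 y2"
proof -
  have "foot e c y1 - foot e c y2 = (y1 - y2) - (e \<bullet> (y1 - y2)) *\<^sub>R e"
    by (simp add: foot_def inner_diff_right algebra_simps)
  then have "norm (foot e c y1 - foot e c y2) \<le> norm (y1 - y2) + \<bar>e \<bullet> (y1 - y2)\<bar> * norm e"
    using norm_triangle_ineq4[of "y1 - y2" "(e \<bullet> (y1 - y2)) *\<^sub>R e"] by simp
  also have "\<bar>e \<bullet> (y1 - y2)\<bar> \<le> norm (y1 - y2)"
    using Cauchy_Schwarz_ineq2[of e "y1 - y2"] assms by simp
  finally show ?thesis
    using assms by (simp add: dist_norm)
qed

context
  fixes f :: "real^'n \<Rightarrow> real" and e :: "real^'n" and c \<tau> :: real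
  assumes cont: "continuous_on UNIV f" and e: "norm e = 1" and \<tau>: "0 \<le> \<tau>"
begin

lemma line_interaction_csteiner:
  assumes hk: "0 \<le> h" "0 \<le> k" and [measurable]: "\<kappa> \<in> borel_measurable borel"
    and sd: "symmetric_decreasing (\<lambda>t. ennreal (line_kernel \<kappa> (dist (foot e c y1) (foot e c y2)) t))"
  shows "line_interaction \<kappa> e c {x. f x > k} {x. f x > h} y1 y2 \<le>
    line_interaction \<kappa> e c {x. csteiner e c \<tau> f x > k} {x. csteiner e c \<tau> f x > h} y1 y2"
proof -
  have "\<forall>\<^sub>F m in sequentially. interaction (\<lambda>t. ennreal (line_kernel \<kappa> (dist (foot e c y1) (foot e c y2)) t))
      (slice f e (foot e c y1) (k + 1 / real (Suc m)))
      (slice f e (foot e c y2) (h + 1 / real (Suc m))) + 0 \<le>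
    interaction (\<lambda>t. ennreal (line_kernel \<kappa> (dist (foot e c y1) (foot e c y2)) t))
      (csteiner_set \<tau> (slice f e (foot e c y1) (k + 1 / real (Suc m))))
      (csteiner_set \<tau> (slice f e (foot e c y2) (h + 1 / real (Suc m))))"
    using sd \<tau> cont
    by (intro always_eventually allI) (auto intro!: interaction_csteiner_set open_line_section open_superlevel)
  from interaction_section_csteiner[OF cont e \<tau> inner_foot[OF e] inner_foot[OF e] hk _ this]
  show ?thesis
    unfolding line_interaction_def by simp
qed

lemma line_interaction_gain:
  assumes cfg: "gain_configuration f e c \<tau>0 C P \<alpha> \<beta> \<alpha>' \<beta>' p1 p2 r" and "\<tau> \<le> \<tau>0"
    and y: "y1 \<in> ball p1 r" "y2 \<in> ball p2 r" and hk: "h \<in> {\<alpha><..<\<beta>}" "k \<in> {\<alpha>'<..<\<beta>'}"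
    and [measurable]: "\<kappa> \<in> borel_measurable borel" and "0 \<le> \<theta>"
    and sd: "strongly_decreasing \<theta> P (line_kernel \<kappa> (dist (foot e c y1) (foot e c y2)))"
  shows "line_interaction \<kappa> e c {x. f x > k} {x. f x > h} y1 y2 + ennreal (\<theta> * C * \<tau>) \<le>
    line_interaction \<kappa> e c {x. csteiner e c \<tau> f x > k} {x. csteiner e c \<tau> f x > h} y1 y2"
proof -
  have near: "\<forall>\<^sub>F m in sequentially. x + 1 / real (Suc m) < b" if "x < b" for x b
  proof -
    have "(\<lambda>m. x + 1 / real (Suc m)) \<longlonglongrightarrow> x + 0"
      using LIMSEQ_inverse_real_of_nat by (intro tendsto_intros) (simp add: inverse_eq_divide)
    then show ?thesis
      using that by (intro order_tendstoD(2)) auto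
  qed
  have "\<forall>\<^sub>F m in sequentially. interaction (\<lambda>t. ennreal (line_kernel \<kappa> (dist (foot e c y1) (foot e c y2)) t))
      (slice f e (foot e c y1) (k + 1 / real (Suc m)))
      (slice f e (foot e c y2) (h + 1 / real (Suc m))) + ennreal (\<theta> * C * \<tau>) \<le>
    interaction (\<lambda>t. ennreal (line_kernel \<kappa> (dist (foot e c y1) (foot e c y2)) t))
      (csteiner_set \<tau> (slice f e (foot e c y1) (k + 1 / real (Suc m))))
      (csteiner_set \<tau> (slice f e (foot e c y2) (h + 1 / real (Suc m))))"
  proof -
    have "\<forall>\<^sub>F m in sequentially. h + 1 / real (Suc m) < \<beta>" "\<forall>\<^sub>F m in sequentially. k + 1 / real (Suc m) < \<beta>'"
      using near hk by auto
    then show ?thesis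
    proof eventually_elim
      case (elim m)
      have "h + 1 / real (Suc m) \<in> {\<alpha><..<\<beta>}" "k + 1 / real (Suc m) \<in> {\<alpha>'<..<\<beta>'}"
        using elim hk by (auto intro: less_trans add_pos_pos simp: add_strict_increasing)
      then have "interaction_gain C P \<tau>0 (slice f e (foot e c y1) (k + 1 / real (Suc m)))
          (slice f e (foot e c y2) (h + 1 / real (Suc m)))"
        using cfg y unfolding gain_configuration_def by blast
      then show ?case
        using assms \<tau> unfolding interaction_gain_def by simp
    qed
  qed
  moreover have "0 \<le> h" "0 \<le> k"
    using hk cfg by (auto simp: gain_configuration_def)
  ultimately show ?thesis
    unfolding line_interaction_def
    by (intro interaction_section_csteiner[OF cont e \<tau> inner_foot[OF e] inner_foot[OF e]]) measurable
qed

lemma emeasure_csteiner_superlevel: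
  assumes "0 \<le> h"
  shows "emeasure lborel {x. csteiner e c \<tau> f x > h} = emeasure lborel {x. f x > h}"
proof -
  have [measurable]: "csteiner e c \<tau> f \<in> borel_measurable borel" "f \<in> borel_measurable borel"
    by (intro borel_measurable_csteiner cont e \<tau> borel_measurable_continuous_onI)+
  show ?thesis
    by (subst (1 2) emeasure_lines[OF e, where c = c], measurable)
       (simp add: emeasure_section_csteiner[OF cont e \<tau> inner_foot[OF e] assms])
qed

end

section \<open>Integrating the gain over lines, levels and kernels\<close>

lemma pair_interaction_layer_measurable:
  fixes F :: "'a::euclidean_space \<Rightarrow> real"
  assumes [measurable]: "\<kappa> \<in> borel_measurable borel" "F \<in> borel_measurable borel"
  shows "(\<lambda>q. pair_interaction (\<lambda>z. ennreal (\<kappa> (norm z))) {x. F x > snd q} (- {x. F x > fst q}))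
    \<in> borel_measurable (borel :: (real \<times> real) measure)"
proof -
  have "pair_interaction (\<lambda>z. ennreal (\<kappa> (norm z))) {x. F x > snd q} (- {x. F x > fst q}) =
    (\<integral>\<^sup>+x. (\<integral>\<^sup>+y. ennreal (\<kappa> (norm (x - y))) * (if fst q < F y then 0 else 1) \<partial>lborel) *
      (if snd q < F x then 1 else 0) \<partial>lborel)" for q :: "real \<times> real"
    unfolding pair_interaction_def
    by (intro nn_integral_cong arg_cong2[of _ _ _ _ "(*)"]) (auto simp: indicator_def)
  then show ?thesis
    by (simp add: borel_prod[symmetric])
qed

text \<open>Chebyshev's inequality. It makes the constant in \<open>pair_interaction_split\<close>
  finite for integrable kernels.\<close>

lemma emeasure_superlevel_finite:
  fixes f :: "'a::euclidean_space \<Rightarrow> real"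
  assumes f: "integrable lborel f" and "0 < k"
  shows "emeasure lborel {x. f x > k} < \<infinity>"
proof -
  have [measurable]: "f \<in> borel_measurable borel"
    using f by (auto dest: borel_measurable_integrable)
  have "ennreal k * emeasure lborel {x. f x > k} = (\<integral>\<^sup>+x. ennreal k * indicator {x. f x > k} x \<partial>lborel)"
    by (rule nn_integral_cmult_indicator[symmetric]) measurable
  also have "\<dots> \<le> (\<integral>\<^sup>+x. ennreal (norm (f x)) \<partial>lborel)"
    by (intro nn_integral_mono) (auto simp: indicator_def intro!: ennreal_leI)
  also have "\<dots> < \<infinity>"
    using f by (simp add: integrable_iff_bounded)
  finally show ?thesis
    using \<open>0 < k\<close> by (auto simp: ennreal_mult_less_top)
qed

lemma ball_measure_pos: "0 < r \<Longrightarrow> 0 < measure lborel (ball (p::'a::euclidean_space) r)"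
  by (rule content_ball_pos)

text \<open>Every pair of lines loses nothing, and those indexed by the two balls gain
  \<open>\<theta> * C * \<tau>\<close>; averaging produces the two measures. Such lines are at most
  \<open>2 * (dist p1 p2 + 2 * r)\<close> apart, so a strong decrease of the line kernel is required
  only up to that distance.\<close>

lemma pair_interaction_gain:
  fixes f :: "real^'n \<Rightarrow> real"
  assumes cont: "continuous_on UNIV f" and e: "norm e = 1" and \<tau>: "0 \<le> \<tau>" "\<tau> \<le> \<tau>0"
    and cfg: "gain_configuration f e c \<tau>0 C P \<alpha> \<beta> \<alpha>' \<beta>' p1 p2 r"
    and [measurable]: "\<kappa> \<in> borel_measurable borel" and "0 \<le> \<theta>"
    and sd: "\<And>d. 0 \<le> d \<Longrightarrow> d \<le> 2 * (dist p1 p2 + 2 * r) \<Longrightarrow> strongly_decreasing \<theta> P (line_kernel \<kappa> d)"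
    and sd': "\<And>d. 0 \<le> d \<Longrightarrow> symmetric_decreasing (\<lambda>t. ennreal (line_kernel \<kappa> d t))"
    and q: "0 \<le> fst q" "0 \<le> snd q"
  shows "pair_interaction (\<lambda>z. ennreal (\<kappa> (norm z))) {x. f x > snd q} {x. f x > fst q} +
    ennreal (\<theta> * C * measure lborel (ball p1 r) * measure lborel (ball p2 r) * \<tau>) *
      indicator ({\<alpha><..<\<beta>} \<times> {\<alpha>'<..<\<beta>'}) q \<le>
    pair_interaction (\<lambda>z. ennreal (\<kappa> (norm z))) {x. csteiner e c \<tau> f x > snd q} {x. csteiner e c \<tau> f x > fst q}"
proof -
  let ?R = "{\<alpha><..<\<beta>} \<times> {\<alpha>'<..<\<beta>'}"
  let ?F = "csteiner e c \<tau> f"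
  define m1 m2 where "m1 = measure lborel (ball p1 r)" "m2 = measure lborel (ball p2 r)"
  define x where "x = ennreal (\<theta> * C * \<tau>) * indicator ?R q"
  have C: "0 < C" using cfg by (simp add: gain_configuration_def)
  have [measurable]: "?F \<in> borel_measurable borel" "f \<in> borel_measurable borel"
    by (intro borel_measurable_csteiner cont e \<tau> borel_measurable_continuous_onI)+
  let ?L = "line_interaction \<kappa> e c {x. f x > snd q} {x. f x > fst q}"
  let ?M = "line_interaction \<kappa> e c {x. ?F x > snd q} {x. ?F x > fst q}"
  have [measurable]: "ball p1 r \<in> sets borel" "ball p2 r \<in> sets borel"
    by auto
  have L_meas: "(\<lambda>(y1, y2). ?L y1 y2) \<in> borel_measurable (borel \<Otimes>\<^sub>M borel)"
    by (intro line_interaction_measurable e) measurable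
  have [measurable]: "(\<lambda>z. ?L (g1 z) (g2 z)) \<in> borel_measurable M"
    if [measurable]: "g1 \<in> M \<rightarrow>\<^sub>M borel" "g2 \<in> M \<rightarrow>\<^sub>M borel" for M :: "'c measure" and g1 g2
    using measurable_compose[OF measurable_Pair[OF that] L_meas] by simp
  have pt: "?L y1 y2 + x * indicator (ball p2 r) y2 * indicator (ball p1 r) y1 \<le> ?M y1 y2" for y1 y2
  proof (cases "q \<in> ?R \<and> y1 \<in> ball p1 r \<and> y2 \<in> ball p2 r")
    case True
    have "dist y1 y2 \<le> dist p1 p2 + 2 * r"
      using True dist_triangle[of y1 y2 p1] dist_triangle[of p1 y2 p2] by (simp add: dist_commute)
    then have "dist (foot e c y1) (foot e c y2) \<le> 2 * (dist p1 p2 + 2 * r)"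
      by (intro order_trans[OF dist_foot[OF e]]) simp
    then have "?L y1 y2 + ennreal (\<theta> * C * \<tau>) \<le> ?M y1 y2"
      using True by (intro line_interaction_gain[OF cont e \<tau>(1) cfg \<tau>(2) _ _ _ _ _ \<open>0 \<le> \<theta>\<close>] sd)
        (auto simp: mem_Times_iff)
    then show ?thesis
      using True by (simp add: x_def)
  next
    case False
    then have z: "x * indicator (ball p2 r) y2 * indicator (ball p1 r) y1 = 0"
      by (auto simp: x_def indicator_def)
    show ?thesis
      unfolding z add_0_right by (rule line_interaction_csteiner[OF cont e \<tau>(1) q _ sd']) auto
  qed
  have slab: "indicator (ball p i) y * indicator {0..1} (e \<bullet> y) = (indicator (ball p i) y :: ennreal)"
    if "ball p i \<subseteq> {y. e \<bullet> y \<in> {0..1}}" for p i y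
    using that by (auto simp: indicator_def)
  have slabs: "ball p1 r \<subseteq> {y. e \<bullet> y \<in> {0..1}}" "ball p2 r \<subseteq> {y. e \<bullet> y \<in> {0..1}}"
    using cfg by (auto simp: gain_configuration_def)
  have em: "emeasure lborel (ball p1 r) = ennreal m1" "emeasure lborel (ball p2 r) = ennreal m2"
    unfolding m1_m2_def using emeasure_lborel_ball_finite[of p1 r] emeasure_lborel_ball_finite[of p2 r]
    by (simp_all add: emeasure_eq_ennreal_measure)
  have "x * ennreal m2 * ennreal m1 = ennreal (\<theta> * C * m1 * m2 * \<tau>) * indicator ?R q"
    using C \<open>0 \<le> \<theta>\<close> \<tau> by (cases "q \<in> ?R") (simp_all add: x_def ennreal_mult[symmetric] m1_m2_def ac_simps)
  moreover have "x * ennreal m2 * ennreal m1 = (\<integral>\<^sup>+y1. (\<integral>\<^sup>+y2. x * indicator (ball p2 r) y2 * indicator {0..1} (e \<bullet> y2) \<partial>lborel) *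
      indicator (ball p1 r) y1 * indicator {0..1} (e \<bullet> y1) \<partial>lborel)"
  proof -
    have "(\<integral>\<^sup>+y2. x * indicator (ball p2 r) y2 * indicator {0..1} (e \<bullet> y2) \<partial>lborel) = x * ennreal m2"
      using slab[OF slabs(2)] by (simp add: mult.assoc nn_integral_cmult_indicator em)
    moreover have "(\<integral>\<^sup>+y1. x * ennreal m2 * indicator (ball p1 r) y1 \<partial>lborel) = x * ennreal m2 * ennreal m1"
      by (subst nn_integral_cmult_indicator) (auto simp: em)
    ultimately show ?thesis
      using slab[OF slabs(1)] by (simp only: mult.assoc)
  qed
  moreover have "pair_interaction (\<lambda>z. ennreal (\<kappa> (norm z))) {x. f x > snd q} {x. f x > fst q} + \<dots> =
      (\<integral>\<^sup>+y1. (\<integral>\<^sup>+y2. (?L y1 y2 + x * indicator (ball p2 r) y2 * indicator (ball p1 r) y1) * indicator {0..1} (e \<bullet> y2) \<partial>lborel) *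
       indicator {0..1} (e \<bullet> y1) \<partial>lborel)"
  proof -
    have "(\<integral>\<^sup>+y2. (?L y1 y2 + x * indicator (ball p2 r) y2 * indicator (ball p1 r) y1) * indicator {0..1} (e \<bullet> y2) \<partial>lborel) =
      (\<integral>\<^sup>+y2. ?L y1 y2 * indicator {0..1} (e \<bullet> y2) \<partial>lborel) +
      (\<integral>\<^sup>+y2. x * indicator (ball p2 r) y2 * indicator {0..1} (e \<bullet> y2) \<partial>lborel) * indicator (ball p1 r) y1" for y1
    proof -
      have "(\<integral>\<^sup>+y2. (?L y1 y2 + x * indicator (ball p2 r) y2 * indicator (ball p1 r) y1) * indicator {0..1} (e \<bullet> y2) \<partial>lborel) =
        (\<integral>\<^sup>+y2. ?L y1 y2 * indicator {0..1} (e \<bullet> y2) +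
          x * indicator (ball p2 r) y2 * indicator {0..1} (e \<bullet> y2) * indicator (ball p1 r) y1 \<partial>lborel)"
        by (intro nn_integral_cong) (simp add: algebra_simps)
      also have "\<dots> = (\<integral>\<^sup>+y2. ?L y1 y2 * indicator {0..1} (e \<bullet> y2) \<partial>lborel) +
          (\<integral>\<^sup>+y2. x * indicator (ball p2 r) y2 * indicator {0..1} (e \<bullet> y2) * indicator (ball p1 r) y1 \<partial>lborel)"
        by (rule nn_integral_add) measurable
      also have "(\<integral>\<^sup>+y2. x * indicator (ball p2 r) y2 * indicator {0..1} (e \<bullet> y2) * indicator (ball p1 r) y1 \<partial>lborel) =
          (\<integral>\<^sup>+y2. x * indicator (ball p2 r) y2 * indicator {0..1} (e \<bullet> y2) \<partial>lborel) * indicator (ball p1 r) y1"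
        by (rule nn_integral_multc) measurable
      finally show ?thesis .
    qed
    then have "(\<integral>\<^sup>+y1. (\<integral>\<^sup>+y2. (?L y1 y2 + x * indicator (ball p2 r) y2 * indicator (ball p1 r) y1) * indicator {0..1} (e \<bullet> y2) \<partial>lborel) *
       indicator {0..1} (e \<bullet> y1) \<partial>lborel) =
      (\<integral>\<^sup>+y1. (\<integral>\<^sup>+y2. ?L y1 y2 * indicator {0..1} (e \<bullet> y2) \<partial>lborel) * indicator {0..1} (e \<bullet> y1) +
        (\<integral>\<^sup>+y2. x * indicator (ball p2 r) y2 * indicator {0..1} (e \<bullet> y2) \<partial>lborel) *
          indicator (ball p1 r) y1 * indicator {0..1} (e \<bullet> y1) \<partial>lborel)"
      by (simp add: distrib_right)
    also have "\<dots> = pair_interaction (\<lambda>z. ennreal (\<kappa> (norm z))) {x. f x > snd q} {x. f x > fst q} +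
        (\<integral>\<^sup>+y1. (\<integral>\<^sup>+y2. x * indicator (ball p2 r) y2 * indicator {0..1} (e \<bullet> y2) \<partial>lborel) *
          indicator (ball p1 r) y1 * indicator {0..1} (e \<bullet> y1) \<partial>lborel)"
      by (subst nn_integral_add) (auto simp: pair_interaction_lines[OF e, where c = c])
    finally show ?thesis by simp
  qed
  moreover have "\<dots> \<le> (\<integral>\<^sup>+y1. (\<integral>\<^sup>+y2. ?M y1 y2 * indicator {0..1} (e \<bullet> y2) \<partial>lborel) *
       indicator {0..1} (e \<bullet> y1) \<partial>lborel)"
    by (intro nn_integral_mono mult_right_mono pt) auto
  moreover have "\<dots> = pair_interaction (\<lambda>z. ennreal (\<kappa> (norm z))) {x. ?F x > snd q} {x. ?F x > fst q}"
    by (rule pair_interaction_lines[OF e, symmetric]) measurable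
  ultimately show ?thesis
    by (simp only: m1_m2_def)
qed

text \<open>The power is increasing in the difference of levels for \<open>p \<ge> 2\<close> and
  decreasing otherwise, hence the minimum over both extreme differences.\<close>

lemma layer_weight_lower:
  assumes "1 < p" "0 < \<alpha>" "\<beta> < \<alpha>'" "q \<in> {\<alpha><..<\<beta>} \<times> {\<alpha>'<..<\<beta>'}"
  shows "p * (p - 1) * min ((\<alpha>' - \<beta>) powr (p - 2)) ((\<beta>' - \<alpha>) powr (p - 2)) \<le> layer_weight p q"
proof -
  have q: "0 < fst q" "\<alpha>' - \<beta> \<le> snd q - fst q" "snd q - fst q \<le> \<beta>' - \<alpha>" "0 < snd q - fst q"
    using assms by auto
  have "min ((\<alpha>' - \<beta>) powr (p - 2)) ((\<beta>' - \<alpha>) powr (p - 2)) \<le> (snd q - fst q) powr (p - 2)"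
  proof (cases "0 \<le> p - 2")
    case True
    then have "(\<alpha>' - \<beta>) powr (p - 2) \<le> (snd q - fst q) powr (p - 2)"
      using q assms by (intro powr_mono2) auto
    then show ?thesis by simp
  next
    case False
    then have "(\<beta>' - \<alpha>) powr (p - 2) \<le> (snd q - fst q) powr (p - 2)"
      using q assms by (intro powr_mono2') auto
    then show ?thesis by simp
  qed
  then have "p * (p - 1) * min ((\<alpha>' - \<beta>) powr (p - 2)) ((\<beta>' - \<alpha>) powr (p - 2)) \<le>
      p * (p - 1) * (snd q - fst q) powr (p - 2)"
    using assms by (intro mult_left_mono) auto
  then show ?thesis
    using q by (simp add: layer_weight_def)
qed

text \<open>Superlevel sets of \<open>f\<close> and \<open>f^\<tau>\<close> have equal measure, so
  the constants agree and each interaction gain becomes an energy loss. Weighting by the layers and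
  keeping the gain only on the rectangle of levels \<open>?R\<close> gives \<open>w\<close> times
  its area, and 2 from the layer formula.\<close>

lemma kernel_energy_decrease:
  fixes f :: "real^'n \<Rightarrow> real"
  assumes p: "1 < p" and f: "\<And>x. 0 \<le> f x" "integrable lborel f" "continuous_on UNIV f"
    and \<tau>: "0 \<le> \<tau>" "\<tau> \<le> \<tau>0"
    and cfg: "gain_configuration f e c \<tau>0 C P \<alpha> \<beta> \<alpha>' \<beta>' p1 p2 r"
    and [measurable]: "\<kappa> \<in> borel_measurable borel" and "0 \<le> \<theta>"
    and sd: "\<And>d. 0 \<le> d \<Longrightarrow> d \<le> 2 * (dist p1 p2 + 2 * r) \<Longrightarrow> strongly_decreasing \<theta> P (line_kernel \<kappa> d)"
    and sd': "\<And>d. 0 \<le> d \<Longrightarrow> symmetric_decreasing (\<lambda>t. ennreal (line_kernel \<kappa> d t))"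
    and fin: "(\<integral>\<^sup>+x. ennreal (\<kappa> (norm (x::real^'n))) \<partial>lborel) < \<infinity>"
  defines "w \<equiv> p * (p - 1) * min ((\<alpha>' - \<beta>) powr (p - 2)) ((\<beta>' - \<alpha>) powr (p - 2))"
  defines "g \<equiv> \<theta> * C * measure lborel (ball p1 r) * measure lborel (ball p2 r)"
  shows "kernel_energy p \<kappa> (csteiner e c \<tau> f) + ennreal (2 * w * (\<beta> - \<alpha>) * (\<beta>' - \<alpha>') * g * \<tau>) \<le>
    kernel_energy p \<kappa> f"
proof -
  have e: "norm e = 1" and C: "0 < C" and lv: "0 < \<alpha>" "\<alpha> < \<beta>" "\<beta> < \<alpha>'" "\<alpha>' < \<beta>'"
    using cfg by (auto simp: gain_configuration_def)
  let ?F = "csteiner e c \<tau> f"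
  let ?R = "{\<alpha><..<\<beta>} \<times> {\<alpha>'<..<\<beta>'}"
  let ?K = "\<lambda>z::real^'n. ennreal (\<kappa> (norm z))"
  have [measurable]: "?F \<in> borel_measurable borel" "f \<in> borel_measurable borel"
    by (intro borel_measurable_csteiner f e \<tau> borel_measurable_continuous_onI)+
  have "0 \<le> w" "0 \<le> g"
    using p C \<open>0 \<le> \<theta>\<close> by (auto simp: w_def g_def)
  have P: "pair_interaction ?K {x. ?F x > snd q} (- {x. ?F x > fst q}) + ennreal (g * \<tau>) * indicator ?R q \<le>
      pair_interaction ?K {x. f x > snd q} (- {x. f x > fst q})" if q: "0 < fst q" "fst q < snd q" for q
  proof -
    define Q Q' where "Q = pair_interaction ?K {x. f x > snd q} {x. f x > fst q}"
      and "Q' = pair_interaction ?K {x. ?F x > snd q} {x. ?F x > fst q}"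
    define S S' where "S = pair_interaction ?K {x. f x > snd q} (- {x. f x > fst q})"
      and "S' = pair_interaction ?K {x. ?F x > snd q} (- {x. ?F x > fst q})"
    have "S + Q = emeasure lborel {x. f x > snd q} * (\<integral>\<^sup>+x. ?K x \<partial>lborel)"
      unfolding S_def Q_def by (rule pair_interaction_split) measurable
    moreover have "S' + Q' = emeasure lborel {x. ?F x > snd q} * (\<integral>\<^sup>+x. ?K x \<partial>lborel)"
      unfolding S'_def Q'_def by (rule pair_interaction_split) measurable
    moreover have "emeasure lborel {x. ?F x > snd q} = emeasure lborel {x. f x > snd q}"
      using q by (intro emeasure_csteiner_superlevel f e \<tau>) simp
    ultimately have eq: "S' + Q' = S + Q" by simp
    have "Q + ennreal (g * \<tau>) * indicator ?R q \<le> Q'"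
      using pair_interaction_gain[OF f(3) e \<tau> cfg _ \<open>0 \<le> \<theta>\<close> sd sd', of q] q
      unfolding Q_def Q'_def g_def by simp
    then have "Q + (S' + ennreal (g * \<tau>) * indicator ?R q) \<le> Q + S"
      using eq add_left_mono[of "Q + ennreal (g * \<tau>) * indicator ?R q" Q' S'] by (simp add: ac_simps)
    \<comment> \<open>Finiteness, from the integrable kernel and the positive level, permits
      cancelling \<open>Q\<close>.\<close>
    moreover have "S + Q < \<infinity>"
      unfolding \<open>S + Q = _\<close> using fin emeasure_superlevel_finite[OF f(2), of "snd q"] q
      by (simp add: ennreal_mult_less_top)
    ultimately show ?thesis
      unfolding S_def[symmetric] S'_def[symmetric] by (auto simp: ennreal_add_left_cancel_le)
  qed
  note [measurable] = pair_interaction_layer_measurable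
  have [measurable]: "?R \<in> sets (borel :: (real \<times> real) measure)"
    by (intro borel_open open_Times) auto
  have R: "emeasure lborel ?R = ennreal ((\<beta> - \<alpha>) * (\<beta>' - \<alpha>'))"
    unfolding lborel_prod[symmetric] using lv
    by (subst lborel.emeasure_pair_measure_Times) (auto simp: ennreal_mult)
  have "ennreal (2 * w * (\<beta> - \<alpha>) * (\<beta>' - \<alpha>') * g * \<tau>) = ennreal (2 * w * (g * \<tau>)) * emeasure lborel ?R"
  proof -
    have "2 * w * (\<beta> - \<alpha>) * (\<beta>' - \<alpha>') * g * \<tau> = 2 * w * (g * \<tau>) * ((\<beta> - \<alpha>) * (\<beta>' - \<alpha>'))"
      by (simp add: algebra_simps)
    moreover have "0 \<le> 2 * w * (g * \<tau>)" "0 \<le> (\<beta> - \<alpha>) * (\<beta>' - \<alpha>')"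
      using \<open>0 \<le> w\<close> \<open>0 \<le> g\<close> \<tau> lv by auto
    ultimately show ?thesis
      unfolding R by (simp only: ennreal_mult)
  qed
  also have "\<dots> = (\<integral>\<^sup>+q. ennreal (2 * w * (g * \<tau>)) * indicator ?R q \<partial>lborel)"
    by (simp add: nn_integral_cmult_indicator)
  also have "\<dots> \<le> (\<integral>\<^sup>+q. ennreal (layer_weight p q) * (2 * (ennreal (g * \<tau>) * indicator ?R q)) \<partial>lborel)"
  proof (intro nn_integral_mono)
    fix q :: "real \<times> real"
    show "ennreal (2 * w * (g * \<tau>)) * indicator ?R q \<le>
      ennreal (layer_weight p q) * (2 * (ennreal (g * \<tau>) * indicator ?R q))"
    proof (cases "q \<in> ?R")
      case True
      have "ennreal (2 * w * (g * \<tau>)) = ennreal w * (2 * ennreal (g * \<tau>))"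
        using \<open>0 \<le> w\<close> \<open>0 \<le> g\<close> \<tau> by (simp add: ennreal_mult ac_simps)
      also have "\<dots> \<le> ennreal (layer_weight p q) * (2 * ennreal (g * \<tau>))"
        using layer_weight_lower[OF p lv(1,3) True] by (intro mult_right_mono ennreal_leI) (auto simp: w_def)
      finally show ?thesis using True by simp
    qed simp
  qed
  finally have "kernel_energy p \<kappa> ?F + ennreal (2 * w * (\<beta> - \<alpha>) * (\<beta>' - \<alpha>') * g * \<tau>) \<le>
      kernel_energy p \<kappa> ?F + (\<integral>\<^sup>+q. ennreal (layer_weight p q) * (2 * (ennreal (g * \<tau>) * indicator ?R q)) \<partial>lborel)"
    by (rule add_left_mono)
  also have "\<dots> = (\<integral>\<^sup>+q. ennreal (layer_weight p q) *
      (2 * (pair_interaction ?K {x. ?F x > snd q} (- {x. ?F x > fst q}) + ennreal (g * \<tau>) * indicator ?R q)) \<partial>lborel)"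
    using p csteiner_nonneg[OF f(3) e \<tau>(1)]
    by (subst kernel_energy_layers, simp, measurable, subst nn_integral_add[symmetric], measurable)
      (simp add: distrib_left)
  also have "\<dots> \<le> (\<integral>\<^sup>+q. ennreal (layer_weight p q) *
      (2 * pair_interaction ?K {x. f x > snd q} (- {x. f x > fst q})) \<partial>lborel)"
  proof (intro nn_integral_mono)
    fix q :: "real \<times> real"
    show "ennreal (layer_weight p q) *
        (2 * (pair_interaction ?K {x. ?F x > snd q} (- {x. ?F x > fst q}) + ennreal (g * \<tau>) * indicator ?R q)) \<le>
      ennreal (layer_weight p q) * (2 * pair_interaction ?K {x. f x > snd q} (- {x. f x > fst q}))"
    proof (cases "0 < fst q \<and> fst q < snd q")
      case True
      then show ?thesis
        using P[of q] by (intro mult_left_mono) auto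
    next
      case False
      then show ?thesis by (auto simp: layer_weight_def)
    qed
  qed
  also have "\<dots> = kernel_energy p \<kappa> f"
    using p f by (subst kernel_energy_layers) auto
  finally show ?thesis .
qed

text \<open>The loss \<open>\<gamma> * \<tau>\<close> is the same for all large \<open>N\<close>, so
  it passes to the supremum over the truncated energies, also when that supremum is
  infinite.\<close>

lemma sobolev_decrease:
  fixes f :: "real^'n \<Rightarrow> real"
  assumes s: "0 < s" and p: "1 < p"
    and f: "\<And>x. 0 \<le> f x" "integrable lborel f" "continuous_on UNIV f"
    and cfg: "gain_configuration f e c \<tau>0 C P \<alpha> \<beta> \<alpha>' \<beta>' p1 p2 r"
  shows "\<exists>\<gamma>>0. \<forall>\<tau>. 0 \<le> \<tau> \<and> \<tau> \<le> \<tau>0 \<longrightarrow>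
    sobolev_seminorm_powr s p (csteiner e c \<tau> f) + ennreal (\<gamma> * \<tau>) \<le> sobolev_seminorm_powr s p f"
proof -
  define a where "a = (real CARD('n) + s * p) / 2"
  define D where "D = 2 * (dist p1 p2 + 2 * r)"
  define \<theta> where "\<theta> = a * (1 + D\<^sup>2 + P\<^sup>2) powr (- a - 1)"
  define w where "w = p * (p - 1) * min ((\<alpha>' - \<beta>) powr (p - 2)) ((\<beta>' - \<alpha>) powr (p - 2))"
  define g where "g = \<theta> * C * measure lborel (ball p1 r) * measure lborel (ball p2 r)"
  define \<gamma> where "\<gamma> = 2 * w * (\<beta> - \<alpha>) * (\<beta>' - \<alpha>') * g"
  have e: "norm e = 1" and C: "0 < C" "0 < r" and lv: "0 < \<alpha>" "\<alpha> < \<beta>" "\<beta> < \<alpha>'" "\<alpha>' < \<beta>'"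
    using cfg by (auto simp: gain_configuration_def)
  have a: "0 < a"
    using s p by (simp add: a_def add_pos_pos)
  have "0 < 1 + D\<^sup>2 + P\<^sup>2"
    by (intro add_pos_nonneg) auto
  then have "0 < \<theta>"
    using a by (simp add: \<theta>_def)
  then have "0 < \<gamma>"
    using p C lv ball_measure_pos[OF C(2), of p1] ball_measure_pos[OF C(2), of p2]
    by (simp add: \<gamma>_def g_def w_def)
  have fm: "f \<in> borel_measurable borel"
    using f by (intro borel_measurable_continuous_onI)
  \<comment> \<open>Since \<open>real N \<le> (real N)\<^sup>2\<close>, every \<open>N > N0\<close>
    has its cutoff beyond all distances at which strong decrease is needed.\<close>
  obtain N0 where N0: "D\<^sup>2 + P\<^sup>2 < real N0"
    using reals_Archimedean2 by blast
  have main: "sobolev_seminorm_powr s p (csteiner e c \<tau> f) + ennreal (\<gamma> * \<tau>) \<le> sobolev_seminorm_powr s p f"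
    if \<tau>: "0 \<le> \<tau>" "\<tau> \<le> \<tau>0" for \<tau>
  proof -
    have Fm: "csteiner e c \<tau> f \<in> borel_measurable borel"
      by (intro borel_measurable_csteiner f e \<tau>)
    note S = sobolev_seminorm_eq_SUP[OF s p Fm, folded a_def]
    have N: "kernel_energy p (trunc_kernel a N) (csteiner e c \<tau> f) + ennreal (\<gamma> * \<tau>) \<le> sobolev_seminorm_powr s p f"
      if "N0 < N" for N
    proof -
      have "1 \<le> real N" "real N0 \<le> real N"
        using that by auto
      then have "real N \<le> (real N)\<^sup>2"
        by (simp add: power2_eq_square)
      then have big: "D\<^sup>2 + P\<^sup>2 < (real N)\<^sup>2"
        using N0 \<open>real N0 \<le> real N\<close> by linarith
      have "0 < N" using that by simp
      have "kernel_energy p (trunc_kernel a N) (csteiner e c \<tau> f) +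
          ennreal (2 * w * (\<beta> - \<alpha>) * (\<beta>' - \<alpha>') * g * \<tau>) \<le> kernel_energy p (trunc_kernel a N) f"
        unfolding w_def g_def
      proof (rule kernel_energy_decrease[OF p f \<tau> cfg])
        show "0 \<le> \<theta>" using \<open>0 < \<theta>\<close> by simp
        show "strongly_decreasing \<theta> P (line_kernel (trunc_kernel a N) d)"
          if "0 \<le> d" "d \<le> 2 * (dist p1 p2 + 2 * r)" for d
          unfolding \<theta>_def using a \<open>0 < N\<close> that big
          by (intro strongly_decreasing_trunc_kernel) (auto simp: D_def)
        show "symmetric_decreasing (\<lambda>t. ennreal (line_kernel (trunc_kernel a N) d t))" for d
        proof -
          have "line_kernel (trunc_kernel a N) d v \<le> line_kernel (trunc_kernel a N) d u" if "\<bar>u\<bar> \<le> \<bar>v\<bar>" for u v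
          proof -
            have "u\<^sup>2 \<le> v\<^sup>2"
              using that by (metis abs_ge_zero power2_abs power_mono)
            then show ?thesis
              unfolding line_kernel_def using a \<open>0 < N\<close> by (intro trunc_kernel_decreasing) auto
          qed
          then show ?thesis
            by (auto simp: symmetric_decreasing_def intro: ennreal_leI)
        qed
        show "(\<integral>\<^sup>+x. ennreal (trunc_kernel a N (norm (x::real^'n))) \<partial>lborel) < \<infinity>"
          by (rule trunc_kernel_finite[OF a])
      qed simp
      also have "\<dots> \<le> sobolev_seminorm_powr s p f"
        unfolding sobolev_seminorm_eq_SUP(1)[OF s p fm, folded a_def] by (rule SUP_upper) simp
      finally show ?thesis by (simp add: \<gamma>_def)
    qed
    have "(\<lambda>N. kernel_energy p (trunc_kernel a N) (csteiner e c \<tau> f) + ennreal (\<gamma> * \<tau>)) \<longlonglongrightarrow>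
        sobolev_seminorm_powr s p (csteiner e c \<tau> f) + ennreal (\<gamma> * \<tau>)"
      unfolding S(1) by (intro tendsto_intros LIMSEQ_SUP S(2))
    then show ?thesis
    proof (rule tendsto_upperbound)
      show "\<forall>\<^sub>F N in sequentially. kernel_energy p (trunc_kernel a N) (csteiner e c \<tau> f) + ennreal (\<gamma> * \<tau>)
          \<le> sobolev_seminorm_powr s p f"
        using eventually_gt_at_top[of N0] by eventually_elim (rule N)
    qed simp
  qed
  show ?thesis
    using \<open>0 < \<gamma>\<close> main by blast
qed

section \<open>Choice of the hyperplane\<close>

definition quasi_concave :: "('a::real_vector \<Rightarrow> real) \<Rightarrow> bool" where
  "quasi_concave f \<longleftrightarrow> (\<forall>x y u. u \<in> closed_segment x y \<longrightarrow> min (f x) (f y) \<le> f u)"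

lemma continuous_eventually_ball:
  fixes f :: "'a::metric_space \<Rightarrow> real"
  assumes "continuous_on UNIV f"
  shows "f x < a \<Longrightarrow> \<exists>r>0. \<forall>v. dist v x < r \<longrightarrow> f v < a"
    and "a < f x \<Longrightarrow> \<exists>r>0. \<forall>v. dist v x < r \<longrightarrow> a < f v"
proof -
  have tend: "(f \<longlongrightarrow> f x) (nhds x)"
    using assms by (simp add: continuous_on_eq_continuous_at continuous_within tendsto_nhds_iff)
  show "f x < a \<Longrightarrow> \<exists>r>0. \<forall>v. dist v x < r \<longrightarrow> f v < a"
    using order_tendstoD(2)[OF tend] by (simp add: eventually_nhds_metric)
  show "a < f x \<Longrightarrow> \<exists>r>0. \<forall>v. dist v x < r \<longrightarrow> a < f v"
    using order_tendstoD(1)[OF tend] by (simp add: eventually_nhds_metric)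
qed

text \<open>Sliding \<open>z\<close> along \<open>e\<close> to the middle of the unit slab leaves
  its foot unchanged. A small ball there stays in the slab and indexes lines close to the one
  through \<open>z\<close>.\<close>

lemma slab_center:
  fixes e z :: "'a::euclidean_space"
  assumes e: "norm e = 1" and z: "e \<bullet> z = c" and r: "r \<le> 1 / 2"
  shows "ball (z + (1 / 2 - c) *\<^sub>R e) r \<subseteq> {y. e \<bullet> y \<in> {0..1}}"
    and "y \<in> ball (z + (1 / 2 - c) *\<^sub>R e) r \<Longrightarrow> dist (foot e c y) z < 2 * r"
proof -
  have ee: "e \<bullet> e = 1"
    using e by (simp add: dot_square_norm)
  let ?p = "z + (1 / 2 - c) *\<^sub>R e"
  have p: "e \<bullet> ?p = 1 / 2" "foot e c ?p = z"
    using z ee by (simp_all add: foot_def inner_add_right algebra_simps)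
  show "ball ?p r \<subseteq> {y. e \<bullet> y \<in> {0..1}}"
  proof
    fix y assume "y \<in> ball ?p r"
    then have "norm (y - ?p) < r"
      by (simp add: dist_norm norm_minus_commute)
    then have "\<bar>e \<bullet> (y - ?p)\<bar> < r"
      using Cauchy_Schwarz_ineq2[of e "y - ?p"] e by simp
    moreover have "e \<bullet> (y - ?p) = e \<bullet> y - 1 / 2"
      unfolding inner_diff_right p(1) by simp
    ultimately show "y \<in> {y. e \<bullet> y \<in> {0..1}}"
      using r by (simp add: abs_less_iff)
  qed
  show "dist (foot e c y) z < 2 * r" if "y \<in> ball ?p r"
    using dist_foot[OF e, of c y ?p] that unfolding p(2) by (simp add: dist_commute)
qed

text \<open>The normal \<open>e\<close> points along the segment and the hyperplane passes through
  \<open>u\<close>; on this line \<open>u\<close> sits at 0, \<open>y\<close> at \<open>d\<close>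
  and \<open>x\<close> at \<open>- a\<close>. For levels between the bottom and both rims, slices of
  nearby lines miss a neighbourhood of 0 and contain neighbourhoods of \<open>d\<close> and
  \<open>- a\<close>, as \<open>gain_across_gap\<close> requires.\<close>

lemma gain_configuration_across_valley:
  fixes f :: "real^'n \<Rightarrow> real"
  assumes pos: "\<And>x. 0 < f x" and cont: "continuous_on UNIV f"
    and u: "u \<in> closed_segment x y" "f u < min (f x) (f y)"
  shows "\<exists>e c \<tau>0 C P \<alpha> \<beta> \<alpha>' \<beta>' p1 p2 r. gain_configuration f e c \<tau>0 C P \<alpha> \<beta> \<alpha>' \<beta>' p1 p2 r"
proof -
  obtain t where t: "0 \<le> t" "t \<le> 1" "u = (1 - t) *\<^sub>R x + t *\<^sub>R y"
    using u(1) by (auto simp: closed_segment_def)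
  have "x \<noteq> y" "t \<noteq> 0" "t \<noteq> 1"
    using t(3) u(2) by (auto simp: algebra_simps)
  then have t': "0 < t" "t < 1"
    using t by auto
  define e where "e = (y - x) /\<^sub>R norm (y - x)"
  define c where "c = e \<bullet> u"
  define d a where "d = (1 - t) * norm (y - x)" and "a = t * norm (y - x)"
  have e: "norm e = 1"
    using \<open>x \<noteq> y\<close> by (simp add: e_def)
  have da: "0 < d" "0 < a"
    using t' \<open>x \<noteq> y\<close> by (auto simp: d_def a_def)
  have ne: "norm (y - x) *\<^sub>R e = y - x"
    using \<open>x \<noteq> y\<close> by (simp add: e_def)
  have y: "u + d *\<^sub>R e = y"
    unfolding d_def scaleR_scaleR[symmetric] ne t(3) by (simp add: algebra_simps)
  have x: "u - a *\<^sub>R e = x"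
    unfolding a_def scaleR_scaleR[symmetric] ne t(3) by (simp add: algebra_simps)
  define m M where "m = f u" and "M = min (f x) (f y)"
  \<comment> \<open>Four intermediate levels: two disjoint open ranges with a gap between them, away
    from \<open>m\<close> and from \<open>M\<close>.\<close>
  define L where "L i = m + (M - m) * i / 5" for i :: real
  have mM: "0 < m" "m < M"
    using pos u by (auto simp: m_def M_def)
  have L: "m < L 1" "L 1 < L 2" "L 2 < L 3" "L 3 < L 4" "L 4 < M"
    using mM by (auto simp: L_def field_simps)
  obtain r1 where r1: "r1 > 0" "\<And>v. dist v u < r1 \<Longrightarrow> f v < L 1"
    using continuous_eventually_ball(1)[OF cont, of u "L 1"] L by (auto simp: m_def)
  obtain r2 where r2: "r2 > 0" "\<And>v. dist v x < r2 \<Longrightarrow> L 4 < f v"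
    using continuous_eventually_ball(2)[OF cont, of "L 4" x] L by (auto simp: M_def)
  obtain r3 where r3: "r3 > 0" "\<And>v. dist v y < r3 \<Longrightarrow> L 4 < f v"
    using continuous_eventually_ball(2)[OF cont, of "L 4" y] L by (auto simp: M_def)
  \<comment> \<open>One radius for lines, gap and bumps. Points considered are less than
    \<open>3 * \<eta>\<close> from \<open>u\<close>, \<open>x\<close> or \<open>y\<close>, within
    the radii of continuity; \<open>2 * \<eta> \<le> d\<close> and \<open>2 * \<eta> \<le> a\<close>
    keep the bumps outside the gap.\<close>
  define \<eta> where "\<eta> = Min {r1 / 4, r2 / 4, r3 / 4, d / 2, a / 2, 1 / 2}"
  have \<eta>: "0 < \<eta>" "4 * \<eta> \<le> r1" "4 * \<eta> \<le> r2" "4 * \<eta> \<le> r3" "2 * \<eta> \<le> d" "2 * \<eta> \<le> a" "\<eta> \<le> 1 / 2"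
    using r1 r2 r3 da unfolding \<eta>_def by (auto simp: Min_le_iff)
  let ?p = "u + (1 / 2 - c) *\<^sub>R e"
  note slab = slab_center[OF e c_def[symmetric] \<eta>(7)]
  have near: "dist (foot e c z + t *\<^sub>R e) (u + s *\<^sub>R e) < 2 * \<eta> + \<bar>t - s\<bar>" if "z \<in> ball ?p \<eta>" for z t s
  proof -
    have "dist (foot e c z + t *\<^sub>R e) (u + s *\<^sub>R e) = norm ((foot e c z - u) + (t - s) *\<^sub>R e)"
      unfolding dist_norm by (rule arg_cong[where f = norm]) (simp add: algebra_simps)
    also have "\<dots> \<le> norm (foot e c z - u) + norm ((t - s) *\<^sub>R e)"
      by (rule norm_triangle_ineq)
    also have "\<dots> = dist (foot e c z) u + \<bar>t - s\<bar>"
      using e by (simp add: dist_norm)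
    finally show ?thesis
      using slab(2)[OF that] by simp
  qed
  have gain: "interaction_gain (16 * \<eta> * \<eta>\<^sup>2) (d + a + 2 * \<eta>) \<eta>
      (slice f e (foot e c z1) k) (slice f e (foot e c z2) h)"
    if z: "z1 \<in> ball ?p \<eta>" "z2 \<in> ball ?p \<eta>" and hk: "L 1 < h" "h < L 4" "L 1 < k" "k < L 4" for z1 z2 h k
    unfolding interaction_gain_def
  proof (intro allI impI)
    fix \<kappa> \<theta> \<tau> assume \<kappa>: "\<kappa> \<in> borel_measurable borel" "strongly_decreasing \<theta> (d + a + 2 * \<eta>) \<kappa>"
      "0 \<le> \<theta>" "0 \<le> \<tau>" "\<tau> \<le> \<eta>"
    have gap: "slice f e (foot e c z) l \<inter> {- \<eta>..\<eta>} = {}" if "z \<in> ball ?p \<eta>" "L 1 < l" for z l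
    proof -
      have "f (foot e c z + s *\<^sub>R e) < L 1" if "s \<in> {- \<eta>..\<eta>}" for s
      proof (rule r1(2))
        have "\<bar>s\<bar> \<le> \<eta>" using that by (simp add: abs_le_iff)
        then show "dist (foot e c z + s *\<^sub>R e) u < r1"
          using near[OF \<open>z \<in> _\<close>, of s 0] \<eta> by simp
      qed
      then show ?thesis
        using \<open>L 1 < l\<close> by (force simp: line_section_def)
    qed
    have right: "{d - \<eta><..<d + \<eta>} \<subseteq> slice f e (foot e c z) l" if "z \<in> ball ?p \<eta>" "l < L 4" for z l
    proof
      fix s assume "s \<in> {d - \<eta><..<d + \<eta>}"
      then have "\<bar>s - d\<bar> < \<eta>" by (auto simp: abs_less_iff)
      then have "L 4 < f (foot e c z + s *\<^sub>R e)"
        using near[OF \<open>z \<in> _\<close>, of s d] \<eta> unfolding y by (intro r3(2)) simp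
      then show "s \<in> slice f e (foot e c z) l"
        using \<open>l < L 4\<close> by (simp add: line_section_def)
    qed
    have left: "{- a - \<eta><..<- a + \<eta>} \<subseteq> slice f e (foot e c z) l" if "z \<in> ball ?p \<eta>" "l < L 4" for z l
    proof
      fix s assume "s \<in> {- a - \<eta><..<- a + \<eta>}"
      then have "\<bar>s + a\<bar> < \<eta>" by (auto simp: abs_less_iff)
      then have "L 4 < f (foot e c z + s *\<^sub>R e)"
        using near[OF \<open>z \<in> _\<close>, of s "- a"] \<eta> x by (intro r2(2)) simp
      then show "s \<in> slice f e (foot e c z) l"
        using \<open>l < L 4\<close> by (simp add: line_section_def)
    qed
    have "interaction (\<lambda>t. ennreal (\<kappa> t)) (slice f e (foot e c z1) k)
        (slice f e (foot e c z2) h) + ennreal (16 * \<theta> * \<eta> * \<eta>\<^sup>2 * \<tau>) \<le>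
      interaction (\<lambda>t. ennreal (\<kappa> t)) (csteiner_set \<tau> (slice f e (foot e c z1) k))
        (csteiner_set \<tau> (slice f e (foot e c z2) h))"
      using \<kappa> z hk \<eta>
      by (intro gain_across_gap[where p = d and q = "- a"] open_line_section open_superlevel cont gap right left) auto
    then show "interaction (\<lambda>t. ennreal (\<kappa> t)) (slice f e (foot e c z1) k)
        (slice f e (foot e c z2) h) + ennreal (\<theta> * (16 * \<eta> * \<eta>\<^sup>2) * \<tau>) \<le>
      interaction (\<lambda>t. ennreal (\<kappa> t)) (csteiner_set \<tau> (slice f e (foot e c z1) k))
        (csteiner_set \<tau> (slice f e (foot e c z2) h))"
      by (simp add: ac_simps)
  qed
  have "gain_configuration f e c \<eta> (16 * \<eta> * \<eta>\<^sup>2) (d + a + 2 * \<eta>) (L 1) (L 2) (L 3) (L 4) ?p ?p \<eta>"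
    unfolding gain_configuration_def using \<eta> mM L e slab(1) by (auto intro!: gain)
  then show ?thesis by blast
qed

lemma interaction_gain_commute:
  assumes "open U" "open V" "interaction_gain C P \<tau>0 U V"
  shows "interaction_gain C P \<tau>0 V U"
  unfolding interaction_gain_def
proof (intro allI impI)
  fix \<kappa> \<theta> \<tau> assume \<kappa>: "\<kappa> \<in> borel_measurable borel" "strongly_decreasing \<theta> P \<kappa>" "0 \<le> \<theta>" "0 \<le> \<tau>" "\<tau> \<le> \<tau>0"
  have comm: "interaction (\<lambda>t. ennreal (\<kappa> t)) A B = interaction (\<lambda>t. ennreal (\<kappa> t)) B A"
    if "open A" "open B" for A B
    using \<kappa> that by (intro interaction_commute strongly_decreasing_imp) (auto simp: borel_open)
  show "interaction (\<lambda>t. ennreal (\<kappa> t)) V U + ennreal (\<theta> * C * \<tau>) \<le>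
      interaction (\<lambda>t. ennreal (\<kappa> t)) (csteiner_set \<tau> V) (csteiner_set \<tau> U)"
    using assms(3) \<kappa> comm[OF assms(1,2)] comm[OF open_csteiner_set[OF \<kappa>(4) assms(1)] open_csteiner_set[OF \<kappa>(4) assms(2)]]
    unfolding interaction_gain_def by metis
qed

text \<open>Trimming each end by at most \<open>\<delta>\<close> moves a midpoint by at most
  \<open>\<delta> / 2\<close> and leaves a length of at least \<open>2 * \<delta>\<close>. So the
  midpoints stay at least \<open>\<delta>\<close> from the origin and cannot reach it within time
  \<open>\<delta>\<close>.\<close>

lemma interaction_gain_intervals:
  assumes "0 < \<mu>" "0 < \<delta>" "2 * \<delta> \<le> \<mu>" "4 * \<delta> \<le> B - A" "4 * \<delta> \<le> B' - A'"
    and mid: "(A + B) / 2 = \<mu>" "(A' + B') / 2 = - \<mu>"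
    and ab: "A \<le> a" "a \<le> A + \<delta>" "B - \<delta> \<le> b" "b \<le> B" "A' \<le> a'" "a' \<le> A' + \<delta>" "B' - \<delta> \<le> b'" "b' \<le> B'"
  shows "interaction_gain (2 * \<delta> ^ 3) (B - A') \<delta> {a<..<b} {a'<..<b'}"
  unfolding interaction_gain_def
proof (intro allI impI)
  fix \<kappa> \<theta> \<tau> assume \<kappa>: "\<kappa> \<in> borel_measurable borel" "strongly_decreasing \<theta> (B - A') \<kappa>" "0 \<le> \<theta>" "0 \<le> \<tau>" "\<tau> \<le> \<delta>"
  have "2 * \<mu> - \<delta> \<le> a + b" "a' + b' \<le> - (2 * \<mu>) + \<delta>"
    using mid ab by (auto simp: field_simps)
  then have "interaction (\<lambda>t. ennreal (\<kappa> t)) {a<..<b} {a'<..<b'} + ennreal (2 * \<theta> * \<delta> ^ 3 * \<tau>) \<le>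
      interaction (\<lambda>t. ennreal (\<kappa> t)) (csteiner_set \<tau> {a<..<b}) (csteiner_set \<tau> {a'<..<b'})"
    using assms \<kappa> by (intro gain_of_intervals[where P = "B - A'"]) auto
  then show "interaction (\<lambda>t. ennreal (\<kappa> t)) {a<..<b} {a'<..<b'} + ennreal (\<theta> * (2 * \<delta> ^ 3) * \<tau>) \<le>
      interaction (\<lambda>t. ennreal (\<kappa> t)) (csteiner_set \<tau> {a<..<b}) (csteiner_set \<tau> {a'<..<b'})"
    by (simp add: ac_simps)
qed

lemma is_interval_line_section:
  assumes "quasi_concave f"
  shows "is_interval (slice f e z h)"
  unfolding is_interval_1
proof (intro ballI allI impI)
  fix a b x assume ab: "a \<in> slice f e z h" "b \<in> slice f e z h" "a \<le> x \<and> x \<le> b"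
  have "x \<in> closed_segment a b"
    using ab by (simp add: closed_segment_eq_real_ivl)
  then obtain t where t: "0 \<le> t" "t \<le> 1" "x = (1 - t) * a + t * b"
    by (auto simp: closed_segment_def)
  have "z + x *\<^sub>R e = (1 - t) *\<^sub>R (z + a *\<^sub>R e) + t *\<^sub>R (z + b *\<^sub>R e)"
    unfolding t(3) by (simp add: algebra_simps)
  then have "z + x *\<^sub>R e \<in> closed_segment (z + a *\<^sub>R e) (z + b *\<^sub>R e)"
    using t by (auto simp: closed_segment_def)
  then have "min (f (z + a *\<^sub>R e)) (f (z + b *\<^sub>R e)) \<le> f (z + x *\<^sub>R e)"
    using assms by (simp add: quasi_concave_def)
  then show "x \<in> slice f e z h"
    using ab by (auto simp: line_section_def)
qed

text \<open>Slightly above \<open>l\<close>, \<open>f\<close> is below the level at \<open>A\<close>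
  and \<open>B\<close> but above it at \<open>A + \<delta>\<close> and \<open>B - \<delta>\<close>.
  These strict inequalities persist on nearby lines, and as slices are intervals they trap both
  endpoints.\<close>

lemma stable_section:
  fixes f :: "real^'n \<Rightarrow> real"
  assumes cont: "continuous_on UNIV f" and qc: "quasi_concave f" and e: "norm e = 1"
    and sec: "slice f e z l = {A<..<B}" and \<delta>: "0 < \<delta>" "2 * \<delta> < B - A"
  shows "\<exists>H>l. \<forall>\<alpha> \<beta>. l < \<alpha> \<and> \<alpha> < \<beta> \<and> \<beta> < H \<longrightarrow> (\<exists>r>0. \<forall>z'. dist z' z < r \<longrightarrow>
    (\<forall>h\<in>{\<alpha><..<\<beta>}. \<exists>a b. slice f e z' h = {a<..<b} \<and>
       A \<le> a \<and> a \<le> A + \<delta> \<and> B - \<delta> \<le> b \<and> b \<le> B))"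
proof -
  have out: "f (z + A *\<^sub>R e) \<le> l" "f (z + B *\<^sub>R e) \<le> l"
  proof -
    have "A \<notin> slice f e z l" "B \<notin> slice f e z l"
      unfolding sec by auto
    then show "f (z + A *\<^sub>R e) \<le> l" "f (z + B *\<^sub>R e) \<le> l"
      by (auto simp: line_section_def)
  qed
  have ins: "l < f (z + (A + \<delta>) *\<^sub>R e)" "l < f (z + (B - \<delta>) *\<^sub>R e)"
  proof -
    have "A + \<delta> \<in> slice f e z l" "B - \<delta> \<in> slice f e z l"
      unfolding sec using \<delta> by auto
    then show "l < f (z + (A + \<delta>) *\<^sub>R e)" "l < f (z + (B - \<delta>) *\<^sub>R e)"
      by (auto simp: line_section_def)
  qed
  define H where "H = min (f (z + (A + \<delta>) *\<^sub>R e)) (f (z + (B - \<delta>) *\<^sub>R e))"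
  have "\<exists>r>0. \<forall>z'. dist z' z < r \<longrightarrow> (\<forall>h\<in>{\<alpha><..<\<beta>}. \<exists>a b. slice f e z' h = {a<..<b} \<and>
       A \<le> a \<and> a \<le> A + \<delta> \<and> B - \<delta> \<le> b \<and> b \<le> B)" if ab: "l < \<alpha>" "\<alpha> < \<beta>" "\<beta> < H" for \<alpha> \<beta>
  proof -
    have dist: "dist (z' + s *\<^sub>R e) (z + s *\<^sub>R e) = dist z' z" for z' s
      by simp
    obtain r1 where r1: "r1 > 0" "\<And>z'. dist z' z < r1 \<Longrightarrow> f (z' + A *\<^sub>R e) < \<alpha>"
      using continuous_eventually_ball(1)[OF cont, of "z + A *\<^sub>R e" \<alpha>] out ab dist by (metis le_less_trans)
    obtain r2 where r2: "r2 > 0" "\<And>z'. dist z' z < r2 \<Longrightarrow> f (z' + B *\<^sub>R e) < \<alpha>"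
      using continuous_eventually_ball(1)[OF cont, of "z + B *\<^sub>R e" \<alpha>] out ab dist by (metis le_less_trans)
    have "\<beta> < f (z + (A + \<delta>) *\<^sub>R e)" "\<beta> < f (z + (B - \<delta>) *\<^sub>R e)"
      using ab by (auto simp: H_def)
    then obtain r3 r4 where r3: "r3 > 0" "\<And>z'. dist z' z < r3 \<Longrightarrow> \<beta> < f (z' + (A + \<delta>) *\<^sub>R e)"
      and r4: "r4 > 0" "\<And>z'. dist z' z < r4 \<Longrightarrow> \<beta> < f (z' + (B - \<delta>) *\<^sub>R e)"
      using continuous_eventually_ball(2)[OF cont, of \<beta> "z + (A + \<delta>) *\<^sub>R e"]
        continuous_eventually_ball(2)[OF cont, of \<beta> "z + (B - \<delta>) *\<^sub>R e"] dist by metis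
    define r where "r = min (min r1 r2) (min r3 r4)"
    have "\<exists>a b. slice f e z' h = {a<..<b} \<and>
       A \<le> a \<and> a \<le> A + \<delta> \<and> B - \<delta> \<le> b \<and> b \<le> B" if z': "dist z' z < r" and h: "h \<in> {\<alpha><..<\<beta>}" for z' h
    proof -
      let ?S = "slice f e z' h"
      have S: "A \<notin> ?S" "B \<notin> ?S" "A + \<delta> \<in> ?S" "B - \<delta> \<in> ?S"
        using r1(2)[of z'] r2(2)[of z'] r3(2)[of z'] r4(2)[of z'] z' h by (auto simp: line_section_def r_def)
      have int: "x \<in> ?S" if "a \<in> ?S" "b \<in> ?S" "a \<le> x" "x \<le> b" for a b x
        using is_interval_line_section[OF qc, of e z' h] that unfolding is_interval_1 by blast
      have sub: "?S \<subseteq> {A<..<B}"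
      proof
        fix x assume "x \<in> ?S"
        then have "\<not> x \<le> A" "\<not> B \<le> x"
          using int[of x "A + \<delta>" A] int[of "B - \<delta>" x B] S \<delta> by auto
        then show "x \<in> {A<..<B}" by simp
      qed
      have "bounded ?S"
        using sub bounded_subset[OF bounded_closed_interval[of A B]] by (meson greaterThanLessThan_subseteq_atLeastAtMost_iff order_refl order_trans)
      then have eq: "?S = {Inf ?S<..<Sup ?S}"
        using S is_interval_line_section[OF qc, of e z' h] cont
        by (intro open_connected_bounded_eq open_line_section open_superlevel) (auto simp: is_interval_connected_1)
      have "Inf ?S < A + \<delta>" "A + \<delta> < Sup ?S" "Inf ?S < B - \<delta>" "B - \<delta> < Sup ?S"
        using S(3,4) eq by (metis greaterThanLessThan_iff)+
      moreover have "A \<le> Inf ?S" "Sup ?S \<le> B"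
        using sub S by (auto intro!: cInf_greatest cSup_least)
      ultimately show ?thesis
        using eq by (intro exI[of _ "Inf ?S"] exI[of _ "Sup ?S"]) auto
    qed
    then show ?thesis
      using r1 r2 r3 r4 by (intro exI[of _ r]) (auto simp: r_def)
  qed
  moreover have "l < H"
    using ins by (simp add: H_def)
  ultimately show ?thesis by blast
qed

text \<open>The hyperplane is put halfway between the two midpoints, so that both slices move, in
  opposite directions.\<close>

lemma gain_configuration_of_midpoints:
  fixes f :: "real^'n \<Rightarrow> real"
  assumes cont: "continuous_on UNIV f" and qc: "quasi_concave f" and e: "norm e = 1"
    and z: "e \<bullet> z1 = 0" "e \<bullet> z2 = 0" and l: "0 < l1" "0 < l2" and ab: "a1 < b1" "a2 < b2"
    and sec: "slice f e z1 l1 = {a1<..<b1}" "slice f e z2 l2 = {a2<..<b2}"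
    and mid: "a2 + b2 < a1 + b1"
  shows "\<exists>e c \<tau>0 C P \<alpha> \<beta> \<alpha>' \<beta>' p1 p2 r. gain_configuration f e c \<tau>0 C P \<alpha> \<beta> \<alpha>' \<beta>' p1 p2 r"
proof -
  \<comment> \<open>\<open>c\<close> is the mean of the two midpoints and \<open>\<mu>\<close> half
    their difference; after the shift by \<open>c\<close> the midpoints are \<open>\<mu>\<close> and
    \<open>- \<mu>\<close>.\<close>
  define c where "c = (a1 + b1 + a2 + b2) / 4"
  define \<mu> where "\<mu> = (a1 + b1 - a2 - b2) / 4"
  define A1 B1 A2 B2 where "A1 = a1 - c" and "B1 = b1 - c" and "A2 = a2 - c" and "B2 = b2 - c"
  define w1 w2 where "w1 = z1 + c *\<^sub>R e" and "w2 = z2 + c *\<^sub>R e"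
  define \<delta> where "\<delta> = Min {\<mu> / 2, (b1 - a1) / 4, (b2 - a2) / 4}"
  have \<mu>: "0 < \<mu>" "(A1 + B1) / 2 = \<mu>" "(A2 + B2) / 2 = - \<mu>"
    using mid by (auto simp: \<mu>_def A1_def B1_def A2_def B2_def c_def field_simps)
  have \<delta>: "0 < \<delta>" "2 * \<delta> \<le> \<mu>" "4 * \<delta> \<le> B1 - A1" "4 * \<delta> \<le> B2 - A2"
  proof -
    have "\<delta> \<le> \<mu> / 2" "\<delta> \<le> (b1 - a1) / 4" "\<delta> \<le> (b2 - a2) / 4"
      unfolding \<delta>_def by (intro Min_le; simp)+
    then show "2 * \<delta> \<le> \<mu>" "4 * \<delta> \<le> B1 - A1" "4 * \<delta> \<le> B2 - A2"
      by (auto simp: A1_def B1_def A2_def B2_def)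
    show "0 < \<delta>"
      using \<mu> ab by (simp add: \<delta>_def)
  qed
  have ee: "e \<bullet> e = 1"
    using e by (simp add: dot_square_norm)
  have w: "e \<bullet> w1 = c" "e \<bullet> w2 = c"
    using z ee by (auto simp: w1_def w2_def inner_add_right)
  have shift: "line_section e (z + c *\<^sub>R e) S = {t. t + c \<in> line_section e z S}" for z S
    by (auto simp: line_section_def algebra_simps)
  have sec1: "slice f e w1 l1 = {A1<..<B1}"
    unfolding w1_def shift sec A1_def B1_def by auto
  have sec2: "slice f e w2 l2 = {A2<..<B2}"
    unfolding w2_def shift sec A2_def B2_def by auto
  obtain H1 where H1: "l1 < H1" "\<And>\<alpha> \<beta>. l1 < \<alpha> \<Longrightarrow> \<alpha> < \<beta> \<Longrightarrow> \<beta> < H1 \<Longrightarrow> \<exists>r>0. \<forall>z'. dist z' w1 < r \<longrightarrow>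
    (\<forall>h\<in>{\<alpha><..<\<beta>}. \<exists>a b. slice f e z' h = {a<..<b} \<and>
       A1 \<le> a \<and> a \<le> A1 + \<delta> \<and> B1 - \<delta> \<le> b \<and> b \<le> B1)"
    using stable_section[OF cont qc e sec1 \<delta>(1)] \<delta> by force
  obtain H2 where H2: "l2 < H2" "\<And>\<alpha> \<beta>. l2 < \<alpha> \<Longrightarrow> \<alpha> < \<beta> \<Longrightarrow> \<beta> < H2 \<Longrightarrow> \<exists>r>0. \<forall>z'. dist z' w2 < r \<longrightarrow>
    (\<forall>h\<in>{\<alpha><..<\<beta>}. \<exists>a b. slice f e z' h = {a<..<b} \<and>
       A2 \<le> a \<and> a \<le> A2 + \<delta> \<and> B2 - \<delta> \<le> b \<and> b \<le> B2)"
    using stable_section[OF cont qc e sec2 \<delta>(1)] \<delta> by force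
  let ?p1 = "w1 + (1 / 2 - c) *\<^sub>R e" and ?p2 = "w2 + (1 / 2 - c) *\<^sub>R e"
  let ?S = "\<lambda>y h. slice f e (foot e c y) h"
  have gain: "\<exists>r>0. r \<le> 1 / 2 \<and> (\<forall>y1\<in>ball ?p1 r. \<forall>y2\<in>ball ?p2 r. \<forall>h\<in>{\<alpha><..<\<beta>}. \<forall>k\<in>{\<alpha>'<..<\<beta>'}.
      interaction_gain (2 * \<delta> ^ 3) (B1 - A2) \<delta> (?S y1 h) (?S y2 k))"
    if lv: "l1 < \<alpha>" "\<alpha> < \<beta>" "\<beta> < H1" "l2 < \<alpha>'" "\<alpha>' < \<beta>'" "\<beta>' < H2" for \<alpha> \<beta> \<alpha>' \<beta>'
  proof -
    obtain r1 where r1: "r1 > 0" "\<And>z' h. dist z' w1 < r1 \<Longrightarrow> h \<in> {\<alpha><..<\<beta>} \<Longrightarrow>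
        \<exists>a b. slice f e z' h = {a<..<b} \<and> A1 \<le> a \<and> a \<le> A1 + \<delta> \<and> B1 - \<delta> \<le> b \<and> b \<le> B1"
      using H1(2)[OF lv(1-3)] by blast
    obtain r2 where r2: "r2 > 0" "\<And>z' h. dist z' w2 < r2 \<Longrightarrow> h \<in> {\<alpha>'<..<\<beta>'} \<Longrightarrow>
        \<exists>a b. slice f e z' h = {a<..<b} \<and> A2 \<le> a \<and> a \<le> A2 + \<delta> \<and> B2 - \<delta> \<le> b \<and> b \<le> B2"
      using H2(2)[OF lv(4-6)] by blast
    define r where "r = Min {r1 / 2, r2 / 2, 1 / 2}"
    have r: "0 < r" "2 * r \<le> r1" "2 * r \<le> r2" "r \<le> 1 / 2"
      using r1 r2 unfolding r_def by (auto simp: Min_le_iff)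
    have "interaction_gain (2 * \<delta> ^ 3) (B1 - A2) \<delta> (?S y1 h) (?S y2 k)"
      if y: "y1 \<in> ball ?p1 r" "y2 \<in> ball ?p2 r" and hk: "h \<in> {\<alpha><..<\<beta>}" "k \<in> {\<alpha>'<..<\<beta>'}" for y1 y2 h k
    proof -
      obtain a b where I: "?S y1 h = {a<..<b}" "A1 \<le> a" "a \<le> A1 + \<delta>" "B1 - \<delta> \<le> b" "b \<le> B1"
        using r1(2)[OF _ hk(1), of "foot e c y1"] slab_center(2)[OF e w(1) r(4) y(1)] r by fastforce
      obtain a' b' where J: "?S y2 k = {a'<..<b'}" "A2 \<le> a'" "a' \<le> A2 + \<delta>" "B2 - \<delta> \<le> b'" "b' \<le> B2"
        using r2(2)[OF _ hk(2), of "foot e c y2"] slab_center(2)[OF e w(2) r(4) y(2)] r by fastforce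
      show ?thesis
        unfolding I(1) J(1) by (rule interaction_gain_intervals[OF \<mu>(1) \<delta> \<mu>(2,3) I(2-5) J(2-5)])
    qed
    then show ?thesis
      using r by blast
  qed
  have open_S: "open (?S y h)" for y h
    by (intro open_line_section open_superlevel cont)
  \<comment> \<open>The layer weight needs the levels of one slice to lie entirely below those of
    the other. Each slice is stable on levels from \<open>l1\<close> to \<open>H1\<close>,
    respectively \<open>l2\<close> to \<open>H2\<close>, and at least one of the two arrangements is
    possible; in the first the roles of the slices are exchanged by symmetry of the
    interaction.\<close>
  consider "l1 < H2" | "l2 < H1"
    using H1(1) H2(1) by linarith
  then show ?thesis
  proof cases
    case 1
    obtain \<alpha> where \<alpha>: "l1 < \<alpha>" "\<alpha> < min H1 H2" using 1 H1(1) dense[of l1 "min H1 H2"] by auto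
    obtain \<beta> where \<beta>: "\<alpha> < \<beta>" "\<beta> < min H1 H2" using \<alpha> dense by blast
    obtain \<alpha>' where \<alpha>': "max \<beta> l2 < \<alpha>'" "\<alpha>' < H2" using \<beta> H2(1) dense[of "max \<beta> l2" H2] by auto
    obtain \<beta>' where \<beta>': "\<alpha>' < \<beta>'" "\<beta>' < H2" using \<alpha>' dense by blast
    obtain r where r: "0 < r" "r \<le> 1 / 2" "\<And>y1 y2 h k. y1 \<in> ball ?p1 r \<Longrightarrow> y2 \<in> ball ?p2 r \<Longrightarrow>
        h \<in> {\<alpha><..<\<beta>} \<Longrightarrow> k \<in> {\<alpha>'<..<\<beta>'} \<Longrightarrow> interaction_gain (2 * \<delta> ^ 3) (B1 - A2) \<delta> (?S y1 h) (?S y2 k)"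
      using gain[of \<alpha> \<beta> \<alpha>' \<beta>'] \<alpha> \<beta> \<alpha>' \<beta>' by auto
    have "gain_configuration f e c \<delta> (2 * \<delta> ^ 3) (B1 - A2) \<alpha> \<beta> \<alpha>' \<beta>' ?p2 ?p1 r"
      unfolding gain_configuration_def
      using \<alpha> \<beta> \<alpha>' \<beta>' l \<delta>(1) r(1) e slab_center(1)[OF e w(1) r(2)] slab_center(1)[OF e w(2) r(2)]
      by (simp add: interaction_gain_commute[OF open_S open_S r(3)])
    then show ?thesis by blast
  next
    case 2
    obtain \<alpha> where \<alpha>: "l2 < \<alpha>" "\<alpha> < min H1 H2" using 2 H2(1) dense[of l2 "min H1 H2"] by auto
    obtain \<beta> where \<beta>: "\<alpha> < \<beta>" "\<beta> < min H1 H2" using \<alpha> dense by blast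
    obtain \<alpha>' where \<alpha>': "max \<beta> l1 < \<alpha>'" "\<alpha>' < H1" using \<beta> H1(1) dense[of "max \<beta> l1" H1] by auto
    obtain \<beta>' where \<beta>': "\<alpha>' < \<beta>'" "\<beta>' < H1" using \<alpha>' dense by blast
    obtain r where r: "0 < r" "r \<le> 1 / 2" "\<And>y1 y2 h k. y1 \<in> ball ?p1 r \<Longrightarrow> y2 \<in> ball ?p2 r \<Longrightarrow>
        h \<in> {\<alpha>'<..<\<beta>'} \<Longrightarrow> k \<in> {\<alpha><..<\<beta>} \<Longrightarrow> interaction_gain (2 * \<delta> ^ 3) (B1 - A2) \<delta> (?S y1 h) (?S y2 k)"
      using gain[of \<alpha>' \<beta>' \<alpha> \<beta>] \<alpha> \<beta> \<alpha>' \<beta>' by auto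
    have "gain_configuration f e c \<delta> (2 * \<delta> ^ 3) (B1 - A2) \<alpha> \<beta> \<alpha>' \<beta>' ?p1 ?p2 r"
      unfolding gain_configuration_def
      using \<alpha> \<beta> \<alpha>' \<beta>' l \<delta>(1) r(1) e slab_center(1)[OF e w(1) r(2)] slab_center(1)[OF e w(2) r(2)]
      by (simp add: r(3))
    then show ?thesis by blast
  qed
qed

section \<open>Rigidity\<close>

context
  fixes f :: "real^'n \<Rightarrow> real"
  assumes pos: "\<And>x. 0 < f x" and int: "integrable lborel f" and cont: "continuous_on UNIV f"
    and qc: "quasi_concave f"
begin

text \<open>By quasi-concavity a ray inside a superlevel set, together with a ball around its start,
  forces a half-cylinder into that set. Its infinite measure contradicts integrability.\<close>

lemma no_ray:
  assumes e: "norm e = 1" and "0 < h"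
  shows "\<not> (\<forall>t\<ge>0. h < f (x + t *\<^sub>R e))"
proof
  assume ray: "\<forall>t\<ge>0. h < f (x + t *\<^sub>R e)"
  define c where "c = e \<bullet> x"
  have "h < f x"
    using ray[rule_format, of 0] by simp
  then obtain \<epsilon> where \<epsilon>: "0 < \<epsilon>" "\<And>v. dist v x < \<epsilon> \<Longrightarrow> h < f v"
    using continuous_eventually_ball(2)[OF cont] by blast
  define r where "r = min (\<epsilon> / 4) (1 / 2)"
  have r: "0 < r" "4 * r \<le> \<epsilon>" "r \<le> 1 / 2"
    using \<epsilon> by (auto simp: r_def)
  let ?p = "x + (1 / 2 - c) *\<^sub>R e"
  note slab = slab_center[OF e c_def[symmetric] r(3)]
  let ?S = "\<lambda>y. slice f e (foot e c y) h"
  have inf: "emeasure lborel (?S y) = \<infinity>" if y: "y \<in> ball ?p r" for y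
  proof -
    define v where "v = foot e c y - x"
    have v: "norm v < 2 * r"
      using slab(2)[OF y] by (simp add: v_def dist_norm)
    have "{0..} \<subseteq> ?S y"
    proof
      fix t :: real assume "t \<in> {0..}"
      have "dist (x + 2 *\<^sub>R v) x < \<epsilon>"
        using v r by (simp add: dist_norm)
      then have "h < f (x + 2 *\<^sub>R v)"
        by (rule \<epsilon>(2))
      moreover have "h < f (x + (2 * t) *\<^sub>R e)"
        using ray \<open>t \<in> {0..}\<close> by simp
      \<comment> \<open>The point equals \<open>x + v + t *\<^sub>R e\<close>, the midpoint of a
        point of the ball and a point twice as far out on the ray.\<close>
      moreover have "foot e c y + t *\<^sub>R e \<in> closed_segment (x + 2 *\<^sub>R v) (x + (2 * t) *\<^sub>R e)"
        unfolding closed_segment_def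
        by (intro CollectI exI[of _ "1 / 2"]) (simp add: v_def algebra_simps scaleR_2[symmetric] flip: scaleR_add_left)
      ultimately show "t \<in> ?S y"
        using qc unfolding quasi_concave_def line_section_def by fastforce
    qed
    moreover have "emeasure lborel {0::real..} = \<infinity>"
    proof (rule ccontr)
      assume "emeasure lborel {0::real..} \<noteq> \<infinity>"
      then obtain s where s: "0 \<le> s" "emeasure lborel {0::real..} = ennreal s"
        by (cases "emeasure lborel {0::real..}") auto
      have "emeasure lborel {0..s + 1} \<le> emeasure lborel {0::real..}"
        by (intro emeasure_mono) auto
      then show False using s by simp
    qed
    ultimately show ?thesis
      using emeasure_mono[of "{0..}" "?S y" lborel] open_line_section[OF open_superlevel[OF cont]]
      by (simp add: borel_open top_unique)
  qed
  have "(\<infinity>::ennreal) = \<infinity> * emeasure lborel (ball ?p r)"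
    using ball_measure_pos[OF r(1), of ?p] by (auto simp: ennreal_top_mult measure_def)
  also have "\<dots> = (\<integral>\<^sup>+y. \<infinity> * indicator (ball ?p r) y \<partial>lborel)"
    by (subst nn_integral_cmult_indicator) auto
  also have "\<dots> \<le> (\<integral>\<^sup>+y. emeasure lborel (?S y) * indicator {0..1} (e \<bullet> y) \<partial>lborel)"
    using inf slab(1) by (intro nn_integral_mono) (auto simp: indicator_def)
  also have "\<dots> = emeasure lborel {x. f x > h}"
    using open_superlevel[OF cont] by (intro emeasure_lines[OF e, symmetric]) (auto simp: borel_open)
  also have "\<dots> < \<infinity>"
    by (rule emeasure_superlevel_finite[OF int \<open>0 < h\<close>])
  finally show False by simp
qed

lemma section_eq_interval:
  assumes e: "norm e = 1" and "0 < h" and t: "t \<in> slice f e z h"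
  shows "\<exists>a b. slice f e z h = {a<..<b}"
proof -
  let ?S = "slice f e z h"
  have conv: "x \<in> ?S" if "a \<in> ?S" "b \<in> ?S" "a \<le> x" "x \<le> b" for a b x
    using is_interval_line_section[OF qc, of e z h] that unfolding is_interval_1 by blast
  obtain s where s: "0 \<le> s" "t + s \<notin> ?S"
    using no_ray[OF e \<open>0 < h\<close>, of "z + t *\<^sub>R e"] by (auto simp: line_section_def algebra_simps not_less)
  obtain s' where s': "0 \<le> s'" "t - s' \<notin> ?S"
    using no_ray[of "- e", OF _ \<open>0 < h\<close>, of "z + t *\<^sub>R e"] e by (auto simp: line_section_def algebra_simps not_less)
  have "?S \<subseteq> {t - s'..t + s}"
  proof
    fix x assume "x \<in> ?S"
    then show "x \<in> {t - s'..t + s}"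
      using conv[OF t \<open>x \<in> ?S\<close>, of "t + s"] conv[OF \<open>x \<in> ?S\<close> t, of "t - s'"] s s' by force
  qed
  then have "bounded ?S"
    by (rule bounded_subset[OF bounded_closed_interval])
  then have "?S = {Inf ?S<..<Sup ?S}"
    using t is_interval_line_section[OF qc, of e z h] cont
    by (intro open_connected_bounded_eq open_line_section open_superlevel) (auto simp: is_interval_connected_1)
  then show ?thesis by blast
qed

text \<open>If all slices in direction \<open>e\<close> are centred at \<open>c\<close>, every
  positive level set is symmetric; comparing all levels below \<open>f x\<close> gives one
  inequality, and applying it to the mirror image gives the other.\<close>

lemma reflection_invariant:
  assumes e: "norm e = 1"
    and mid: "\<And>z h a b. e \<bullet> z = 0 \<Longrightarrow> 0 < h \<Longrightarrow> a < b \<Longrightarrow>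
      slice f e z h = {a<..<b} \<Longrightarrow> (a + b) / 2 = c"
  shows "f (x - (2 * (e \<bullet> x - c)) *\<^sub>R e) = f x"
proof -
  have ee: "e \<bullet> e = 1"
    using e by (simp add: dot_square_norm)
  have le: "f x \<le> f (x - (2 * (e \<bullet> x - c)) *\<^sub>R e)" for x
  proof (rule dense_le)
    fix h assume "h < f x"
    define t where "t = e \<bullet> x"
    define z where "z = x - t *\<^sub>R e"
    have z: "e \<bullet> z = 0" "x = z + t *\<^sub>R e"
      by (auto simp: z_def t_def inner_diff_right ee)
    \<comment> \<open>The hypothesis on midpoints concerns positive levels only, so \<open>h\<close>
      is raised to a positive level still below \<open>f x\<close>.\<close>
    define h' where "h' = max h (f x / 2)"
    have h': "0 < h'" "h' < f x" "h \<le> h'"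
      using \<open>h < f x\<close> pos[of x] by (auto simp: h'_def)
    have t: "t \<in> slice f e z h'"
      using h' z by (simp add: line_section_def)
    then obtain a b where ab: "slice f e z h' = {a<..<b}"
      using section_eq_interval[OF e h'(1)] by blast
    then have "(a + b) / 2 = c"
      using t by (intro mid[OF z(1) h'(1)]) auto
    then have "2 * c - t \<in> slice f e z h'"
      using t unfolding ab by auto
    then have "h' < f (z + (2 * c - t) *\<^sub>R e)"
      by (simp add: line_section_def)
    moreover have "z + (2 * c - t) *\<^sub>R e = x + ((2 * c - t) - t) *\<^sub>R e"
      unfolding z_def scaleR_left_diff_distrib by simp
    moreover have "(2 * c - t) - t = - (2 * (e \<bullet> x - c))"
      by (simp add: t_def)
    ultimately have "h' < f (x - (2 * (e \<bullet> x - c)) *\<^sub>R e)"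
      by (simp only: scaleR_minus_left add_uminus_conv_diff)
    then show "h \<le> f (x - (2 * (e \<bullet> x - c)) *\<^sub>R e)"
      using h' by simp
  qed
  define y where "y = x - (2 * (e \<bullet> x - c)) *\<^sub>R e"
  have "e \<bullet> y - c = - (e \<bullet> x - c)"
    by (simp add: y_def inner_diff_right ee algebra_simps)
  then have "y - (2 * (e \<bullet> y - c)) *\<^sub>R e = x"
    by (simp only: mult_minus_right scaleR_minus_left diff_minus_eq_add)
      (simp only: y_def diff_add_cancel)
  then have "f y \<le> f x"
    using le[of y] by (simp only:)
  moreover have "f x \<le> f y"
    using le[of x] by (simp only: y_def)
  ultimately show ?thesis
    unfolding y_def[symmetric] by simp
qed

text \<open>The reflections in the coordinate directions compose to a point reflection in some \<open>x0\<close>.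
  Were another mirror to miss \<open>x0\<close>, then \<open>f\<close> would be invariant under a translation.\<close>

lemma radially_decreasing_of_reflections:
  assumes refl: "\<And>e. norm e = 1 \<Longrightarrow> \<exists>c. \<forall>x. f (x - (2 * (e \<bullet> x - c)) *\<^sub>R e) = f x"
  shows "\<exists>x0. radially_decreasing_about x0 f"
proof -
  obtain m where m: "\<And>e x. norm e = 1 \<Longrightarrow> f (x - (2 * (e \<bullet> x - m e)) *\<^sub>R e) = f x"
    using refl by metis
  define x0 where "x0 = (\<Sum>b\<in>Basis. m b *\<^sub>R b)"
  \<comment> \<open>Mirrors along different basis vectors act on different coordinates, so the
    composition can be written as one sum in terms of the original \<open>x\<close>.\<close>
  have partial: "f (x - 2 *\<^sub>R (\<Sum>b\<in>S. (b \<bullet> x - m b) *\<^sub>R b)) = f x"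
    if "finite S" "S \<subseteq> Basis" for S and x :: "real^'n"
    using that
  proof (induction S)
    case (insert b S)
    define x' where "x' = x - 2 *\<^sub>R (\<Sum>b\<in>S. (b \<bullet> x - m b) *\<^sub>R b)"
    have "b \<bullet> b' = 0" if "b' \<in> S" for b'
      using insert.hyps insert.prems that by (intro inner_not_same_Basis) auto
    then have bx: "b \<bullet> x' = b \<bullet> x"
      by (simp add: x'_def inner_diff_right inner_sum_right)
    have "norm b = 1"
      using insert.prems by simp
    from m[OF this, of x'] have "f (x' - (2 * (b \<bullet> x - m b)) *\<^sub>R b) = f x'"
      by (simp add: bx)
    moreover have eq: "x' - (2 * (b \<bullet> x - m b)) *\<^sub>R b = x - 2 *\<^sub>R (\<Sum>b\<in>insert b S. (b \<bullet> x - m b) *\<^sub>R b)"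
      using insert.hyps by (simp add: x'_def scaleR_add_right)
    moreover have "f x' = f x"
      using insert unfolding x'_def by simp
    ultimately show ?case
      by (simp only:)
  qed simp
  have point: "f (2 *\<^sub>R x0 - x) = f x" for x
  proof -
    have "(\<Sum>b\<in>Basis. (b \<bullet> x - m b) *\<^sub>R b) = x - x0"
      using euclidean_representation[of x]
      by (simp add: x0_def scaleR_diff_left sum_subtractf inner_commute)
    then have "f (x - 2 *\<^sub>R (x - x0)) = f x"
      using partial[OF finite_Basis subset_refl, of x] by (simp only:)
    moreover have "x - 2 *\<^sub>R (x - x0) = 2 *\<^sub>R x0 - x"
      by (simp add: scaleR_right_diff_distrib scaleR_2)
    ultimately show ?thesis by simp
  qed
  have center: "m e = e \<bullet> x0" if e: "norm e = 1" for e
  proof (rule ccontr)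
    assume "m e \<noteq> e \<bullet> x0"
    \<comment> \<open>Point reflection followed by the mirror reverses directions orthogonal to
      \<open>e\<close> and shifts along \<open>e\<close> by twice the offset. Its square is a pure
      translation by four times the offset.\<close>
    define \<nu> where "\<nu> = 4 * (m e - e \<bullet> x0)"
    have ee: "e \<bullet> e = 1"
      using e by (simp add: dot_square_norm)
    define \<alpha> where "\<alpha> y = 2 * (e \<bullet> (2 *\<^sub>R x0 - y) - m e)" for y
    define R where "R y = 2 *\<^sub>R x0 - y - \<alpha> y *\<^sub>R e" for y
    have R: "f (R y) = f y" for y
      unfolding R_def \<alpha>_def using m[OF e] point by simp
    have "R (R y) = y + \<nu> *\<^sub>R e" for y
    proof -
      have "R (R y) = y + (\<alpha> y - \<alpha> (R y)) *\<^sub>R e"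
        unfolding R_def[of "R y"] by (simp add: R_def scaleR_left_diff_distrib)
      moreover have "\<alpha> y - \<alpha> (R y) = \<nu>"
        by (simp add: \<alpha>_def R_def inner_diff_right inner_add_right ee \<nu>_def)
      ultimately show ?thesis by simp
    qed
    then have step: "f (y + \<nu> *\<^sub>R e) = f y" for y
      using R[of "R y"] R[of y] by simp
    have iter: "f ((real n * \<nu>) *\<^sub>R e) = f 0" for n
    proof (induction n)
      case (Suc n)
      then show ?case
        using step[of "(real n * \<nu>) *\<^sub>R e"] by (simp add: algebra_simps)
    qed simp
    have "\<nu> \<noteq> 0"
      using \<open>m e \<noteq> e \<bullet> x0\<close> by (simp add: \<nu>_def)
    define e' where "e' = sgn \<nu> *\<^sub>R e"
    have "norm e' = 1"
      using \<open>\<nu> \<noteq> 0\<close> e by (simp add: e'_def abs_sgn_eq)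
    \<comment> \<open>Translation invariance repeats the value \<open>f 0\<close> arbitrarily far
      along the line, and quasi-concavity keeps \<open>f\<close> at least that large in between: a
      forbidden ray. Halving makes the bound strict.\<close>
    moreover have "f 0 / 2 < f (0 + t *\<^sub>R e')" if "0 \<le> t" for t
    proof -
      obtain n where n: "t < real n * \<bar>\<nu>\<bar>"
        using reals_Archimedean3[of "\<bar>\<nu>\<bar>"] \<open>\<nu> \<noteq> 0\<close> by auto
      define u where "u = t / (real n * \<bar>\<nu>\<bar>)"
      have u: "0 \<le> u" "u \<le> 1"
        using n that by (auto simp: u_def divide_le_eq)
      have "n \<noteq> 0"
        using n that by (cases "n = 0") auto
      then have "t *\<^sub>R e' = u *\<^sub>R ((real n * \<nu>) *\<^sub>R e)"
        using n that \<open>\<nu> \<noteq> 0\<close> by (simp add: u_def e'_def sgn_if abs_if)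
      then have "t *\<^sub>R e' \<in> closed_segment 0 ((real n * \<nu>) *\<^sub>R e)"
        unfolding closed_segment_def using u by auto
      then have "min (f 0) (f ((real n * \<nu>) *\<^sub>R e)) \<le> f (t *\<^sub>R e')"
        using qc by (simp add: quasi_concave_def)
      then show ?thesis
        using pos[of 0] unfolding iter by simp
    qed
    ultimately show False
      using no_ray[of e' "f 0 / 2" 0] pos[of 0] by auto
  qed
  have rotate: "f x = f y" if "norm (x - x0) = norm (y - x0)" for x y
  proof (cases "x = y")
    case False
    define u v where "u = x - x0" and "v = y - x0"
    have uv: "norm u = norm v" "u \<noteq> v"
      using that False by (auto simp: u_def v_def)
    \<comment> \<open>The mirror orthogonal to \<open>u - v\<close> passes through \<open>x0\<close>
      by \<open>center\<close> and exchanges \<open>x\<close> and \<open>y\<close>, as these are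
      equidistant from \<open>x0\<close>.\<close>
    define e where "e = (u - v) /\<^sub>R norm (u - v)"
    have e: "norm e = 1"
      using uv by (simp add: e_def)
    have "2 * ((u - v) \<bullet> u) = (norm (u - v))\<^sup>2"
      using uv(1) by (simp add: power2_norm_eq_inner inner_diff_left inner_diff_right inner_commute norm_eq)
    moreover have "2 * (e \<bullet> u) = 2 * ((u - v) \<bullet> u) / norm (u - v)"
      unfolding e_def inner_scaleR_left by (simp only: divide_inverse ac_simps)
    ultimately have "2 * (e \<bullet> u) = norm (u - v)"
      using uv(2) by (simp only: power2_eq_square) simp
    moreover have "norm (u - v) *\<^sub>R e = u - v"
      using uv(2) by (simp add: e_def)
    ultimately have "(2 * (e \<bullet> u)) *\<^sub>R e = u - v"
      by (simp only:)
    moreover have "e \<bullet> x - m e = e \<bullet> u"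
      by (simp add: center[OF e] u_def inner_diff_right)
    ultimately have "x - (2 * (e \<bullet> x - m e)) *\<^sub>R e = y"
      by (simp add: u_def v_def)
    then show ?thesis
      using m[OF e, of x] by simp
  qed simp
  obtain b :: "real^'n" where b: "norm b = 1"
    using norm_Basis nonempty_Basis by blast
  define \<Phi> where "\<Phi> r = f (x0 + r *\<^sub>R b)" for r
  have "f x = \<Phi> (norm (x - x0))" for x
    unfolding \<Phi>_def using b by (intro rotate) simp
  moreover have "antimono_on {0..} \<Phi>"
  proof (rule monotone_onI)
    fix r r' :: real assume r: "r \<in> {0..}" "r' \<in> {0..}" "r \<le> r'"
    show "\<Phi> r' \<le> \<Phi> r"
    proof (cases "r' = 0")
      case False
      then have "0 < r'" using r by simp
      have "f (x0 - r' *\<^sub>R b) = \<Phi> r'"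
        unfolding \<Phi>_def by (intro rotate) simp
      \<comment> \<open>The point at radius \<open>r\<close> lies between the two antipodal points
        at radius \<open>r'\<close>, where \<open>f\<close> takes the same value; quasi-concavity
        gives monotonicity.\<close>
      moreover have "x0 + r *\<^sub>R b \<in> closed_segment (x0 - r' *\<^sub>R b) (x0 + r' *\<^sub>R b)"
        unfolding closed_segment_def
      proof (intro CollectI exI conjI)
        define u where "u = (1 + r / r') / 2"
        show "0 \<le> u" "u \<le> 1"
          using r \<open>0 < r'\<close> by (auto simp: u_def divide_le_eq)
        have "r = u * r' - (1 - u) * r'"
          using \<open>0 < r'\<close> by (simp add: u_def field_simps)
        then show "x0 + r *\<^sub>R b = (1 - u) *\<^sub>R (x0 - r' *\<^sub>R b) + u *\<^sub>R (x0 + r' *\<^sub>R b)"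
          by (simp only: scaleR_left_diff_distrib scaleR_right_distrib scaleR_right_diff_distrib scaleR_scaleR) simp
      qed
      ultimately show ?thesis
        using qc unfolding quasi_concave_def \<Phi>_def by (metis min.idem)
    qed (use r in auto)
  qed
  ultimately show ?thesis
    unfolding radially_decreasing_about_def by blast
qed

end

lemma exists_gain_configuration:
  fixes f :: "real^'n \<Rightarrow> real"
  assumes pos: "\<And>x. 0 < f x" and int: "integrable lborel f" and cont: "continuous_on UNIV f"
    and not_radial: "\<not> (\<exists>x0. radially_decreasing_about x0 f)"
  shows "\<exists>e c \<tau>0 C P \<alpha> \<beta> \<alpha>' \<beta>' p1 p2 r. gain_configuration f e c \<tau>0 C P \<alpha> \<beta> \<alpha>' \<beta>' p1 p2 r"
proof (cases "quasi_concave f")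
  case False
  then obtain x y u where "u \<in> closed_segment x y" "f u < min (f x) (f y)"
    unfolding quasi_concave_def by (meson not_le)
  then show ?thesis
    by (rule gain_configuration_across_valley[OF pos cont])
next
  case qc: True
  have "\<exists>e. norm e = 1 \<and> (\<forall>c. \<exists>z h a b. e \<bullet> z = 0 \<and> 0 < h \<and> a < b \<and>
      slice f e z h = {a<..<b} \<and> (a + b) / 2 \<noteq> c)"
  proof (rule ccontr)
    assume "\<not> ?thesis"
    then have "\<exists>c. \<forall>x. f (x - (2 * (e \<bullet> x - c)) *\<^sub>R e) = f x" if "norm e = 1" for e
      using reflection_invariant[OF pos int cont qc that] that by metis
    with not_radial show False
      using radially_decreasing_of_reflections[OF pos int cont qc] by blast
  qed
  then obtain e where e: "norm e = 1" "\<And>c. \<exists>z h a b. e \<bullet> z = 0 \<and> 0 < h \<and> a < b \<and>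
      slice f e z h = {a<..<b} \<and> (a + b) / 2 \<noteq> c"
    by blast
  obtain z1 h1 a1 b1 where 1: "e \<bullet> z1 = 0" "0 < h1" "a1 < b1"
      "slice f e z1 h1 = {a1<..<b1}"
    using e(2) by blast
  obtain z2 h2 a2 b2 where 2: "e \<bullet> z2 = 0" "0 < h2" "a2 < b2"
      "slice f e z2 h2 = {a2<..<b2}" "(a2 + b2) / 2 \<noteq> (a1 + b1) / 2"
    using e(2) by blast
  consider "a2 + b2 < a1 + b1" | "a1 + b1 < a2 + b2"
    using 2(5) by force
  then show ?thesis
  proof cases
    case 1
    show ?thesis
      by (rule gain_configuration_of_midpoints[OF cont qc e(1) \<open>e \<bullet> z1 = 0\<close> 2(1) \<open>0 < h1\<close> 2(2)
          \<open>a1 < b1\<close> 2(3) \<open>_ = {a1<..<b1}\<close> 2(4) 1])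
  next
    case 2
    show ?thesis
      by (rule gain_configuration_of_midpoints[OF cont qc e(1) \<open>e \<bullet> z2 = 0\<close> \<open>e \<bullet> z1 = 0\<close> \<open>0 < h2\<close> \<open>0 < h1\<close>
          \<open>a2 < b2\<close> \<open>a1 < b1\<close> \<open>_ = {a2<..<b2}\<close> \<open>_ = {a1<..<b1}\<close> 2])
  qed
qed

theorem theorem1p1:
  fixes f :: "real^'n \<Rightarrow> real"
  assumes "\<And>x. f x > 0"
    and "integrable lborel f"
    and "continuous_on UNIV f"
    and "\<not> (\<exists>x0. radially_decreasing_about x0 f)"
  shows "\<exists>\<tau>0>0. \<forall>s p. 0 < s \<and> s < 1 \<and> 1 < p \<longrightarrow>
    (\<exists>\<gamma>>0. \<exists>e c. norm e = 1 \<and>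
      (\<forall>\<tau>. 0 \<le> \<tau> \<and> \<tau> \<le> \<tau>0 \<longrightarrow>
        enn2ereal (sobolev_seminorm_powr s p (csteiner e c \<tau> f))
          \<le> enn2ereal (sobolev_seminorm_powr s p f) - ereal (\<gamma> * \<tau>)))"
proof -
  \<comment> \<open>The configuration depends on \<open>f\<close> alone, so \<open>\<tau>0\<close>
    and the hyperplane are fixed before \<open>s\<close> and \<open>p\<close>.\<close>
  obtain e c \<tau>0 C P \<alpha> \<beta> \<alpha>' \<beta>' p1 p2 r where cfg: "gain_configuration f e c \<tau>0 C P \<alpha> \<beta> \<alpha>' \<beta>' p1 p2 r"
    using exists_gain_configuration[OF assms] by blast
  then have "0 < \<tau>0" "norm e = 1"
    by (auto simp: gain_configuration_def)
  \<comment> \<open>Only the finite gain is moved to the other side, so the subtraction is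
    legitimate even for an infinite seminorm.\<close>
  have ereal: "enn2ereal a \<le> enn2ereal b - ereal g" if "a + ennreal g \<le> b" "0 \<le> g" for a b g
  proof -
    have "enn2ereal (a + ennreal g) \<le> enn2ereal b"
      using that(1) by (simp add: less_eq_ennreal.rep_eq)
    then have "enn2ereal a + ereal g \<le> enn2ereal b"
      using that(2) by (simp add: plus_ennreal.rep_eq enn2ereal_ennreal)
    then show ?thesis
      by (simp add: ereal_le_minus)
  qed
  have "\<exists>\<gamma>>0. \<exists>e c. norm e = 1 \<and> (\<forall>\<tau>. 0 \<le> \<tau> \<and> \<tau> \<le> \<tau>0 \<longrightarrow>
      enn2ereal (sobolev_seminorm_powr s p (csteiner e c \<tau> f))
        \<le> enn2ereal (sobolev_seminorm_powr s p f) - ereal (\<gamma> * \<tau>))" if sp: "0 < s" "1 < p" for s p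
  proof -
    obtain \<gamma> where \<gamma>: "0 < \<gamma>" "\<And>\<tau>. 0 \<le> \<tau> \<Longrightarrow> \<tau> \<le> \<tau>0 \<Longrightarrow>
        sobolev_seminorm_powr s p (csteiner e c \<tau> f) + ennreal (\<gamma> * \<tau>) \<le> sobolev_seminorm_powr s p f"
      using sobolev_decrease[OF sp less_imp_le[OF assms(1)] assms(2,3) cfg] by blast
    then show ?thesis
      using \<open>norm e = 1\<close> by (intro exI[of _ \<gamma>] conjI exI[of _ e] exI[of _ c]) (auto intro!: ereal)
  qed
  then show ?thesis
    using \<open>0 < \<tau>0\<close> by blast
qed

end
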